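(* Let $\Theta\subseteq\mathbb{R}^l$ be a closed convex set, let $f:\mathbb{R}^n\times\mathbb{R}^m\to\mathbb{R}^n$ and $g:\mathbb{R}^n\times\mathbb{R}^m\to\mathbb{R}^{n\times l}$ be smooth with $f(0,0)=0$, $g(0,0)=0$, and consider the control system $\dot x=f(x,u)+g(x,u)\theta$ with state $x\in\mathbb{R}^n$, input $u\in\mathbb{R}^m$ and constant unknown parameter $\theta\in\Theta$. Suppose there are a smooth mapping $k:\Theta\times\mathbb{R}^n\to\mathbb{R}^m$ with $k(\theta,0)=0$ for all $\theta\in\Theta$, a constant $\sigma>0$, and a continuous mapping $V:\Theta\times\mathbb{R}^n\to\mathbb{R}_+$ such that for each $\theta\in\Theta$ the function $V(\theta,\cdot)$ is continuously differentiable, positive definite and radially unbounded, and such that: (i) for each $\theta\in\Theta$, $0\in\mathbb{R}^n$ is globally asymptotically stable for $\dot x=f(x,k(\theta,x))+g(x,k(\theta,x))\theta$; more specifically, $\nabla V(\theta,x)\big(f(x,k(\theta,x))+g(x,k(\theta,x))\theta\big)\le-2\sigma V(\theta,x)$ for all $\theta\in\Theta$, $x\in\mathbb{R}^n$ (gradient with respect to $x$); (ii) for every non-empty compact set $\bar\Theta\subseteq\Theta$ and every $M\ge0$ there exists $R>0$ such that $V(\theta,x)\le M$ and $\theta\in\bar\Theta$ imply $|x|\le R$. Let $T>0$ be a constant and let $a:\mathbb{R}^n\to\mathbb{R}_+$ be continuous and positive definite. Then there exists a family of class $KL$ functions $\omega_{\theta,\hat\theta}$, parameterized by $\theta\in\Theta$,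 $\hat\theta\in\Theta$, such that for every $\theta\in\Theta$, $x_0\in\mathbb{R}^n$, $\hat\theta_0\in\Theta$ the solution of the hybrid closed-loop system (the plant with the event-triggered adaptive controller and batch least-squares identifier built from $k,V,a,T$ as described in the context) with $x(0)=x_0$, $\hat\theta(0)=\hat\theta_0$ is unique, is defined for all $t\ge0$, and satisfies $|x(t)|\le\omega_{\theta,\hat\theta_0}(|x_0|,t)$ for all $t\ge0$. Moreover, there exist $\tau\ge0$ and $\theta_s\in\Theta$ (both depending on $\theta,x_0,\hat\theta_0$) such that $\hat\theta(t)=\theta_s$ for all $t\ge\tau$, and $g(x(t),u(t))(\theta-\theta_s)=0$ for all $t\ge0$. Finally, suppose that $N$ is a positive integer with the following parameter observability property: for every set of times $0=\tau_0<\tau_1<\dots<\tau_N$ and for all vectors $\theta,d_0,\dots,d_N\in\Theta$ with $d_i\neq0$ for $i=0,\dots,N$, the only right differentiable mapping $x\in C^0([0,\tau_N];\mathbb{R}^n)\cap C^1([0,\tau_N]\setminus\{\tau_0,\dots,\tau_N\};\mathbb{R}^n)$ satisfying both $\dot x(t)=f(x(t),k(\theta+d_i,x(t)))+g(x(t),k(\theta+d_i,x(t)))\theta$ for $t\in[\tau_i,\tau_{i+1})$, $i=0,\dots,N-1$, and $g(x(t),k(\theta+d_j,x(t)))d_{i+1}=0$ for all $t\in[\tau_j,\tau_{j+1}]$, $i=0,\dots,N-1$, $j=0,\dots,i$, is the identically zero mapping, i.e. $x(t)=0$ for all $t\in[0,\tau_N]$. If in addition $x_0\ne0$, then the solution of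 the hybrid closed-loop system satisfies $\hat\theta(t)=\theta$ for all $t\ge NT$.
   Context: Notation: $|\cdot|$ is the Euclidean norm, $\mathbb{R}_+=[0,\infty)$, $\mathbb{Z}_+=\{0,1,2,\dots\}$, $A'$ is the transpose of $A$. $V:\mathbb{R}^n\to\mathbb{R}_+$ is positive definite if $V(0)=0$ and $V(x)>0$ for $x\ne0$; a continuous $V:\mathbb{R}^n\to\mathbb{R}_+$ is radially unbounded if $\{x:V(x)\le M\}$ is compact for every $M>0$. Class $K$: continuous strictly increasing functions $\mathbb{R}_+\to\mathbb{R}_+$ vanishing at $0$. Class $KL$: continuous $\omega:\mathbb{R}_+\times\mathbb{R}_+\to\mathbb{R}_+$ such that $\omega(\cdot,t)$ is of class $K$ for each $t\ge 0$, and $\omega(s,\cdot)$ is non-increasing with $\lim_{t\to+\infty}\omega(s,t)=0$ for each $s\ge 0$. Hybrid closed-loop system. Given $k,V,a,T$ and the (unknown to the controller) parameter $\theta\in\Theta$, a solution consists of a continuous function $x(t)\in\mathbb{R}^n$, a right-continuous piecewise constant function $\hat\theta(t)\in\Theta$, and event times $0=\tau_0<\tau_1<\tau_2<\dots$ such that: (1) Control between events: for $t\in[\tau_i,\tau_{i+1})$, $i\in\mathbb{Z}_+$, one has $\hat\theta(t)=\hat\theta(\tau_i)$, $u(t)=k(\hat\theta(\tau_i),x(t))$ and $\dot x(t)=f(x(t),u(t))+g(x(t),u(t))\theta$ (right derivative at $t=\tau_i$). (2) Event times: $\tau_{i+1}=\min(\tau_i+T,r_i)$, where, if $x(\tau_i)\ne0$,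 $$r_i=\inf\{t>\tau_i:\ V(\hat\theta(\tau_i),x(t))=V(\hat\theta(\tau_i),x(\tau_i))+a(x(\tau_i))\}$$ with $x(t)$ the solution of the plant started from $x(\tau_i)$ at time $\tau_i$ with $u(t)=k(\hat\theta(\tau_i),x(t))$ ($r_i=+\infty$ if no such $t$ exists), and $r_i=\tau_i+T$ if $x(\tau_i)=0$. (3) Parameter update (batch least-squares identifier): with $$p(t,s)=x(t)-x(s)-\int_s^t f(x(r),u(r))\,dr,\qquad q(t,s)=\int_s^t g(x(r),u(r))\,dr,$$ $\hat\theta(\tau_{i+1})$ is the unique minimizer of $|\vartheta-\hat\theta(\tau_i)|^2$ over all $\vartheta\in\Theta$ satisfying $$\int_0^{\tau_{i+1}}\!\!\int_0^{\tau_{i+1}} q'(t,s)p(t,s)\,ds\,dt=\Big(\int_0^{\tau_{i+1}}\!\!\int_0^{\tau_{i+1}} q'(t,s)q(t,s)\,ds\,dt\Big)\vartheta .$$ (The constraint set is non-empty, since it contains $\theta$.)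
   Formalization: In the parameter observability property, the condition that the d_i lie in Θ is replaced by θ+d_i ∈ Θ (with θ ∈ Θ, d_i ≠ 0), since k is only defined on Θ×ℝⁿ and the last claim fails with d_i ∈ Θ, e.g. for Θ=[1,2], f=-x, g=u, k=0.1(θ-1.5)x, N=1. *)

theory Defs
  imports "HOL-Analysis.Analysis"
begin

primrec Ck_on :: "nat \<Rightarrow> 'a::real_normed_vector set \<Rightarrow> ('a \<Rightarrow> 'b::real_normed_vector) \<Rightarrow> bool" where
  "Ck_on 0 U F \<longleftrightarrow> continuous_on U F"
| "Ck_on (Suc k) U F \<longleftrightarrow>
     (\<forall>x\<in>U. F differentiable (at x)) \<and> (\<forall>v. Ck_on k U (\<lambda>x. frechet_derivative F (at x) v))"

(* Derivatives are only taken on open sets.  On a set that is not open (such as Theta x R^n),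
   smoothness means that near every point the map is the restriction of a C^infinity map
   defined on an open set of the ambient space. *)
definition smooth_on :: "'a::real_normed_vector set \<Rightarrow> ('a \<Rightarrow> 'b::real_normed_vector) \<Rightarrow> bool" where
  "smooth_on S F \<longleftrightarrow>
     (\<forall>z\<in>S. \<exists>U G. open U \<and> z \<in> U \<and> (\<forall>k. Ck_on k U G) \<and> (\<forall>y\<in>U \<inter> S. G y = F y))"

definition gradient :: "('a::real_inner \<Rightarrow> real) \<Rightarrow> 'a \<Rightarrow> 'a" where
  "gradient h x = (THE D. GDERIV h x :> D)"

definition positive_definite :: "('a::real_normed_vector \<Rightarrow> real) \<Rightarrow> bool" where
  "positive_definite h \<longleftrightarrow> (\<forall>x. 0 \<le> h x) \<and> h 0 = 0 \<and> (\<forall>x. x \<noteq> 0 \<longrightarrow> 0 < h x)"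

definition radially_unbounded :: "('a::real_normed_vector \<Rightarrow> real) \<Rightarrow> bool" where
  "radially_unbounded h \<longleftrightarrow> (\<forall>M>0. compact {x. h x \<le> M})"

definition class_K :: "(real \<Rightarrow> real) \<Rightarrow> bool" where
  "class_K \<gamma> \<longleftrightarrow>
     \<gamma> ` {0..} \<subseteq> {0..} \<and> continuous_on {0..} \<gamma> \<and> strict_mono_on {0..} \<gamma> \<and> \<gamma> 0 = 0"

definition class_KL :: "(real \<Rightarrow> real \<Rightarrow> real) \<Rightarrow> bool" where
  "class_KL \<omega> \<longleftrightarrow>
     continuous_on ({0..} \<times> {0..}) (\<lambda>(s, t). \<omega> s t) \<and>
     (\<forall>t\<ge>0. class_K (\<lambda>s. \<omega> s t)) \<and>
     (\<forall>s\<ge>0. antimono_on {0..} (\<omega> s) \<and> (\<omega> s \<longlongrightarrow> 0) at_top)"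

(* The derivative is relative to J, hence one-sided at an endpoint of J that belongs to J. *)
definition ode_solution ::
    "('a::real_normed_vector \<Rightarrow> 'a) \<Rightarrow> real set \<Rightarrow> (real \<Rightarrow> 'a) \<Rightarrow> bool" where
  "ode_solution F J x \<longleftrightarrow> (\<forall>t\<in>J. (x has_vector_derivative F (x t)) (at t within J))"

definition globally_asymptotically_stable :: "('a::real_normed_vector \<Rightarrow> 'a) \<Rightarrow> bool" where
  "globally_asymptotically_stable F \<longleftrightarrow>
     (\<forall>x0. \<exists>x. ode_solution F {0..} x \<and> x 0 = x0) \<and>
     (\<forall>\<epsilon>>0. \<exists>\<delta>>0. \<forall>x. ode_solution F {0..} x \<and> norm (x 0) < \<delta> \<longrightarrow> (\<forall>t\<ge>0. norm (x t) < \<epsilon>)) \<and>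
     (\<forall>x. ode_solution F {0..} x \<longrightarrow> (x \<longlongrightarrow> 0) at_top)"

definition closed_loop_field ::
    "((real^'n) \<times> (real^'m) \<Rightarrow> real^'n) \<Rightarrow> ((real^'n) \<times> (real^'m) \<Rightarrow> real^'l^'n) \<Rightarrow>
     ((real^'l) \<times> (real^'n) \<Rightarrow> real^'m) \<Rightarrow> real^'l \<Rightarrow> real^'l \<Rightarrow> real^'n \<Rightarrow> real^'n" where
  "closed_loop_field f g k \<theta> \<theta>h x = f (x, k (\<theta>h, x)) + g (x, k (\<theta>h, x)) *v \<theta>"

definition input_signal ::
    "((real^'l) \<times> (real^'n) \<Rightarrow> real^'m) \<Rightarrow> (real \<Rightarrow> real^'n) \<Rightarrow> (real \<Rightarrow> real^'l) \<Rightarrow> real \<Rightarrow> real^'m"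
  where "input_signal k x \<theta>h t = k (\<theta>h t, x t)"

(* r_i of the event trigger, started at time t0 in state x0 with parameter estimate th0.
   xi is the solution of the plant with the estimate frozen at th0; it need only exist up to the
   candidate time t, so times beyond a finite escape are excluded.  The infimum is
   taken in ereal, where Inf {} is infinity. *)
definition trigger_time ::
    "((real^'n) \<times> (real^'m) \<Rightarrow> real^'n) \<Rightarrow> ((real^'n) \<times> (real^'m) \<Rightarrow> real^'l^'n) \<Rightarrow>
     ((real^'l) \<times> (real^'n) \<Rightarrow> real^'m) \<Rightarrow> ((real^'l) \<times> (real^'n) \<Rightarrow> real) \<Rightarrow> (real^'n \<Rightarrow> real) \<Rightarrow> real \<Rightarrow>
     real^'l \<Rightarrow> real \<Rightarrow> real^'n \<Rightarrow> real^'l \<Rightarrow> ereal" where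
  "trigger_time f g k V a T \<theta> t0 x0 \<theta>0 =
     (if x0 = 0 then ereal (t0 + T)
      else Inf (ereal ` {t. t0 < t \<and>
             (\<exists>\<xi>. ode_solution (closed_loop_field f g k \<theta> \<theta>0) {t0..t} \<xi> \<and> \<xi> t0 = x0 \<and>
                  V (\<theta>0, \<xi> t) = V (\<theta>0, x0) + a x0)}))"

(* The interval Lebesgue integral is oriented, as needed for t < s. *)
definition p_data ::
    "((real^'n) \<times> (real^'m) \<Rightarrow> real^'n) \<Rightarrow> (real \<Rightarrow> real^'n) \<Rightarrow> (real \<Rightarrow> real^'m) \<Rightarrow>
     real \<Rightarrow> real \<Rightarrow> real^'n" where
  "p_data f x u t s = x t - x s - (LBINT r=ereal s..ereal t. f (x r, u r))"

definition q_data ::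
    "((real^'n) \<times> (real^'m) \<Rightarrow> real^'l^'n) \<Rightarrow> (real \<Rightarrow> real^'n) \<Rightarrow> (real \<Rightarrow> real^'m) \<Rightarrow>
     real \<Rightarrow> real \<Rightarrow> real^'l^'n" where
  "q_data g x u t s = (LBINT r=ereal s..ereal t. g (x r, u r))"

definition normal_equation ::
    "((real^'n) \<times> (real^'m) \<Rightarrow> real^'n) \<Rightarrow> ((real^'n) \<times> (real^'m) \<Rightarrow> real^'l^'n) \<Rightarrow>
     (real \<Rightarrow> real^'n) \<Rightarrow> (real \<Rightarrow> real^'m) \<Rightarrow> real \<Rightarrow> real^'l \<Rightarrow> bool" where
  "normal_equation f g x u t1 \<eta> \<longleftrightarrow>
     (LBINT t=ereal 0..ereal t1. (LBINT s=ereal 0..ereal t1.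
        transpose (q_data g x u t s) *v p_data f x u t s)) =
     (LBINT t=ereal 0..ereal t1. (LBINT s=ereal 0..ereal t1.
        transpose (q_data g x u t s) ** q_data g x u t s)) *v \<eta>"

definition unique_minimizer :: "('a \<Rightarrow> real) \<Rightarrow> ('a \<Rightarrow> bool) \<Rightarrow> 'a \<Rightarrow> bool" where
  "unique_minimizer h P z \<longleftrightarrow> is_arg_min h P z \<and> (\<forall>y. is_arg_min h P y \<longrightarrow> y = z)"

definition time_domain :: "(nat \<Rightarrow> real) \<Rightarrow> real set" where
  "time_domain \<tau> = (\<Union>i. {\<tau> i..<\<tau> (Suc i)})"

(* A solution lives on time_domain tau, i.e. on [0, sup tau_i), which is a bounded interval
   when the event times accumulate.  Values of x and \<theta>h outside it are irrelevant. *)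
definition hybrid_solution ::
    "(real^'l) set \<Rightarrow> ((real^'n) \<times> (real^'m) \<Rightarrow> real^'n) \<Rightarrow> ((real^'n) \<times> (real^'m) \<Rightarrow> real^'l^'n) \<Rightarrow>
     ((real^'l) \<times> (real^'n) \<Rightarrow> real^'m) \<Rightarrow> ((real^'l) \<times> (real^'n) \<Rightarrow> real) \<Rightarrow> (real^'n \<Rightarrow> real) \<Rightarrow> real \<Rightarrow>
     real^'l \<Rightarrow> (real \<Rightarrow> real^'n) \<Rightarrow> (real \<Rightarrow> real^'l) \<Rightarrow> (nat \<Rightarrow> real) \<Rightarrow> bool" where
  "hybrid_solution \<Theta> f g k V a T \<theta> x \<theta>h \<tau> \<longleftrightarrow>
     \<tau> 0 = 0 \<and> strict_mono \<tau> \<and>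
     continuous_on (time_domain \<tau>) x \<and>
     (\<forall>t\<in>time_domain \<tau>. \<theta>h t \<in> \<Theta>) \<and>
     (\<forall>i.
        (\<forall>t\<in>{\<tau> i..<\<tau> (Suc i)}. \<theta>h t = \<theta>h (\<tau> i)) \<and>
        ode_solution (closed_loop_field f g k \<theta> (\<theta>h (\<tau> i))) {\<tau> i..<\<tau> (Suc i)} x \<and>
        ereal (\<tau> (Suc i)) =
          min (ereal (\<tau> i + T)) (trigger_time f g k V a T \<theta> (\<tau> i) (x (\<tau> i)) (\<theta>h (\<tau> i))) \<and>
        unique_minimizer (\<lambda>\<eta>. (norm (\<eta> - \<theta>h (\<tau> i)))\<^sup>2)
          (\<lambda>\<eta>. \<eta> \<in> \<Theta> \<and> normal_equation f g x (input_signal k x \<theta>h) (\<tau> (Suc i)) \<eta>)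
          (\<theta>h (\<tau> (Suc i))))"

(* The d_i are parameter errors: k is only given on Theta x R^n, so the feedback k(theta + d_i, .)
   makes sense exactly when theta + d_i lies in Theta.  That, rather than d_i in Theta, is
   the membership required here; the two agree when Theta is the whole space.
   ode_solution gives the right differentiability at the times tau_i. *)
definition parameter_observable ::
    "(real^'l) set \<Rightarrow> ((real^'n) \<times> (real^'m) \<Rightarrow> real^'n) \<Rightarrow> ((real^'n) \<times> (real^'m) \<Rightarrow> real^'l^'n) \<Rightarrow>
     ((real^'l) \<times> (real^'n) \<Rightarrow> real^'m) \<Rightarrow> nat \<Rightarrow> bool" where
  "parameter_observable \<Theta> f g k N \<longleftrightarrow>
     (\<forall>\<tau> \<theta> d x.
        \<tau> 0 = 0 \<and> (\<forall>i<N. \<tau> i < \<tau> (Suc i)) \<and>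
        \<theta> \<in> \<Theta> \<and> (\<forall>i\<le>N. \<theta> + d i \<in> \<Theta> \<and> d i \<noteq> 0) \<and>
        continuous_on {0..\<tau> N} x \<and>
        x C1_differentiable_on ({0..\<tau> N} - \<tau> ` {..N}) \<and>
        (\<forall>i<N. ode_solution (closed_loop_field f g k \<theta> (\<theta> + d i)) {\<tau> i..<\<tau> (Suc i)} x) \<and>
        (\<forall>i<N. \<forall>j\<le>i. \<forall>t\<in>{\<tau> j..\<tau> (Suc j)}. g (x t, k (\<theta> + d j, x t)) *v d (Suc i) = 0)
        \<longrightarrow> (\<forall>t\<in>{0..\<tau> N}. x t = 0))"

end

theory Submission
  imports Defs
begin

text \<open>Along a solution the data satisfy \<open>p = q \<theta>\<close>, so the normal equation at \<open>\<tau>\<^sub>i\<close> says exactly that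
  \<open>\<vartheta> - \<theta>\<close> lies in the subspace \<open>N\<^sub>i\<close> of all \<open>w\<close> with \<open>g(x, u) w = 0\<close> on \<open>[0, \<tau>\<^sub>i)\<close>, and the
  new estimate is the projection of the old one onto \<open>\<Theta> \<inter> (\<theta> + N\<^sub>i)\<close>. Hence the estimation error
  never grows, and an update that changes the estimate lowers \<open>dim N\<^sub>i\<close>, which happens at most \<open>l\<close>
  times. When an update leaves the estimate unchanged, the plant has moved as if the estimate were
  the true parameter, so \<open>V\<close> has decayed exponentially, the event was not triggered and the full
  time \<open>T\<close> has elapsed: there is no Zeno behaviour. The remaining, at most \<open>l\<close>, intervals last at
  most \<open>T\<close> and the trigger bounds the growth of \<open>V\<close> on them by a gain that is uniform over a compact
  parameter set; composing the gains with the decay along the longest unchanged stretch gives the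
  \<open>KL\<close> bound.\<close>

section \<open>Lipschitz continuity and comparison functions\<close>

text \<open>Three obstacles shape the proof. With a wrong estimate nothing excludes a finite escape
  of the plant; only the trigger confines the state, up to the next event, to a bounded sublevel set
  of \<open>V\<close>. Inter-event solutions are therefore built from a field cut off outside a
  ball. Next, \<open>V\<close> itself depends on the estimate, so values of \<open>V\<close> before
  and after a change can be compared only through \<open>norm x\<close>. This is why each gain is
  composed of two class K functions, one for each direction of that comparison; both may depend only
  on the true parameter and the initial estimate. Finally, the gains are nonlinear and need not
  commute with an exponential factor, so the decay of several stretches cannot be accumulated
  through them. One stretch suffices: at most \<open>l\<close> changes leave at most
  \<open>l + 1\<close> stretches, one of which lasts at least \<open>t / (l + 1) - T\<close>. This
  is the origin of the rate \<open>2 * \<sigma> / (l + 1)\<close> and of the constant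
  \<open>exp (2 * \<sigma> * T)\<close>.\<close>

lemma Ck_on_one_imp_local_lipschitz:
  fixes G :: "'a::euclidean_space \<Rightarrow> 'b::real_normed_vector"
  assumes G: "Ck_on 1 U G" and U: "open U" and z: "z \<in> U"
  obtains e L where "e > 0" "L-lipschitz_on (cball z e) G" "cball z e \<subseteq> U"
proof -
  obtain e where e: "e > 0" "cball z e \<subseteq> U"
    using U z open_contains_cball by blast
  have diff: "G differentiable (at x)" if "x \<in> U" for x
    using G that by simp
  have cont: "continuous_on (cball z e) (\<lambda>x. frechet_derivative G (at x) b)" for b
    using G e(2) by (auto intro: continuous_on_subset)
  \<comment> \<open>\<open>Ck_on\<close> gives continuity of each directional derivative separately,
    not of the derivative as an operator. Bounds for the finitely many basis directions add up to a
    bound \<open>L\<close> on the operator norm.\<close>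
  have "\<exists>B. \<forall>x\<in>cball z e. norm (frechet_derivative G (at x) b) \<le> B" for b
    using compact_imp_bounded[OF compact_continuous_image[OF cont[of b] compact_cball]]
    by (auto simp: bounded_iff)
  then obtain B where B: "\<And>b x. x \<in> cball z e \<Longrightarrow> norm (frechet_derivative G (at x) b) \<le> B b"
    by metis
  have B0: "0 \<le> B b" for b
    using B[of z b] e(1) norm_ge_zero order_trans by (metis centre_in_cball less_imp_le)
  define L where "L = (\<Sum>b\<in>Basis. B b)"
  have hd: "(G has_derivative frechet_derivative G (at x)) (at x)" if "x \<in> cball z e" for x
    using diff e(2) that frechet_derivative_works by blast
  have on: "onorm (frechet_derivative G (at x)) \<le> L" if x: "x \<in> cball z e" for x
  proof (rule onorm_le)
    fix v
    interpret bounded_linear "frechet_derivative G (at x)"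
      using hd[OF x] by (rule has_derivative_bounded_linear)
    have "frechet_derivative G (at x) v = frechet_derivative G (at x) (\<Sum>b\<in>Basis. (v \<bullet> b) *\<^sub>R b)"
      by (simp add: euclidean_representation)
    also have "\<dots> = (\<Sum>b\<in>Basis. (v \<bullet> b) *\<^sub>R frechet_derivative G (at x) b)"
      by (simp add: sum scaleR)
    also have "norm \<dots> \<le> (\<Sum>b\<in>Basis. B b * norm v)"
    proof (rule sum_norm_le)
      fix b :: 'a assume b: "b \<in> Basis"
      have "norm ((v \<bullet> b) *\<^sub>R frechet_derivative G (at x) b)
          = \<bar>v \<bullet> b\<bar> * norm (frechet_derivative G (at x) b)" by simp
      also have "\<dots> \<le> norm v * B b"
        using B[OF x, of b] Basis_le_norm[OF b, of v] by (intro mult_mono) auto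
      finally show "norm ((v \<bullet> b) *\<^sub>R frechet_derivative G (at x) b) \<le> B b * norm v"
        by (simp add: mult.commute)
    qed
    finally show "norm (frechet_derivative G (at x) v) \<le> L * norm v"
      by (simp add: L_def sum_distrib_right)
  qed
  have "L-lipschitz_on (cball z e) G"
  proof (rule lipschitz_onI)
    fix x y assume xy: "x \<in> cball z e" "y \<in> cball z e"
    have "norm (G x - G y) \<le> L * norm (x - y)"
      by (rule differentiable_bound[OF convex_cball has_derivative_at_withinI[OF hd] on xy])
    then show "dist (G x) (G y) \<le> L * dist x y" by (simp add: dist_norm)
  qed (use B0 in \<open>auto simp: L_def intro: sum_nonneg\<close>)
  then show thesis using that e by blast
qed

lemma smooth_on_imp_lipschitz_on_compact:
  fixes F :: "'a::euclidean_space \<Rightarrow> 'b::real_normed_vector"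
  assumes F: "smooth_on S F" and K: "compact K" "K \<subseteq> S"
  shows "\<exists>L. L-lipschitz_on K F"
proof -
  \<comment> \<open>The singleton time set makes \<open>F\<close> an instance of the time-dependent
    notion, and compactness of \<open>K\<close> then turns the local constants into one, with no
    convexity of \<open>K\<close>.\<close>
  have "local_lipschitz {0::real} K (\<lambda>_. F)"
  proof (rule local_lipschitzI)
    fix t :: real and z assume t: "t \<in> {0}" and z: "z \<in> K"
    then obtain U G where U: "open U" "z \<in> U" "Ck_on 1 U G" "\<And>y. y \<in> U \<inter> S \<Longrightarrow> G y = F y"
      using F K(2) unfolding smooth_on_def by (metis subsetD)
    then obtain e L where eL: "e > 0" "L-lipschitz_on (cball z e) G" "cball z e \<subseteq> U"
      using Ck_on_one_imp_local_lipschitz by metis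
    have "G y = F y" if "y \<in> cball z e \<inter> K" for y
      using that eL(3) U(4) K(2) by blast
    then have "L-lipschitz_on (cball z e \<inter> K) F"
      using lipschitz_on_transform[OF lipschitz_on_subset[OF eL(2), of "cball z e \<inter> K"]] by auto
    then show "\<exists>u>0. \<exists>L. \<forall>t\<in>cball t u \<inter> {0}. L-lipschitz_on (cball z u \<inter> K) F"
      using eL(1) by blast
  qed
  then obtain L where "\<And>t. t \<in> {0::real} \<Longrightarrow> L-lipschitz_on K F"
    using K(1) by (rule local_lipschitz_compact_implies_lipschitz) auto
  then show ?thesis by blast
qed

text \<open>\<open>gradient\<close> is a definite description, so it carries information only once
  the Riesz vector of the derivative is known to exist and to be unique.\<close>

lemma gradient_works:
  fixes h :: "'a::euclidean_space \<Rightarrow> real"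
  assumes "h differentiable (at x)"
  shows "(h has_derivative (\<lambda>v. v \<bullet> gradient h x)) (at x)"
proof -
  obtain h' where h': "(h has_derivative h') (at x)"
    using assms differentiable_def by blast
  define D where "D = (\<Sum>b\<in>Basis. h' b *\<^sub>R b)"
  interpret bounded_linear h' using h' by (rule has_derivative_bounded_linear)
  have "h' v = v \<bullet> D" for v
  proof -
    have "h' v = h' (\<Sum>b\<in>Basis. (v \<bullet> b) *\<^sub>R b)" by (simp add: euclidean_representation)
    also have "\<dots> = v \<bullet> D"
      by (simp add: sum scaleR D_def inner_sum_right mult.commute)
    finally show ?thesis .
  qed
  then have D: "GDERIV h x :> D"
    using h' unfolding gderiv_def by (simp add: ext[of h' "\<lambda>v. v \<bullet> D"])
  have "D' = D" if "GDERIV h x :> D'" for D'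
  proof -
    have "(\<lambda>v. v \<bullet> D') = (\<lambda>v. v \<bullet> D)"
      using D that has_derivative_unique unfolding gderiv_def by blast
    then have "\<And>v. v \<bullet> D' = v \<bullet> D" by meson
    then show ?thesis by (metis vector_eq_ldot)
  qed
  then have "gradient h x = D"
    unfolding gradient_def using D by (rule the_equality[rotated])
  then show ?thesis using D unfolding gderiv_def by simp
qed

section \<open>Comparison functions: calculus and construction\<close>

lemma
  assumes "class_K \<alpha>"
  shows class_K_nonneg: "\<And>s. 0 \<le> s \<Longrightarrow> 0 \<le> \<alpha> s"
    and class_K_strict_mono: "\<And>s t. 0 \<le> s \<Longrightarrow> s < t \<Longrightarrow> \<alpha> s < \<alpha> t"
    and class_K_mono: "\<And>s t. 0 \<le> s \<Longrightarrow> s \<le> t \<Longrightarrow> \<alpha> s \<le> \<alpha> t"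
    and class_K_zero: "\<alpha> 0 = 0"
    and class_K_continuous_on: "continuous_on {0..} \<alpha>"
proof -
  show "\<And>s. 0 \<le> s \<Longrightarrow> 0 \<le> \<alpha> s" "\<alpha> 0 = 0" "continuous_on {0..} \<alpha>"
    using assms by (auto simp: class_K_def)
  show st: "\<And>s t. 0 \<le> s \<Longrightarrow> s < t \<Longrightarrow> \<alpha> s < \<alpha> t"
    using assms by (auto simp: class_K_def strict_mono_on_def)
  show "\<And>s t. 0 \<le> s \<Longrightarrow> s \<le> t \<Longrightarrow> \<alpha> s \<le> \<alpha> t"
    using st by (metis less_eq_real_def order_refl)
qed

lemma class_K_compose:
  assumes "class_K \<alpha>" "class_K \<beta>" shows "class_K (\<lambda>s. \<alpha> (\<beta> s))"
  unfolding class_K_def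
proof (intro conjI)
  show "continuous_on {0..} (\<lambda>s. \<alpha> (\<beta> s))"
    using class_K_nonneg[OF assms(2)]
    by (intro continuous_on_compose2[OF class_K_continuous_on[OF assms(1)] class_K_continuous_on[OF assms(2)]])
       auto
  show "strict_mono_on {0..} (\<lambda>s. \<alpha> (\<beta> s))"
    using class_K_strict_mono[OF assms(1)] class_K_strict_mono[OF assms(2)] class_K_nonneg[OF assms(2)]
    by (simp add: strict_mono_on_def)
  show "(\<lambda>s. \<alpha> (\<beta> s)) ` {0..} \<subseteq> {0..}"
    using class_K_nonneg[OF assms(1)] class_K_nonneg[OF assms(2)] by auto
  show "\<alpha> (\<beta> 0) = 0"
    by (simp add: class_K_zero[OF assms(1)] class_K_zero[OF assms(2)])
qed

lemma class_K_funpow: "class_K \<alpha> \<Longrightarrow> class_K (\<alpha> ^^ n)"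
proof (induction n)
  case 0 then show ?case by (auto simp: class_K_def strict_mono_on_def continuous_on_id)
next
  case (Suc n)
  then show ?case using class_K_compose[of \<alpha> "\<alpha> ^^ n"] by (simp add: o_def)
qed

text \<open>Averaging a nondecreasing function \<open>h\<close> over \<open>{s..2 * s}\<close> makes it continuous without losing
  monotonicity, and the average still dominates \<open>h s\<close>.\<close>

lemma class_K_dominates_mono:
  fixes h :: "real \<Rightarrow> real"
  assumes mono: "\<And>s t. 0 \<le> s \<Longrightarrow> s \<le> t \<Longrightarrow> h s \<le> h t" and h0: "h 0 = 0"
    and lim: "\<And>\<epsilon>. 0 < \<epsilon> \<Longrightarrow> \<exists>\<delta>>0. h \<delta> \<le> \<epsilon>"
  obtains \<alpha> where "class_K \<alpha>" "\<And>s. 0 \<le> s \<Longrightarrow> s \<le> \<alpha> s" "\<And>s. 0 \<le> s \<Longrightarrow> h s \<le> \<alpha> s"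
proof -
  have nonneg: "0 \<le> h s" if "0 \<le> s" for s using mono[of 0 s] h0 that by simp
  define I where "I s = integral {1..2} (\<lambda>v. h (s * v))" for s
  \<comment> \<open>The summand \<open>s\<close> supplies strictness, which the average of a locally
    constant \<open>h\<close> lacks, and makes \<open>\<alpha>\<close> dominate the
    identity.\<close>
  define \<alpha> where "\<alpha> s = s + I s" for s
  have int_h: "h integrable_on {a..b}" if "0 \<le> a" for a b
    using that mono by (intro integrable_on_mono_on) (auto simp: mono_on_def)
  have int: "(\<lambda>v. h (s * v)) integrable_on {1..2}" if "0 \<le> s" for s
    using that by (intro integrable_on_mono_on) (auto simp: mono_on_def intro!: mono mult_left_mono)
  have Imono: "I s \<le> I t" if "0 \<le> s" "s \<le> t" for s t
    unfolding I_def using that int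
    by (intro integral_le) (auto intro!: mono mult_right_mono)
  have lower: "h s \<le> I s" if "0 \<le> s" for s
  proof -
    have "integral {1..2::real} (\<lambda>v. h s) \<le> I s"
      unfolding I_def using that int mult_left_mono[of 1 _ s] by (intro integral_le) (auto intro!: mono)
    then show ?thesis by simp
  qed
  have upper: "I s \<le> h (2 * s)" if "0 \<le> s" for s
  proof -
    have "I s \<le> integral {1..2::real} (\<lambda>v. h (2 * s))"
      unfolding I_def using that int mult_left_mono[of _ 2 s]
      by (intro integral_le) (auto intro!: mono simp: mult.commute[of 2])
    then show ?thesis by simp
  qed
  have I0: "I 0 = 0" by (simp add: I_def h0)
  \<comment> \<open>Rescaling by \<open>s\<close> expresses the average through the indefinite
    integral of \<open>h\<close>, which is continuous however \<open>h\<close> jumps.\<close>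
  have Ieq: "I s = (integral {0..2 * s} h - integral {0..s} h) / s" if s: "0 < s" for s
  proof -
    have "(h has_integral integral {s..2 * s} h) {s..2 * s}"
      using int_h[of s "2 * s"] s by (simp add: integrable_integral)
    from has_integral_stretch_real[OF this, of s] s
    have "((\<lambda>v. h (s * v)) has_integral (1/s) * integral {s..2 * s} h) {1..2}"
      by (simp add: image_divide_atLeastAtMost field_simps)
    then have "I s = (1/s) * integral {s..2 * s} h"
      unfolding I_def by (rule integral_unique)
    moreover have "integral {0..s} h + integral {s..2 * s} h = integral {0..2 * s} h"
      using s int_h by (intro Henstock_Kurzweil_Integration.integral_combine) auto
    ultimately show ?thesis by (simp add: field_simps)
  qed
  have Hc: "continuous_on {0..b} (\<lambda>t. integral {0..t} h)" for b
    using int_h by (intro indefinite_integral_continuous_1) auto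
  have contpos: "isCont I s" if s: "0 < s" for s
  proof -
    have H: "isCont (\<lambda>t. integral {0..t} h) t" if "0 < t" for t
      using continuous_on_interior[OF Hc[of "t+1"], of t] that by simp
    have "isCont (\<lambda>s. integral {0..2 * s} h) s"
      using isCont_o2[of s "\<lambda>s. 2 * s" "\<lambda>t. integral {0..t} h"] H[of "2 * s"] s by simp
    then have "isCont (\<lambda>s. (integral {0..2 * s} h - integral {0..s} h) / s) s"
      using H[OF s] s by (intro continuous_intros) auto
    moreover have "eventually (\<lambda>s. I s = (integral {0..2 * s} h - integral {0..s} h) / s) (nhds s)"
      using eventually_nhds_in_open[of "{0<..}" s] s by (auto elim!: eventually_mono simp: Ieq)
    ultimately show ?thesis by (subst isCont_cong)
  qed
  have Icont: "continuous_on {0..} I"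
    unfolding continuous_on_eq_continuous_within
  proof
    fix s :: real assume s: "s \<in> {0..}"
    show "continuous (at s within {0..}) I"
    proof (cases "s = 0")
      case True
      \<comment> \<open>The quotient formula breaks down at 0. There \<open>I y\<close> is squeezed
        between 0 and \<open>h (2 * y)\<close>, and smallness of \<open>h\<close> near 0
        enters.\<close>
      show ?thesis unfolding continuous_within_eps_delta
      proof (intro allI impI)
        fix e :: real assume "0 < e"
        then obtain d where d: "d > 0" "h d \<le> e / 2" using lim[of "e/2"] by auto
        show "\<exists>d>0. \<forall>x'\<in>{0..}. dist x' s < d \<longrightarrow> dist (I x') (I s) < e"
        proof (intro exI[of _ "d/2"] conjI ballI impI)
          fix y :: real assume y: "y \<in> {0..}" "dist y s < d / 2"
          then have "I y \<le> h (2 * y)" "h (2 * y) \<le> h d" "0 \<le> I y"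
            using True upper[of y] mono[of "2*y" d] lower[of y] nonneg[of y] 
            by (auto simp: dist_real_def)
          then show "dist (I y) (I s) < e"
            using d \<open>0 < e\<close> True I0 by (simp add: dist_real_def)
        qed (use d in auto)
      qed
    next
      case False
      then show ?thesis using contpos[of s] s by (simp add: continuous_at_imp_continuous_within)
    qed
  qed
  have "class_K \<alpha>"
    unfolding class_K_def \<alpha>_def
  proof (intro conjI)
    show "strict_mono_on {0..} (\<lambda>s. s + I s)"
      using Imono by (auto simp: strict_mono_on_def intro!: add_less_le_mono)
    show "(\<lambda>s. s + I s) ` {0..} \<subseteq> {0..}"
      using order_trans[OF nonneg lower] by (auto intro!: add_nonneg_nonneg)
    show "continuous_on {0..} (\<lambda>s. s + I s)" using Icont by (intro continuous_intros)
  qed (simp add: I0)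
  then show thesis
  proof (rule that)
    fix s :: real assume "0 \<le> s"
    then show "s \<le> \<alpha> s" "h s \<le> \<alpha> s" using lower[of s] nonneg[of s] by (auto simp: \<alpha>_def)
  qed
qed

text \<open>The supremum of \<open>v\<close> over the sublevel set of \<open>u\<close> is the least
  nondecreasing gain; the two hypotheses say that it is finite and that it vanishes at 0. Inserting
  0 keeps the supremum nonnegative and the set nonempty.\<close>

lemma class_K_dominates:
  fixes u v :: "'c \<Rightarrow> real"
  assumes bdd: "\<And>M. \<exists>R. \<forall>p\<in>P. u p \<le> M \<longrightarrow> v p \<le> R"
    and small: "\<And>\<epsilon>. 0 < \<epsilon> \<Longrightarrow> \<exists>\<delta>>0. \<forall>p\<in>P. u p \<le> \<delta> \<longrightarrow> v p \<le> \<epsilon>"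
    and u: "\<And>p. p \<in> P \<Longrightarrow> 0 \<le> u p"
  obtains \<alpha> where "class_K \<alpha>" "\<And>s. 0 \<le> s \<Longrightarrow> s \<le> \<alpha> s" "\<And>p. p \<in> P \<Longrightarrow> v p \<le> \<alpha> (u p)"
proof -
  define X where "X s = insert 0 (v ` {p\<in>P. u p \<le> s})" for s
  define h where "h s = Sup (X s)" for s
  have bddX: "bdd_above (X s)" for s
  proof -
    obtain R where "\<forall>p\<in>P. u p \<le> s \<longrightarrow> v p \<le> R" using bdd[of s] by blast
    then show ?thesis
      by (intro bdd_aboveI[of _ "max 0 R"]) (auto simp: X_def intro: max.coboundedI2)
  qed
  have mono: "h s \<le> h t" if "s \<le> t" for s t
    unfolding h_def by (rule cSup_subset_mono) (use that bddX in \<open>auto simp: X_def\<close>)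
  have le: "v p \<le> h s" if "p \<in> P" "u p \<le> s" for p s
    unfolding h_def by (rule cSup_upper) (use that bddX in \<open>auto simp: X_def\<close>)
  have nonneg: "0 \<le> h s" for s
    unfolding h_def by (rule cSup_upper) (use bddX in \<open>auto simp: X_def\<close>)
  have lim: "\<exists>\<delta>>0. h \<delta> \<le> \<epsilon>" if e: "0 < \<epsilon>" for \<epsilon>
  proof -
    obtain \<delta> where d: "\<delta> > 0" "\<forall>p\<in>P. u p \<le> \<delta> \<longrightarrow> v p \<le> \<epsilon>" using small[OF e] by blast
    then have "h \<delta> \<le> \<epsilon>" unfolding h_def
      by (intro cSup_least) (use e in \<open>auto simp: X_def\<close>)
    then show ?thesis using d by blast
  qed
  have h0: "h 0 = 0"
  proof (rule antisym[OF field_le_epsilon nonneg])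
    fix e :: real assume "0 < e"
    then obtain d where "d > 0" "h d \<le> e" using lim by blast
    then show "h 0 \<le> 0 + e" using mono[of 0 d] by simp
  qed
  obtain \<alpha> where \<alpha>: "class_K \<alpha>" "\<And>s. 0 \<le> s \<Longrightarrow> s \<le> \<alpha> s" "\<And>s. 0 \<le> s \<Longrightarrow> h s \<le> \<alpha> s"
    using class_K_dominates_mono[of h] mono h0 lim by metis
  have "v p \<le> \<alpha> (u p)" if "p \<in> P" for p
    using le[OF that order_refl] \<alpha>(3)[OF u[OF that]] by linarith
  with \<alpha> that show thesis by blast
qed

section \<open>Ordinary differential equations\<close>

text \<open>In finite dimension this is local Lipschitz continuity; the form on balls fits the later
  cut-off of the field outside a ball.\<close>

definition ball_lipschitz :: "('a::real_normed_vector \<Rightarrow> 'b::real_normed_vector) \<Rightarrow> bool" where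
  "ball_lipschitz F \<longleftrightarrow> (\<forall>R. \<exists>L. L-lipschitz_on (cball 0 R) F)"

lemma ball_lipschitz_continuous_on:
  assumes "ball_lipschitz F" shows "continuous_on S F"
proof -
  have "isCont F x" for x
  proof -
    obtain L where "L-lipschitz_on (cball 0 (norm x + 1)) F"
      using assms ball_lipschitz_def by blast
    then have "continuous_on (cball 0 (norm x + 1)) F" by (rule lipschitz_on_continuous_on)
    moreover have "x \<in> interior (cball 0 (norm x + 1))"
      by (rule subsetD[OF interior_maximal[OF ball_subset_cball open_ball]]) simp
    ultimately show ?thesis using continuous_on_interior by blast
  qed
  then show ?thesis by (simp add: continuous_at_imp_continuous_on)
qed

text \<open>Gronwall's inequality by an integrating factor. Neither \<open>c\<close> nor
  \<open>w\<close> has a prescribed sign, so it serves both for uniqueness (growth at rate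
  \<open>2 * L\<close>) and for Lyapunov decay (rate \<open>- (2 * \<sigma>)\<close>).\<close>

lemma exp_decay:
  fixes w :: "real \<Rightarrow> real"
  assumes "a \<le> b" "continuous_on {a..b} w"
    and w': "\<And>t. a < t \<Longrightarrow> t < b \<Longrightarrow> \<exists>d. (w has_real_derivative d) (at t) \<and> d \<le> c * w t"
  shows "w b \<le> exp (c * (b - a)) * w a"
proof -
  let ?\<phi> = "\<lambda>t. exp (- c * (t - a)) * w t"
  have "?\<phi> b \<le> ?\<phi> a"
  proof (rule DERIV_nonpos_imp_decreasing_open[OF assms(1)])
    fix t assume "a < t" "t < b"
    then obtain d where d: "(w has_real_derivative d) (at t)" "d \<le> c * w t" using w' by blast
    have "(?\<phi> has_real_derivative (exp (- c * (t - a)) * (d - c * w t))) (at t)"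
      by (auto intro!: derivative_eq_intros d(1) simp: algebra_simps)
    moreover have "exp (- c * (t - a)) * (d - c * w t) \<le> 0"
      using d(2) by (simp add: mult_nonneg_nonpos)
    ultimately show "\<exists>y. (?\<phi> has_real_derivative y) (at t) \<and> y \<le> 0" by blast
  next
    show "continuous_on {a..b} ?\<phi>" using assms(2) by (intro continuous_intros)
  qed
  then have "exp (c * (b - a)) * (exp (- c * (b - a)) * w b) \<le> exp (c * (b - a)) * w a"
    by (intro mult_left_mono) auto
  then show ?thesis by (simp flip: mult.assoc exp_add)
qed

lemma ode_solution_subset: "ode_solution F J x \<Longrightarrow> J' \<subseteq> J \<Longrightarrow> ode_solution F J' x"
  by (auto simp: ode_solution_def intro: has_vector_derivative_within_subset)

lemma ode_solution_cong:
  assumes "\<And>t. t \<in> J \<Longrightarrow> x t = y t" "ode_solution F J x"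
  shows "ode_solution F J y"
  unfolding ode_solution_def
proof
  fix t assume t: "t \<in> J"
  then have "(x has_vector_derivative F (y t)) (at t within J)"
    using assms by (simp add: ode_solution_def)
  then show "(y has_vector_derivative F (y t)) (at t within J)"
    using assms(1) t has_vector_derivative_transform by metis
qed

lemma ode_solution_continuous_on: "ode_solution F J x \<Longrightarrow> continuous_on J x"
  by (auto simp: ode_solution_def continuous_on_eq_continuous_within intro: has_vector_derivative_continuous)

lemma ode_solution_interior:
  assumes "ode_solution F J x" "t \<in> interior J"
  shows "(x has_vector_derivative F (x t)) (at t)"
proof -
  have "t \<in> J" using assms(2) interior_subset by (rule rev_subsetD)
  then have "(x has_vector_derivative F (x t)) (at t within J)"
    using assms(1) by (simp add: ode_solution_def)
  then show ?thesis by (simp add: at_within_interior[OF assms(2)])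
qed

lemma ode_solution_unique:
  fixes F :: "'a::real_inner \<Rightarrow> 'a"
  assumes F: "ball_lipschitz F" and x: "ode_solution F {a..b} x" and y: "ode_solution F {a..b} y"
    and init: "x a = y a" and t: "t \<in> {a..b}"
  shows "x t = y t"
proof -
  note cx = ode_solution_continuous_on[OF x] and cy = ode_solution_continuous_on[OF y]
  have "bounded (x ` {a..b} \<union> y ` {a..b})"
    using cx cy by (simp add: compact_imp_bounded compact_continuous_image)
  then obtain R where R: "\<And>s. s \<in> {a..b} \<Longrightarrow> norm (x s) \<le> R" "\<And>s. s \<in> {a..b} \<Longrightarrow> norm (y s) \<le> R"
    unfolding bounded_iff by (metis UnI1 UnI2 imageI)
  obtain L where L: "L-lipschitz_on (cball 0 R) F" using F ball_lipschitz_def by blast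
  \<comment> \<open>The squared distance stays differentiable where the two solutions meet.\<close>
  let ?w = "\<lambda>s. (x s - y s) \<bullet> (x s - y s)"
  have "?w t \<le> exp (2 * L * (t - a)) * ?w a"
  proof (rule exp_decay)
    show "a \<le> t" using t by simp
    show "continuous_on {a..t} ?w"
      using t by (intro continuous_intros continuous_on_subset[OF cx] continuous_on_subset[OF cy]) auto
    fix s assume s: "a < s" "s < t"
    then have s': "s \<in> {a..b}" "s \<in> interior {a..b}" using t by auto
    have "(?w has_real_derivative 2 * ((x s - y s) \<bullet> (F (x s) - F (y s)))) (at s)"
      using ode_solution_interior[OF x s'(2)] ode_solution_interior[OF y s'(2)]
      unfolding has_real_derivative_iff_has_vector_derivative
      by (auto intro!: derivative_eq_intros simp: inner_commute has_vector_derivative_def algebra_simps)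
    moreover have "(x s - y s) \<bullet> (F (x s) - F (y s)) \<le> norm (x s - y s) * (L * norm (x s - y s))"
      using lipschitz_on_normD[OF L, of "x s" "y s"] R[OF s'(1)]
      by (intro order_trans[OF norm_cauchy_schwarz] mult_left_mono) auto
    then have "2 * ((x s - y s) \<bullet> (F (x s) - F (y s))) \<le> 2 * L * ?w s"
      by (simp add: dot_square_norm power2_eq_square mult_ac)
    ultimately show "\<exists>d. (?w has_real_derivative d) (at s) \<and> d \<le> 2 * L * ?w s" by blast
  qed
  then show ?thesis using init by (simp add: inner_gt_zero_iff flip: not_less)
qed

text \<open>Picard iteration in the weighted unknown \<open>z t = exp (- c * (t - a)) *\<^sub>R y t\<close>, which makes the
  integral operator a contraction on the whole interval at once.\<close>

lemma ode_solution_exists_lipschitz: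
  fixes F :: "'a::euclidean_space \<Rightarrow> 'a"
  assumes F: "L-lipschitz_on UNIV F" and ab: "a \<le> b"
  obtains y where "ode_solution F {a..b} y" "y a = x0"
proof -
  \<comment> \<open>The contraction factor will be \<open>L / c\<close>; this choice keeps it below
    1/2, and \<open>c\<close> positive even for \<open>L = 0\<close>.\<close>
  define c where "c = 2 * L + 1"
  have L0: "0 \<le> L" using F lipschitz_on_nonneg by blast
  have c0: "0 < c" using L0 by (simp add: c_def)
  define Y where "Y z s = exp (c * (s - a)) *\<^sub>R apply_bcontfun z s" for z :: "real \<Rightarrow>\<^sub>C 'a" and s
  define P where "P z t = exp (- c * (t - a)) *\<^sub>R (x0 + integral {a..t} (\<lambda>s. F (Y z s)))"
    for z :: "real \<Rightarrow>\<^sub>C 'a" and t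
  have contY: "continuous_on S (\<lambda>s. F (Y z s))" for S z
    unfolding Y_def
    by (intro continuous_on_compose2[OF lipschitz_on_continuous_on[OF F]] continuous_intros) auto
  have intY: "(\<lambda>s. F (Y z s)) integrable_on {a..t}" for z t
    by (intro integrable_continuous_interval contY)
  have contP: "continuous_on (cbox a b) (P z)" for z
    unfolding P_def
    using indefinite_integral_continuous_1[OF intY[of z b]] by (auto intro!: continuous_intros)
  \<comment> \<open>Clamping the argument to \<open>{a..b}\<close> extends the image to a bounded
    continuous function on the line, so the iteration runs in a complete space.\<close>
  have "\<exists>w :: real \<Rightarrow>\<^sub>C 'a. \<forall>t. w t = P z (clamp a b t)" for z
    using continuous_on_cbox_bcontfunE[OF contP[of z]] by metis
  then obtain \<Phi> :: "(real \<Rightarrow>\<^sub>C 'a) \<Rightarrow> (real \<Rightarrow>\<^sub>C 'a)" where \<Phi>: "\<And>z t. \<Phi> z t = P z (clamp a b t)"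
    by metis
  have "dist (\<Phi> z1) (\<Phi> z2) \<le> 1 / 2 * dist z1 z2" for z1 z2
  proof (rule dist_bound)
    fix t0
    define t where "t = clamp a b t0"
    have t: "a \<le> t" "t \<le> b" using clamp_in_interval[of a b t0] ab by (auto simp: t_def)
    let ?d = "dist z1 z2"
    have ex: "((\<lambda>s. L * ?d * exp (c * (s - a))) has_integral
        L * ?d * (exp (c * (t - a)) / c) - L * ?d * (exp (c * (a - a)) / c)) {a..t}"
      using c0 by (intro fundamental_theorem_of_calculus t(1))
        (auto intro!: derivative_eq_intros simp flip: has_real_derivative_iff_has_vector_derivative)
    have "norm (integral {a..t} (\<lambda>s. F (Y z1 s) - F (Y z2 s)))
        \<le> integral {a..t} (\<lambda>s. L * ?d * exp (c * (s - a)))"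
    proof (rule integral_norm_bound_integral)
      show "(\<lambda>s. F (Y z1 s) - F (Y z2 s)) integrable_on {a..t}"
        using intY by (intro integrable_diff)
      show "(\<lambda>s. L * ?d * exp (c * (s - a))) integrable_on {a..t}" using ex by blast
      fix s
      have "norm (F (Y z1 s) - F (Y z2 s)) \<le> L * norm (Y z1 s - Y z2 s)"
        by (rule lipschitz_on_normD[OF F]) auto
      also have "norm (Y z1 s - Y z2 s) = exp (c * (s - a)) * dist (z1 s) (z2 s)"
        by (simp add: Y_def dist_norm flip: scaleR_diff_right)
      also have "L * (exp (c * (s - a)) * dist (z1 s) (z2 s)) \<le> L * (exp (c * (s - a)) * ?d)"
        using L0 by (intro mult_left_mono dist_bounded) auto
      finally show "norm (F (Y z1 s) - F (Y z2 s)) \<le> L * ?d * exp (c * (s - a))"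
        by (simp add: mult_ac)
    qed
    also have "\<dots> \<le> L * ?d * (exp (c * (t - a)) / c)"
      using integral_unique[OF ex] L0 c0 by simp
    finally have le: "norm (integral {a..t} (\<lambda>s. F (Y z1 s) - F (Y z2 s)))
        \<le> L * ?d * (exp (c * (t - a)) / c)" .
    have "dist (P z1 t) (P z2 t) = exp (- c * (t - a)) * norm (integral {a..t} (\<lambda>s. F (Y z1 s) - F (Y z2 s)))"
      using intY by (simp add: P_def dist_norm integral_diff flip: scaleR_diff_right)
    also have "\<dots> \<le> exp (- c * (t - a)) * (L * ?d * (exp (c * (t - a)) / c))"
      by (intro mult_left_mono le) auto
    also have "\<dots> = (exp (- c * (t - a)) * exp (c * (t - a))) * (L / c * ?d)" by (simp add: field_simps)
    also have "\<dots> = L / c * ?d" by (simp flip: exp_add)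
    also have "\<dots> \<le> 1 / 2 * ?d"
      using c0 by (intro mult_right_mono) (auto simp: c_def field_simps)
    finally show "dist (\<Phi> z1 t0) (\<Phi> z2 t0) \<le> 1 / 2 * ?d"
      by (simp add: \<Phi> t_def)
  qed
  then obtain z where z: "\<Phi> z = z"
    using banach_fix_type[of "1/2" \<Phi>] by auto
  have Yeq: "Y z t = x0 + integral {a..t} (\<lambda>s. F (Y z s))" if "t \<in> {a..b}" for t
  proof -
    have "Y z t = exp (c * (t - a)) *\<^sub>R \<Phi> z t" by (simp add: Y_def z)
    also have "\<dots> = exp (c * (t - a)) *\<^sub>R P z t" using that by (simp add: \<Phi>)
    also have "\<dots> = (exp (c * (t - a)) * exp (- c * (t - a))) *\<^sub>R (x0 + integral {a..t} (\<lambda>s. F (Y z s)))"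
      by (simp only: P_def scaleR_scaleR)
    also have "exp (c * (t - a)) * exp (- c * (t - a)) = 1" by (simp flip: exp_add)
    finally show ?thesis by simp
  qed
  have "ode_solution F {a..b} (Y z)"
    unfolding ode_solution_def
  proof
    fix t assume t: "t \<in> {a..b}"
    have "((\<lambda>t. x0 + integral {a..t} (\<lambda>s. F (Y z s))) has_vector_derivative F (Y z t)) (at t within {a..b})"
      using integral_has_vector_derivative[OF contY t]
      by (auto intro!: derivative_eq_intros)
    then show "(Y z has_vector_derivative F (Y z t)) (at t within {a..b})"
      using Yeq t has_vector_derivative_transform by (metis (no_types, lifting))
  qed
  moreover have "Y z a = x0" using Yeq[of a] ab by simp
  ultimately show thesis using that by blast
qed

text \<open>Composing the field with the projection onto the ball makes it globally Lipschitz, so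
  \<open>y\<close> exists on all of \<open>{a..b}\<close>. It solves the original equation for as
  long as it has not left the ball, which is where the projection is the identity.\<close>

lemma ode_solution_exists_in_ball:
  fixes F :: "'a::euclidean_space \<Rightarrow> 'a"
  assumes F: "ball_lipschitz F" and ab: "a \<le> b" and R: "0 \<le> R"
  obtains y where "y a = x0" "continuous_on {a..b} y"
    "\<And>c. c \<le> b \<Longrightarrow> (\<forall>t\<in>{a..c}. norm (y t) \<le> R) \<Longrightarrow> ode_solution F {a..c} y"
proof -
  let ?\<pi> = "closest_point (cball (0::'a) R)"
  have ne: "cball (0::'a) R \<noteq> {}" using R by simp
  obtain L where L: "L-lipschitz_on (cball 0 R) F" using F ball_lipschitz_def by blast
  have "1-lipschitz_on UNIV ?\<pi>"
    using closest_point_lipschitz[OF convex_cball closed_cball ne] by (auto intro: lipschitz_onI)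
  moreover have "?\<pi> ` UNIV \<subseteq> cball 0 R"
    using closest_point_in_set[OF closed_cball ne] by blast
  ultimately have "(L * 1)-lipschitz_on UNIV (\<lambda>x. F (?\<pi> x))"
    using L by (intro lipschitz_on_compose2) (auto intro: lipschitz_on_subset)
  then obtain y where y: "ode_solution (\<lambda>x. F (?\<pi> x)) {a..b} y" "y a = x0"
    using ode_solution_exists_lipschitz ab by metis
  have "ode_solution F {a..c} y" if c: "c \<le> b" and le: "\<forall>t\<in>{a..c}. norm (y t) \<le> R" for c
  proof -
    have "ode_solution (\<lambda>x. F (?\<pi> x)) {a..c} y" using ode_solution_subset[OF y(1)] c by simp
    moreover have "?\<pi> (y t) = y t" if "t \<in> {a..c}" for t
      using le that by (intro closest_point_self) auto
    ultimately show ?thesis by (simp add: ode_solution_def)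
  qed
  then show thesis using that y ode_solution_continuous_on by blast
qed

text \<open>The ball is chosen to contain the sublevel set, so the cut-off solution is genuine until
  the level is first reached. By the intermediate value theorem \<open>W\<close> stays below
  \<open>M\<close> before the first time in \<open>S\<close>; if there is none, the solution lasts
  the full time \<open>T\<close>.\<close>

lemma ode_solution_exists_until_level:
  fixes F :: "'a::euclidean_space \<Rightarrow> 'a" and W :: "'a \<Rightarrow> real"
  assumes F: "ball_lipschitz F" and W: "continuous_on UNIV W" and bdd: "bounded {x. W x \<le> M}"
    and x0: "W x0 < M" and T: "0 < T"
  obtains y r where "y t0 = x0" "t0 < r" "r \<le> t0 + T" "ode_solution F {t0..r} y"
    "\<And>t. t \<in> {t0..<r} \<Longrightarrow> W (y t) < M" "W (y r) \<le> M" "r < t0 + T \<Longrightarrow> W (y r) = M"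
proof -
  obtain R where R: "0 < R" "\<And>x. W x \<le> M \<Longrightarrow> norm x \<le> R"
    using bdd bounded_pos by (metis mem_Collect_eq)
  obtain y where y: "y t0 = x0" "continuous_on {t0..t0+T} y"
    "\<And>c. c \<le> t0 + T \<Longrightarrow> (\<forall>t\<in>{t0..c}. norm (y t) \<le> R) \<Longrightarrow> ode_solution F {t0..c} y"
    using ode_solution_exists_in_ball[OF F, of t0 "t0+T" R x0] T R(1) by auto
  have contW: "continuous_on {t0..t0+T} (\<lambda>t. W (y t))"
    by (rule continuous_on_compose2[OF W y(2)]) auto
  define S where "S = {t \<in> {t0..t0+T}. W (y t) = M}"
  have below: "W (y t) < M" if t: "t0 \<le> t" "t \<le> t0 + T" and n: "\<And>s. t0 \<le> s \<Longrightarrow> s \<le> t \<Longrightarrow> s \<notin> S" for t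
  proof (rule ccontr)
    assume "\<not> W (y t) < M"
    then have "\<exists>s\<ge>t0. s \<le> t \<and> W (y s) = M"
      using x0 y(1) t continuous_on_subset[OF contW, of "{t0..t}"] by (intro IVT') auto
    then show False using n t by (force simp: S_def)
  qed
  show thesis
  proof (cases "S = {}")
    case True
    then have lt: "W (y t) < M" if "t \<in> {t0..t0+T}" for t using below[of t] that by auto
    show thesis
    proof (rule that[of y "t0 + T"])
      show "ode_solution F {t0..t0 + T} y" using y(3)[of "t0+T"] R(2) lt by (simp add: less_imp_le)
      show "W (y (t0 + T)) \<le> M" using lt[of "t0+T"] T by simp
    qed (use T y(1) lt in auto)
  next
    case False
    have "closed S" unfolding S_def
      by (rule continuous_closed_preimage_constant[OF contW closed_atLeastAtMost])
    moreover have bS: "bdd_below S" unfolding S_def by (rule bdd_belowI[of _ t0]) auto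
    ultimately have rS: "Inf S \<in> S" using False closed_contains_Inf by blast
    have lt: "W (y t) < M" if "t \<in> {t0..<Inf S}" for t
      using below[of t] that rS cInf_lower[OF _ bS] by (fastforce simp: S_def)
    have le: "W (y t) \<le> M" if "t \<in> {t0..Inf S}" for t
      using lt[of t] rS that by (cases "t = Inf S") (auto simp: S_def)
    show thesis
    proof (rule that[of y "Inf S"])
      have "Inf S \<noteq> t0" "t0 \<le> Inf S" using rS x0 y(1) unfolding S_def by fastforce+
      then show "t0 < Inf S" by simp
      show "ode_solution F {t0..Inf S} y" using y(3)[of "Inf S"] R(2) le rS by (auto simp: S_def)
      show "\<And>t. t \<in> {t0..<Inf S} \<Longrightarrow> W (y t) < M" by (rule lt)
      have "S \<subseteq> {t. t \<le> t0 + T \<and> W (y t) = M}" by (auto simp: S_def)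
      then have "Inf S \<le> t0 + T" "W (y (Inf S)) = M" using rS by blast+
      then show "Inf S \<le> t0 + T" "W (y (Inf S)) \<le> M" "Inf S < t0 + T \<Longrightarrow> W (y (Inf S)) = M"
        by simp_all
    qed (rule y(1))
  qed
qed

section \<open>The normal equation\<close>

lemma bounded_linear_matrix_vector_mult_left:
  "bounded_linear (\<lambda>M :: real^'l^'n. M *v w)"
  by (intro linear_conv_bounded_linear[THEN iffD1] linearI)
     (auto simp: matrix_vector_mult_add_rdistrib scaleR_matrix_vector_assoc)

lemma bounded_bilinear_transpose_mult:
  "bounded_bilinear (\<lambda>(A :: real^'l^'n) (B :: real^'k^'n). transpose A ** B)"
  unfolding bilinear_conv_bounded_bilinear[symmetric] bilinear_def
  by (intro conjI allI linearI)
     (simp_all add: matrix_matrix_mult_def transpose_def vec_eq_iff algebra_simps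
        sum.distrib sum_distrib_left)

lemmas continuous_on_matrix_vector_mult_left [continuous_intros] =
  bounded_linear.continuous_on[OF bounded_linear_matrix_vector_mult_left]

lemma inner_gram: "w \<bullet> ((transpose Q ** Q) *v w) = (Q *v w) \<bullet> (Q *v w)" for Q :: "real^'l^'n"
  by (metis dot_lmul_matrix matrix_vector_mul_assoc vector_transpose_matrix)

section \<open>Integration of piecewise continuous data\<close>

lemma set_integrable_continuous_Ico:
  fixes K :: "real \<Rightarrow> 'a::{banach, second_countable_topology}"
  assumes "continuous_on {a..b} K" "\<And>t. t \<in> {a..<b} \<Longrightarrow> G t = K t"
  shows "set_integrable lborel {a..<b} G"
proof -
  have "set_integrable lborel {a..<b} K"
    using borel_integrable_atLeastAtMost'[OF assms(1)] by (rule set_integrable_subset) auto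
  then show ?thesis using assms(2) by (subst set_integrable_cong[OF refl refl]) auto
qed

lemma strict_increasing_bounds:
  fixes \<tau> :: "nat \<Rightarrow> real"
  assumes "\<And>i. i < n \<Longrightarrow> \<tau> i < \<tau> (Suc i)" "i \<le> j" "j \<le> n"
  shows "\<tau> i \<le> \<tau> j"
  using assms(2,3)
proof (induction j)
  case (Suc j)
  then show ?case using assms(1)[of j] by (cases "i = Suc j") force+
qed simp

lemma Ico_partition:
  fixes \<tau> :: "nat \<Rightarrow> real"
  assumes "\<And>i. i < n \<Longrightarrow> \<tau> i < \<tau> (Suc i)" "t \<in> {\<tau> 0..<\<tau> n}"
  obtains i where "i < n" "t \<in> {\<tau> i..<\<tau> (Suc i)}"
proof -
  have "\<exists>i<n. t \<in> {\<tau> i..<\<tau> (Suc i)}" using assms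
  proof (induction n)
    case (Suc n)
    show ?case
    proof (cases "t < \<tau> n")
      case True
      then have "\<exists>i<n. t \<in> {\<tau> i..<\<tau> (Suc i)}" using Suc by simp
      then show ?thesis using less_Suc_eq by blast
    qed (use Suc in auto)
  qed simp
  then show thesis using that by blast
qed

text \<open>Each piece extends continuously to its closed interval, while the value of
  \<open>G\<close> at \<open>\<tau> n\<close> is left free: the input jumps there together with the
  estimate.\<close>

definition piecewise_continuous_upto :: "(nat \<Rightarrow> real) \<Rightarrow> nat \<Rightarrow> (real \<Rightarrow> 'a::topological_space) \<Rightarrow> bool" where
  "piecewise_continuous_upto \<tau> n G \<longleftrightarrow>
     (\<forall>i<n. \<exists>K. continuous_on {\<tau> i..\<tau> (Suc i)} K \<and> (\<forall>t\<in>{\<tau> i..<\<tau> (Suc i)}. G t = K t))"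

lemma piecewise_continuous_set_integrable:
  fixes G :: "real \<Rightarrow> 'a::euclidean_space"
  assumes \<tau>: "\<And>i. i < n \<Longrightarrow> \<tau> i < \<tau> (Suc i)" and G: "piecewise_continuous_upto \<tau> n G"
  shows "set_integrable lborel {\<tau> 0..\<tau> n} G"
proof -
  have "set_integrable lborel {\<tau> 0..<\<tau> n} G"
    using assms
  proof (induction n)
    case 0
    then show ?case by (simp add: set_integrable_def)
  next
    case (Suc n)
    have IH: "set_integrable lborel {\<tau> 0..<\<tau> n} G"
      using Suc by (simp add: piecewise_continuous_upto_def)
    obtain K where "continuous_on {\<tau> n..\<tau> (Suc n)} K" "\<forall>t\<in>{\<tau> n..<\<tau> (Suc n)}. G t = K t"
      using Suc.prems(2) unfolding piecewise_continuous_upto_def by blast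
    then have "set_integrable lborel {\<tau> n..<\<tau> (Suc n)} G"
      by (intro set_integrable_continuous_Ico) auto
    moreover have "{\<tau> 0..<\<tau> (Suc n)} = {\<tau> 0..<\<tau> n} \<union> {\<tau> n..<\<tau> (Suc n)}"
      using strict_increasing_bounds[of "Suc n" \<tau> 0 n] Suc.prems(1)
      by (intro ivl_disj_un_two(3)[symmetric]) (auto simp: less_imp_le)
    ultimately show ?case using IH by (simp add: set_integrable_Un)
  qed
  moreover have "set_integrable lborel {\<tau> n} G"
  proof -
    have "(\<lambda>t. indicator {\<tau> n} t *\<^sub>R G t) = (\<lambda>t. indicator {\<tau> n} t *\<^sub>R G (\<tau> n))"
      by (auto simp: indicator_def)
    then show ?thesis unfolding set_integrable_def by simp
  qed
  ultimately have "set_integrable lborel ({\<tau> 0..<\<tau> n} \<union> {\<tau> n}) G"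
    by (rule set_integrable_Un) auto
  moreover have "{\<tau> 0..<\<tau> n} \<union> {\<tau> n} = {\<tau> 0..\<tau> n}"
    using strict_increasing_bounds[of n \<tau> 0 n] \<tau> by auto
  ultimately show ?thesis by simp
qed

text \<open>The oriented integral becomes an increment of one function of the upper limit for both
  orders of \<open>s\<close> and \<open>t\<close>, so \<open>q_data\<close> depends continuously on
  the pair.\<close>

lemma interval_integral_eq_diff:
  fixes G :: "real \<Rightarrow> 'a::euclidean_space"
  assumes G: "set_integrable lborel {a..b} G" and st: "s \<in> {a..b}" "t \<in> {a..b}"
  shows "(LBINT r=ereal s..ereal t. G r) = integral {a..t} G - integral {a..s} G"
proof -
  have *: "(LBINT r=ereal s..ereal t. G r) = integral {a..t} G - integral {a..s} G"
    if "s \<le> t" "s \<in> {a..b}" "t \<in> {a..b}" for s t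
  proof -
    have "(LBINT r=ereal s..ereal t. G r) = integral {s..t} G"
      using that by (intro interval_integral_eq_integral set_integrable_subset[OF G]) auto
    moreover have "G integrable_on {a..t}"
      using set_borel_integral_eq_integral(1)[OF G] by (rule integrable_on_subinterval) (use that in auto)
    then have "integral {a..s} G + integral {s..t} G = integral {a..t} G"
      using that by (intro Henstock_Kurzweil_Integration.integral_combine) auto
    ultimately show ?thesis by (simp add: algebra_simps)
  qed
  show ?thesis
  proof (cases "s \<le> t")
    case True then show ?thesis using * st by simp
  next
    case False
    then show ?thesis
      using *[of t s] st by (subst interval_integral_endpoints_reverse) simp
  qed
qed

section \<open>Double integrals over a square\<close>

definition square_integral :: "real \<Rightarrow> (real \<Rightarrow> real \<Rightarrow> 'a::euclidean_space) \<Rightarrow> 'a" where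
  "square_integral b K = integral {0..b} (\<lambda>t. integral {0..b} (K t))"

lemma
  fixes K :: "real \<Rightarrow> real \<Rightarrow> 'a::euclidean_space"
  assumes K: "continuous_on ({0..b} \<times> {0..b}) (\<lambda>(t, s). K t s)"
  shows square_integral_inner_continuous: "t \<in> {0..b} \<Longrightarrow> continuous_on {0..b} (K t)"
    and square_integral_outer_continuous: "continuous_on {0..b} (\<lambda>t. integral {0..b} (K t))"
proof -
  show "continuous_on {0..b} (K t)" if "t \<in> {0..b}"
  proof -
    have "continuous_on {0..b} (\<lambda>s. (t, s))" by (intro continuous_intros)
    from continuous_on_compose2[OF K this] that show ?thesis by (auto simp: image_subset_iff)
  qed
  show "continuous_on {0..b} (\<lambda>t. integral {0..b} (K t))"
    using integral_continuous_on_param[of "{0..b}" 0 b K] K by simp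
qed

lemma interval_integral_square:
  fixes K :: "real \<Rightarrow> real \<Rightarrow> 'a::euclidean_space"
  assumes K: "continuous_on ({0..b} \<times> {0..b}) (\<lambda>(t, s). K t s)" and b: "0 \<le> b"
    and f: "\<And>t s. t \<in> {0..b} \<Longrightarrow> s \<in> {0..b} \<Longrightarrow> f t s = K t s"
  shows "(LBINT t=ereal 0..ereal b. (LBINT s=ereal 0..ereal b. f t s)) = square_integral b K"
proof -
  have "(LBINT s=ereal 0..ereal b. f t s) = integral {0..b} (K t)" if t: "t \<in> {0..b}" for t
  proof -
    have "(LBINT s=ereal 0..ereal b. f t s) = (LBINT s=ereal 0..ereal b. K t s)"
      using b t f by (intro interval_integral_cong) (auto simp: einterval_iff)
    then show ?thesis
      using interval_integral_eq_integral[OF b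
          borel_integrable_atLeastAtMost'[OF square_integral_inner_continuous[OF K t]]] by simp
  qed
  then have "(LBINT t=ereal 0..ereal b. (LBINT s=ereal 0..ereal b. f t s)) =
      (LBINT t=ereal 0..ereal b. integral {0..b} (K t))"
    using b by (intro interval_integral_cong) (auto simp: einterval_iff)
  then show ?thesis
    using interval_integral_eq_integral[OF b
        borel_integrable_atLeastAtMost'[OF square_integral_outer_continuous[OF K]]]
    by (simp add: square_integral_def)
qed

lemma square_integral_linear:
  fixes K :: "real \<Rightarrow> real \<Rightarrow> 'a::euclidean_space" and h :: "'a \<Rightarrow> 'b::euclidean_space"
  assumes K: "continuous_on ({0..b} \<times> {0..b}) (\<lambda>(t, s). K t s)" and h: "bounded_linear h"
  shows "square_integral b (\<lambda>t s. h (K t s)) = h (square_integral b K)"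
proof -
  have "integral {0..b} (\<lambda>s. h (K t s)) = h (integral {0..b} (K t))" if t: "t \<in> {0..b}" for t
    using integral_linear[OF integrable_continuous_interval[OF square_integral_inner_continuous[OF K t]] h]
    by (simp add: o_def)
  then have "square_integral b (\<lambda>t s. h (K t s)) = integral {0..b} (\<lambda>t. h (integral {0..b} (K t)))"
    unfolding square_integral_def by (intro integral_cong) auto
  then show ?thesis
    using integral_linear[OF integrable_continuous_interval[OF square_integral_outer_continuous[OF K]] h]
    by (simp add: o_def square_integral_def)
qed

lemma square_integral_eq_0_imp:
  fixes K :: "real \<Rightarrow> real \<Rightarrow> real"
  assumes K: "continuous_on ({0..b} \<times> {0..b}) (\<lambda>(t, s). K t s)" and b: "0 < b"
    and nonneg: "\<And>t s. t \<in> {0..b} \<Longrightarrow> s \<in> {0..b} \<Longrightarrow> 0 \<le> K t s"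
    and zero: "square_integral b K = 0" and ts: "t \<in> {0..b}" "s \<in> {0..b}"
  shows "K t s = 0"
proof -
  have inner: "0 \<le> integral {0..b} (K t)" if "t \<in> {0..b}" for t
    using that nonneg square_integral_inner_continuous[OF K that]
    by (intro integral_nonneg integrable_continuous_interval) auto
  have "integral {0..b} (K t) = 0"
    using zero integral_eq_0_iff[OF square_integral_outer_continuous[OF K] b inner] ts(1)
    by (simp add: square_integral_def)
  then show ?thesis
    using integral_eq_0_iff[OF square_integral_inner_continuous[OF K ts(1)] b] nonneg ts by simp
qed

text \<open>Increments are integrals over arbitrary subintervals, so on each piece the continuous
  representative \<open>K\<close> is recovered by differentiation in the upper limit. The time
  \<open>\<tau> n\<close> is missing on the right because \<open>G\<close> is not controlled
  there.\<close>

lemma integral_increments_vanish_iff: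
  fixes G :: "real \<Rightarrow> real^'l^'n"
  assumes \<tau>0: "\<tau> 0 = 0" and \<tau>: "\<And>i. i < n \<Longrightarrow> \<tau> i < \<tau> (Suc i)"
    and G: "piecewise_continuous_upto \<tau> n G"
  shows "(\<forall>t\<in>{0..\<tau> n}. \<forall>s\<in>{0..\<tau> n}. (integral {0..t} G - integral {0..s} G) *v w = 0) \<longleftrightarrow>
    (\<forall>r\<in>{0..<\<tau> n}. G r *v w = 0)"
proof -
  have int: "G integrable_on {0..\<tau> n}"
    using set_borel_integral_eq_integral(1)[OF piecewise_continuous_set_integrable[OF \<tau> G]] \<tau>0 by simp
  have int': "G integrable_on {a..b}" if "0 \<le> a" "b \<le> \<tau> n" for a b
    using int by (rule integrable_on_subinterval) (use that in auto)
  note lin = bounded_linear_matrix_vector_mult_left[of w]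
  have Hw: "integral {a..b} G *v w = integral {a..b} (\<lambda>r. G r *v w)" if "0 \<le> a" "b \<le> \<tau> n" for a b
    using integral_linear[OF int'[OF that] lin] by (simp add: o_def)
  show ?thesis
  proof
    assume L: "\<forall>t\<in>{0..\<tau> n}. \<forall>s\<in>{0..\<tau> n}. (integral {0..t} G - integral {0..s} G) *v w = 0"
    show "\<forall>r\<in>{0..<\<tau> n}. G r *v w = 0"
    proof
      fix r assume "r \<in> {0..<\<tau> n}"
      then obtain i where i: "i < n" "r \<in> {\<tau> i..<\<tau> (Suc i)}"
        using Ico_partition[of n \<tau> r, OF \<tau>] \<tau>0 by auto
      have bnd: "0 \<le> \<tau> i" "\<tau> (Suc i) \<le> \<tau> n"
        using strict_increasing_bounds[of n \<tau> 0 i, OF \<tau>] strict_increasing_bounds[of n \<tau> "Suc i" n, OF \<tau>] i(1) \<tau>0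
        by auto
      obtain K where K: "continuous_on {\<tau> i..\<tau> (Suc i)} K" "\<And>t. t \<in> {\<tau> i..<\<tau> (Suc i)} \<Longrightarrow> G t = K t"
        using G i(1) unfolding piecewise_continuous_upto_def by blast
      have Kw: "continuous_on {\<tau> i..\<tau> (Suc i)} (\<lambda>r. K r *v w)"
        using K(1) by (intro continuous_intros)
      have zero: "integral {\<tau> i..t} (\<lambda>r. K r *v w) = 0" if t: "t \<in> {\<tau> i..\<tau> (Suc i)}" for t
      proof -
        have "integral {\<tau> i..t} (\<lambda>r. K r *v w) = integral {\<tau> i..t} (\<lambda>r. G r *v w)"
          by (rule integral_spike[of "{t}"]) (use K(2) t in auto)
        also have "\<dots> = integral {\<tau> i..t} G *v w" using Hw bnd t by simp
        also have "integral {\<tau> i..t} G = integral {0..t} G - integral {0..\<tau> i} G"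
          using Henstock_Kurzweil_Integration.integral_combine[of 0 "\<tau> i" t G] int'[of 0 t] bnd t
          by (simp add: algebra_simps)
        also have "\<dots> *v w = 0" using L bnd t by auto
        finally show ?thesis .
      qed
      have r: "r \<in> {\<tau> i..\<tau> (Suc i)}" using i(2) by simp
      \<comment> \<open>The derivative is relative to the closed piece, hence one-sided at its left
        end, so \<open>r = \<tau> i\<close> is covered as well.\<close>
      have "((\<lambda>u. integral {\<tau> i..u} (\<lambda>r. K r *v w)) has_vector_derivative K r *v w)
          (at r within {\<tau> i..\<tau> (Suc i)})"
        by (rule integral_has_vector_derivative[OF Kw r])
      then have "((\<lambda>u. 0) has_vector_derivative K r *v w) (at r within {\<tau> i..\<tau> (Suc i)})"
        by (rule has_vector_derivative_transform[OF r, rotated]) (simp add: zero)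
      then have "K r *v w = 0"
        using vector_derivative_unique_within_closed_interval[of "\<tau> i" "\<tau> (Suc i)" r]
          \<tau>[OF i(1)] r has_vector_derivative_const by (metis interval_cbox)
      then show "G r *v w = 0" using K(2)[OF i(2)] by simp
    qed
  next
    assume R: "\<forall>r\<in>{0..<\<tau> n}. G r *v w = 0"
    have "integral {0..t} G *v w = 0" if t: "t \<in> {0..\<tau> n}" for t
    proof -
      have "integral {0..t} (\<lambda>r. G r *v w) = integral {0..t} (\<lambda>r. 0 :: real^'n)"
        by (rule integral_spike[of "{\<tau> n}"]) (use R t in auto)
      then show ?thesis using Hw t by simp
    qed
    then show "\<forall>t\<in>{0..\<tau> n}. \<forall>s\<in>{0..\<tau> n}. (integral {0..t} G - integral {0..s} G) *v w = 0"
      by (simp add: matrix_vector_mult_diff_rdistrib)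
  qed
qed

text \<open>With \<open>p = q \<theta>\<close> the equation reads
  \<open>A *v (\<eta> - \<theta>) = 0\<close> for the Gram matrix \<open>A\<close>, the double
  integral of \<open>transpose q ** q\<close>. The quadratic form of \<open>A\<close> at
  \<open>w\<close> is the double integral of the squared length of \<open>q *v w\<close>, so the
  kernel of \<open>A\<close> consists of the vectors killed by every increment
  \<open>H t - H s\<close>, and these are the vectors killed by \<open>g\<close> itself.\<close>

theorem normal_equation_iff:
  fixes f :: "(real^'n) \<times> (real^'m) \<Rightarrow> real^'n" and g :: "(real^'n) \<times> (real^'m) \<Rightarrow> real^'l^'n"
  assumes \<tau>0: "\<tau> 0 = 0" and n: "0 < n" and \<tau>: "\<And>i. i < n \<Longrightarrow> \<tau> i < \<tau> (Suc i)"
    and x: "continuous_on {0..\<tau> n} x"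
    and x': "\<And>i t. i < n \<Longrightarrow> t \<in> {\<tau> i<..<\<tau> (Suc i)} \<Longrightarrow>
      (x has_vector_derivative f (x t, u t) + g (x t, u t) *v \<theta>) (at t)"
    and f: "piecewise_continuous_upto \<tau> n (\<lambda>t. f (x t, u t))"
    and g: "piecewise_continuous_upto \<tau> n (\<lambda>t. g (x t, u t))"
  shows "normal_equation f g x u (\<tau> n) \<eta> \<longleftrightarrow> (\<forall>t\<in>{0..<\<tau> n}. g (x t, u t) *v (\<eta> - \<theta>) = 0)"
proof -
  let ?F = "\<lambda>t. f (x t, u t)" and ?G = "\<lambda>t. g (x t, u t)"
  define H where "H t = integral {0..t} ?G" for t
  define J where "J t = integral {0..t} ?F" for t
  have T: "0 < \<tau> n"
    using \<tau>[of 0] strict_increasing_bounds[of n \<tau> 1 n, OF \<tau>] n \<tau>0 by simp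
  have siF: "set_integrable lborel {0..\<tau> n} ?F" and siG: "set_integrable lborel {0..\<tau> n} ?G"
    using piecewise_continuous_set_integrable[OF \<tau> f] piecewise_continuous_set_integrable[OF \<tau> g] \<tau>0
    by simp_all
  note inF = set_borel_integral_eq_integral(1)[OF siF] and inG = set_borel_integral_eq_integral(1)[OF siG]
  have q: "q_data g x u t s = H t - H s" if "t \<in> {0..\<tau> n}" "s \<in> {0..\<tau> n}" for t s
    unfolding q_data_def H_def using that by (intro interval_integral_eq_diff[OF siG])
  have xt: "x t = x 0 + J t + H t *v \<theta>" if t: "t \<in> {0..\<tau> n}" for t
  proof -
    have "((\<lambda>r. ?F r + ?G r *v \<theta>) has_integral (x t - x 0)) {0..t}"
    proof (rule fundamental_theorem_of_calculus_interior_strong[of "\<tau> ` {..n}"])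
      fix r assume r: "r \<in> {0<..<t} - \<tau> ` {..n}"
      then obtain i where i: "i < n" "r \<in> {\<tau> i..<\<tau> (Suc i)}"
        using Ico_partition[of n \<tau> r, OF \<tau>] \<tau>0 t by auto
      moreover have "r \<noteq> \<tau> i" using r i(1) by auto
      ultimately show "(x has_vector_derivative ?F r + ?G r *v \<theta>) (at r)"
        by (intro x'[of i]) auto
    qed (use t in \<open>auto intro: continuous_on_subset[OF x]\<close>)
    moreover have "((\<lambda>r. ?F r + ?G r *v \<theta>) has_integral (J t + H t *v \<theta>)) {0..t}"
    proof (rule has_integral_add)
      show "(?F has_integral J t) {0..t}" unfolding J_def
        using integrable_on_subinterval[OF inF, of 0 t] t by (simp add: integrable_integral)
      have "(?G has_integral H t) {0..t}" unfolding H_def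
        using integrable_on_subinterval[OF inG, of 0 t] t by (simp add: integrable_integral)
      then show "((\<lambda>r. ?G r *v \<theta>) has_integral (H t *v \<theta>)) {0..t}"
        using has_integral_linear[OF _ bounded_linear_matrix_vector_mult_left] by (simp add: o_def)
    qed
    ultimately have "x t - x 0 = J t + H t *v \<theta>" by (rule has_integral_unique)
    then show ?thesis by (simp add: algebra_simps)
  qed
  have p: "p_data f x u t s = (H t - H s) *v \<theta>" if "t \<in> {0..\<tau> n}" "s \<in> {0..\<tau> n}" for t s
  proof -
    have "p_data f x u t s = x t - x s - (J t - J s)"
      by (simp add: p_data_def J_def interval_integral_eq_diff[OF siF that(2,1)])
    then show ?thesis using xt[OF that(1)] xt[OF that(2)] by (simp add: matrix_vector_mult_diff_rdistrib)
  qed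
  define Q where "Q t s = transpose (H t - H s) ** (H t - H s)" for t s
  have Hc: "continuous_on {0..\<tau> n} H" unfolding H_def
    by (rule indefinite_integral_continuous_1[OF inG])
  have Hc': "continuous_on ({0..\<tau> n} \<times> {0..\<tau> n}) (\<lambda>z. H (fst z) - H (snd z))"
    by (intro continuous_intros continuous_on_compose2[OF Hc]) auto
  have Qc: "continuous_on ({0..\<tau> n} \<times> {0..\<tau> n}) (\<lambda>(t, s). Q t s)"
    unfolding Q_def case_prod_beta
    by (rule bounded_bilinear.continuous_on[OF bounded_bilinear_transpose_mult Hc' Hc'])
  let ?A = "square_integral (\<tau> n) Q"
  have Aw: "?A *v w = square_integral (\<tau> n) (\<lambda>t s. Q t s *v w)" for w
    by (rule square_integral_linear[OF Qc bounded_linear_matrix_vector_mult_left, symmetric])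
  have "(LBINT t=ereal 0..ereal (\<tau> n). (LBINT s=ereal 0..ereal (\<tau> n).
        transpose (q_data g x u t s) *v p_data f x u t s)) = ?A *v \<theta>"
    unfolding Aw
  proof (rule interval_integral_square)
    show "continuous_on ({0..\<tau> n} \<times> {0..\<tau> n}) (\<lambda>(t, s). Q t s *v \<theta>)"
      using bounded_linear.continuous_on[OF bounded_linear_matrix_vector_mult_left Qc]
      by (simp add: case_prod_beta)
  qed (use T in \<open>auto simp: p q Q_def matrix_vector_mul_assoc\<close>)
  moreover have "(LBINT t=ereal 0..ereal (\<tau> n). (LBINT s=ereal 0..ereal (\<tau> n).
        transpose (q_data g x u t s) ** q_data g x u t s)) = ?A"
    by (rule interval_integral_square[OF Qc]) (use T in \<open>auto simp: q Q_def\<close>)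
  ultimately have "normal_equation f g x u (\<tau> n) \<eta> \<longleftrightarrow> ?A *v (\<eta> - \<theta>) = 0"
    unfolding normal_equation_def by (auto simp: matrix_vector_mult_diff_distrib)
  also have "\<dots> \<longleftrightarrow> (\<forall>t\<in>{0..\<tau> n}. \<forall>s\<in>{0..\<tau> n}. (H t - H s) *v (\<eta> - \<theta>) = 0)"
  proof
    let ?w = "\<eta> - \<theta>"
    assume A: "?A *v ?w = 0"
    \<comment> \<open>Pairing with \<open>?w\<close> turns the vector equation into a vanishing
      integral of a continuous nonnegative function, which must be zero pointwise.\<close>
    have "bounded_linear (\<lambda>M :: real^'l^'l. ?w \<bullet> (M *v ?w))"
      by (intro bounded_linear_inner_right_comp bounded_linear_matrix_vector_mult_left)
    then have zero: "square_integral (\<tau> n) (\<lambda>t s. ?w \<bullet> (Q t s *v ?w)) = 0"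
      using square_integral_linear[OF Qc] A by fastforce
    have cont: "continuous_on ({0..\<tau> n} \<times> {0..\<tau> n}) (\<lambda>(t, s). ?w \<bullet> (Q t s *v ?w))"
      using continuous_on_inner[OF continuous_on_const
          bounded_linear.continuous_on[OF bounded_linear_matrix_vector_mult_left Qc]]
      by (simp add: case_prod_beta)
    have "?w \<bullet> (Q t s *v ?w) = 0" if "t \<in> {0..\<tau> n}" "s \<in> {0..\<tau> n}" for t s
      by (rule square_integral_eq_0_imp[OF cont T _ zero that]) (simp add: Q_def inner_gram)
    then show "\<forall>t\<in>{0..\<tau> n}. \<forall>s\<in>{0..\<tau> n}. (H t - H s) *v ?w = 0"
      by (simp add: Q_def inner_gram)
  next
    let ?w = "\<eta> - \<theta>"
    assume "\<forall>t\<in>{0..\<tau> n}. \<forall>s\<in>{0..\<tau> n}. (H t - H s) *v ?w = 0"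
    then have "Q t s *v ?w = 0" if "t \<in> {0..\<tau> n}" "s \<in> {0..\<tau> n}" for t s
      using that by (simp add: Q_def matrix_vector_mul_assoc[symmetric])
    then have "integral {0..\<tau> n} (\<lambda>s. Q t s *v ?w) = integral {0..\<tau> n} (\<lambda>s. 0 :: real^'l)"
      if "t \<in> {0..\<tau> n}" for t
      using that by (intro integral_cong) auto
    then have "integral {0..\<tau> n} (\<lambda>t. integral {0..\<tau> n} (\<lambda>s. Q t s *v ?w)) =
        integral {0..\<tau> n} (\<lambda>t. 0)"
      by (intro integral_cong) simp
    then show "?A *v ?w = 0" unfolding Aw by (simp add: square_integral_def)
  qed
  also have "\<dots> \<longleftrightarrow> (\<forall>t\<in>{0..<\<tau> n}. ?G t *v (\<eta> - \<theta>) = 0)"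
    unfolding H_def by (rule integral_increments_vanish_iff[OF \<tau>0 \<tau> g])
  finally show ?thesis .
qed

section \<open>Decay with boundedly many jumps\<close>

lemma class_KL_exp:
  assumes \<alpha>: "class_K \<alpha>" and \<beta>: "class_K \<beta>" and c: "0 < c" and r: "0 < r"
  shows "class_KL (\<lambda>s t. \<alpha> (c * exp (- r * t) * \<beta> s))"
  unfolding class_KL_def
proof (intro conjI allI impI)
  have nn: "0 \<le> c * exp (- r * t) * \<beta> s" if "0 \<le> s" for s t
    using class_K_nonneg[OF \<beta> that] c by simp
  have c\<alpha>: "continuous_on {0..} \<alpha>" and c\<beta>: "continuous_on {0..} \<beta>"
    using \<alpha> \<beta> class_K_continuous_on by auto
  have "continuous_on ({0..} \<times> {0..}) (\<lambda>z :: real \<times> real. \<beta> (fst z))"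
    by (rule continuous_on_compose2[OF c\<beta> continuous_on_fst[OF continuous_on_id]]) auto
  then have "continuous_on ({0..} \<times> {0..}) (\<lambda>z. c * exp (- r * snd z) * \<beta> (fst z))"
    by (intro continuous_on_mult continuous_on_exp continuous_on_const continuous_on_snd continuous_on_id)
  moreover have "(\<lambda>z. c * exp (- r * snd z) * \<beta> (fst z)) ` ({0..} \<times> {0..}) \<subseteq> {0..}"
    by (auto intro!: mult_nonneg_nonneg less_imp_le[OF c] class_K_nonneg[OF \<beta>])
  ultimately have "continuous_on ({0..} \<times> {0..}) (\<lambda>z. \<alpha> (c * exp (- r * snd z) * \<beta> (fst z)))"
    by (rule continuous_on_compose2[OF c\<alpha>])
  then show "continuous_on ({0..} \<times> {0..}) (\<lambda>(s, t). \<alpha> (c * exp (- r * t) * \<beta> s))"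
    by (simp add: case_prod_beta)
  show "class_K (\<lambda>s. \<alpha> (c * exp (- r * t) * \<beta> s))" for t
  proof (rule class_K_compose[OF \<alpha>])
    show "class_K (\<lambda>s. c * exp (- r * t) * \<beta> s)"
      unfolding class_K_def
    proof (intro conjI)
      show "strict_mono_on {0..} (\<lambda>s. c * exp (- r * t) * \<beta> s)"
        using class_K_strict_mono[OF \<beta>] c by (simp add: strict_mono_on_def)
      show "(\<lambda>s. c * exp (- r * t) * \<beta> s) ` {0..} \<subseteq> {0..}" using nn by auto
      show "continuous_on {0..} (\<lambda>s. c * exp (- r * t) * \<beta> s)"
        using c\<beta> by (intro continuous_intros)
    qed (simp add: class_K_zero[OF \<beta>])
  qed
  fix s :: real assume s: "0 \<le> s"
  show "antimono_on {0..} (\<lambda>t. \<alpha> (c * exp (- r * t) * \<beta> s))"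
  proof (rule monotone_onI)
    fix t t' :: real assume "t \<le> t'"
    then have "c * exp (- r * t') * \<beta> s \<le> c * exp (- r * t) * \<beta> s"
      using c r class_K_nonneg[OF \<beta> s] by (intro mult_right_mono mult_left_mono) auto
    then show "\<alpha> (c * exp (- r * t) * \<beta> s) \<ge> \<alpha> (c * exp (- r * t') * \<beta> s)"
      by (intro class_K_mono[OF \<alpha>] nn s)
  qed
  have "((\<lambda>t. c * exp (- r * t) * \<beta> s) \<longlongrightarrow> c * 0 * \<beta> s) at_top"
  proof (intro tendsto_intros filterlim_compose[OF exp_at_bot])
    show "LIM t at_top. - r * t :> at_bot"
      using r by (intro filterlim_tendsto_neg_mult_at_bot[OF tendsto_const] filterlim_ident) auto
  qed
  then have "((\<lambda>t. c * exp (- r * t) * \<beta> s) \<longlongrightarrow> 0) at_top" by simp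
  moreover have "eventually (\<lambda>t. c * exp (- r * t) * \<beta> s \<in> {0..}) at_top" using nn[OF s] by simp
  ultimately have "((\<lambda>t. \<alpha> (c * exp (- r * t) * \<beta> s)) \<longlongrightarrow> \<alpha> 0) at_top"
    by (intro continuous_on_tendsto_compose[OF c\<alpha>]) auto
  then show "((\<lambda>t. \<alpha> (c * exp (- r * t) * \<beta> s)) \<longlongrightarrow> 0) at_top"
    by (simp add: class_K_zero[OF \<alpha>])
qed

text \<open>Records \<open>c\<close> as a value at time \<open>t\<close> reached from \<open>v0\<close> through \<open>j\<close> jumps by the gain \<open>A\<close>, each
  taking time at most \<open>T\<close>, separated by stretches of exponential decay: \<open>s\<close> is the start of the
  current stretch and \<open>m\<close> bounds the length of the earlier ones. Only the longest stretch is used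
  for decay.\<close>

definition jump_decay :: "real \<Rightarrow> real \<Rightarrow> (real \<Rightarrow> real) \<Rightarrow> real \<Rightarrow> nat \<Rightarrow> real \<Rightarrow> real \<Rightarrow> bool" where
  "jump_decay r T A v0 j t c \<longleftrightarrow>
     (\<exists>s m. 0 \<le> m \<and> s \<le> t \<and> s \<le> real j * T + real j * m \<and>
        c \<le> exp (- r * (t - s)) * (A ^^ j) v0 \<and>
        c \<le> (A ^^ j) (exp (- r * m) * (A ^^ j) v0))"

context
  fixes r T :: real and A :: "real \<Rightarrow> real" and v0 :: real
  assumes r: "0 < r" and T: "0 < T" and A: "class_K A" and Age: "\<forall>s\<ge>0. s \<le> A s"
    and v0: "0 \<le> v0"
begin

lemma funpow_gain_ge: "0 \<le> s \<Longrightarrow> s \<le> (A ^^ j) s"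
proof (induction j)
  case (Suc j)
  then have "s \<le> (A ^^ j) s" by simp
  moreover from this have "(A ^^ j) s \<le> A ((A ^^ j) s)" using Age Suc.prems by (meson order_trans)
  ultimately show ?case by simp
qed simp

lemma funpow_gain_nonneg: "0 \<le> s \<Longrightarrow> 0 \<le> (A ^^ j) s"
  using funpow_gain_ge by (meson order_trans)

lemma funpow_gain_mono: "0 \<le> s \<Longrightarrow> s \<le> s' \<Longrightarrow> i \<le> j \<Longrightarrow> (A ^^ i) s \<le> (A ^^ j) s'"
proof -
  assume s: "0 \<le> s" "s \<le> s'" and ij: "i \<le> j"
  have "(A ^^ i) s \<le> (A ^^ i) s'" using class_K_mono[OF class_K_funpow[OF A]] s by blast
  also have "\<dots> \<le> (A ^^ (j - i)) ((A ^^ i) s')"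
    using s by (intro funpow_gain_ge funpow_gain_nonneg) simp
  also have "\<dots> = (A ^^ j) s'" using ij by (simp flip: funpow_add comp_apply[of "A ^^ (j - i)"])
  finally show ?thesis .
qed

lemma jump_decay_start: "c \<le> v0 \<Longrightarrow> jump_decay r T A v0 0 0 c"
  unfolding jump_decay_def by (intro exI[of _ 0]) simp

text \<open>Only the current stretch grows, so the witnesses \<open>s\<close> and \<open>m\<close>
  are kept.\<close>

lemma jump_decay_flow:
  assumes "jump_decay r T A v0 j t c" "t \<le> t'" "c' \<le> exp (- r * (t' - t)) * c" "0 \<le> c"
  shows "jump_decay r T A v0 j t' c'"
proof -
  obtain s m where *: "0 \<le> m" "s \<le> t" "s \<le> real j * T + real j * m"
      "c \<le> exp (- r * (t - s)) * (A ^^ j) v0" "c \<le> (A ^^ j) (exp (- r * m) * (A ^^ j) v0)"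
    using assms(1) unfolding jump_decay_def by blast
  have "c' \<le> exp (- r * (t' - t)) * (exp (- r * (t - s)) * (A ^^ j) v0)"
    using *(4) assms(3) by (meson exp_ge_zero mult_left_mono order_trans)
  also have "\<dots> = exp (- r * (t' - s)) * (A ^^ j) v0"
    by (simp add: algebra_simps flip: exp_add mult.assoc)
  finally have 1: "c' \<le> exp (- r * (t' - s)) * (A ^^ j) v0" .
  have "exp (- r * (t' - t)) * c \<le> 1 * c"
    using r assms(2,4) by (intro mult_right_mono) auto
  then have "c' \<le> (A ^^ j) (exp (- r * m) * (A ^^ j) v0)" using assms(3) *(5) by linarith
  then show ?thesis using 1 * assms(2) unfolding jump_decay_def
    by (intro exI[of _ s] exI[of _ m]) auto
qed

text \<open>The current stretch has length \<open>t - s\<close>, so \<open>max m (t - s)\<close>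
  bounds all \<open>j + 1\<close> stretches. If the current one is the longest, its decay comes
  after all gains; since \<open>A\<close> dominates the identity, further gains may be applied on
  the outside to reach the common form.\<close>

lemma jump_decay_longest:
  assumes "jump_decay r T A v0 j t c" "0 \<le> c"
  obtains m where "0 \<le> m" "t \<le> real j * T + (real j + 1) * m"
    "c \<le> (A ^^ j) (exp (- r * m) * (A ^^ j) v0)" "c \<le> (A ^^ j) v0"
proof -
  obtain s m where *: "0 \<le> m" "s \<le> t" "s \<le> real j * T + real j * m"
      "c \<le> exp (- r * (t - s)) * (A ^^ j) v0" "c \<le> (A ^^ j) (exp (- r * m) * (A ^^ j) v0)"
    using assms(1) unfolding jump_decay_def by blast
  define m' where "m' = max m (t - s)"
  have nn: "0 \<le> (A ^^ j) v0" by (rule funpow_gain_nonneg[OF v0])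
  have "real j * m \<le> real j * m'" by (intro mult_left_mono) (auto simp: m'_def)
  then have "t \<le> real j * T + (real j + 1) * m'"
    using *(3) by (auto simp: m'_def algebra_simps)
  moreover have "c \<le> (A ^^ j) (exp (- r * m') * (A ^^ j) v0)"
  proof (cases "t - s \<le> m")
    case True then show ?thesis using *(5) by (simp add: m'_def)
  next
    case False
    have "c \<le> exp (- r * m') * (A ^^ j) v0" using False *(4) by (simp add: m'_def)
    also have "\<dots> \<le> (A ^^ j) (exp (- r * m') * (A ^^ j) v0)" using nn by (intro funpow_gain_ge) simp
    finally show ?thesis .
  qed
  moreover have "exp (- r * (t - s)) * (A ^^ j) v0 \<le> 1 * (A ^^ j) v0"
    using nn r *(2) by (intro mult_right_mono) auto
  then have "c \<le> (A ^^ j) v0" using *(4) by linarith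
  ultimately show thesis using that[of m'] *(1) by (auto simp: m'_def)
qed

text \<open>The jump closes the current stretch, which \<open>jump_decay_longest\<close> merges with
  the earlier ones; the next stretch starts at \<open>t'\<close> with length zero. The jump itself
  contributes the outer factor \<open>A\<close>, and the inner power is raised only to keep a single
  exponent.\<close>

lemma jump_decay_jump:
  assumes "jump_decay r T A v0 j t c" "t' \<le> t + T" "c' \<le> A c" "0 \<le> c"
  shows "jump_decay r T A v0 (Suc j) t' c'"
proof -
  obtain m where m: "0 \<le> m" "t \<le> real j * T + (real j + 1) * m"
    "c \<le> (A ^^ j) (exp (- r * m) * (A ^^ j) v0)" "c \<le> (A ^^ j) v0"
    using jump_decay_longest[OF assms(1,4)] by blast
  have nn: "0 \<le> (A ^^ i) v0" for i by (rule funpow_gain_nonneg[OF v0])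
  have "c' \<le> A ((A ^^ j) v0)"
    using assms(3) class_K_mono[OF A assms(4) m(4)] by linarith
  moreover have "c' \<le> (A ^^ Suc j) (exp (- r * m) * (A ^^ Suc j) v0)"
  proof -
    have "c' \<le> A ((A ^^ j) (exp (- r * m) * (A ^^ j) v0))"
      using assms(3) class_K_mono[OF A assms(4) m(3)] by linarith
    also have "\<dots> = (A ^^ Suc j) (exp (- r * m) * (A ^^ j) v0)" by simp
    also have "\<dots> \<le> (A ^^ Suc j) (exp (- r * m) * (A ^^ Suc j) v0)"
      using nn by (intro funpow_gain_mono mult_left_mono v0 order_refl mult_nonneg_nonneg) auto
    finally show ?thesis .
  qed
  moreover have "t' \<le> real (Suc j) * T + real (Suc j) * m"
    using assms(2) m(2) by (simp add: algebra_simps)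
  ultimately show ?thesis
    unfolding jump_decay_def using m(1) by (intro exI[of _ t'] exI[of _ m]) auto
qed

text \<open>From \<open>t \<le> L * (T + m)\<close> the longest stretch satisfies
  \<open>m \<ge> t / L - T\<close>; the loss of \<open>T\<close> becomes the factor
  \<open>exp (r * T)\<close> and the division the rate \<open>r / L\<close>.\<close>

lemma jump_decay_bound:
  assumes "jump_decay r T A v0 j t c" "j < L" "0 \<le> c"
  shows "c \<le> (A ^^ L) (exp (r * T) * exp (- (r / real L) * t) * (A ^^ L) v0)"
proof -
  obtain m where m: "0 \<le> m" "t \<le> real j * T + (real j + 1) * m"
    "c \<le> (A ^^ j) (exp (- r * m) * (A ^^ j) v0)"
    using jump_decay_longest[OF assms(1,3)] by blast
  have jL: "real j + 1 \<le> real L" using assms(2) by linarith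
  have "real j * T + (real j + 1) * m \<le> real L * T + real L * m"
    using jL m(1) T by (intro add_mono mult_right_mono) auto
  then have "t \<le> real L * (T + m)" using m(2) by (simp add: algebra_simps)
  then have "t / real L \<le> T + m" using jL by (simp add: divide_le_eq mult.commute)
  then have "- r * m \<le> r * (T - t / real L)"
    using r mult_left_mono[of "- m" "T - t / real L" r] by simp
  also have "\<dots> = r * T + - (r / real L) * t" by (simp add: algebra_simps)
  finally have e: "exp (- r * m) \<le> exp (r * T) * exp (- (r / real L) * t)"
    by (simp flip: exp_add)
  have nn: "0 \<le> (A ^^ i) v0" for i by (rule funpow_gain_nonneg[OF v0])
  have "exp (- r * m) * (A ^^ j) v0 \<le> (exp (r * T) * exp (- (r / real L) * t)) * (A ^^ L) v0"
    using assms(2) v0 nn by (intro mult_mono e funpow_gain_mono) auto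
  then show ?thesis
    using m(3) funpow_gain_mono[of "exp (- r * m) * (A ^^ j) v0" _ j L] nn assms(2)
    by (meson exp_ge_zero less_imp_le mult_nonneg_nonneg order_trans)
qed

end

section \<open>Motion between events\<close>

lemma unique_minimizer_iff_closest_point:
  fixes C :: "'a::euclidean_space set"
  assumes "convex C" "closed C" "C \<noteq> {}"
  shows "unique_minimizer (\<lambda>\<eta>. (norm (\<eta> - \<eta>0))\<^sup>2) (\<lambda>\<eta>. \<eta> \<in> C) z \<longleftrightarrow> z = closest_point C \<eta>0"
proof -
  have "is_arg_min (\<lambda>\<eta>. (norm (\<eta> - \<eta>0))\<^sup>2) (\<lambda>\<eta>. \<eta> \<in> C) z \<longleftrightarrow> z = closest_point C \<eta>0" for z
  proof
    assume "is_arg_min (\<lambda>\<eta>. (norm (\<eta> - \<eta>0))\<^sup>2) (\<lambda>\<eta>. \<eta> \<in> C) z"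
    then have "z \<in> C" "\<forall>y\<in>C. dist \<eta>0 z \<le> dist \<eta>0 y"
      by (auto simp: is_arg_min_def not_less dist_norm norm_minus_commute)
    then show "z = closest_point C \<eta>0" using closest_point_unique assms by blast
  next
    assume z: "z = closest_point C \<eta>0"
    have "z \<in> C" using z closest_point_in_set assms by blast
    moreover have "norm (z - \<eta>0) \<le> norm (y - \<eta>0)" if "y \<in> C" for y
      using closest_point_le[OF assms(2) that, of \<eta>0] by (simp add: z dist_norm norm_minus_commute)
    ultimately show "is_arg_min (\<lambda>\<eta>. (norm (\<eta> - \<eta>0))\<^sup>2) (\<lambda>\<eta>. \<eta> \<in> C) z"
      by (auto simp: is_arg_min_def not_less intro!: power_mono)
  qed
  then show ?thesis unfolding unique_minimizer_def by auto
qed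

lemma continuous_zero_on_Icc:
  fixes h :: "real \<Rightarrow> 'a::real_normed_vector"
  assumes "continuous_on {a..b} h" "\<And>t. t \<in> {a..<b} \<Longrightarrow> h t = 0" "a < b" "t \<in> {a..b}"
  shows "h t = 0"
  using continuous_constant_on_closure[of "{a..<b}" h 0 t] assms by simp

text \<open>The true parameter is fixed along with the data: the KL functions are indexed by it, so
  one plant can be treated at a time.\<close>

locale adaptive_loop =
  fixes \<Theta> :: "(real^'l) set"
    and f :: "(real^'n) \<times> (real^'m) \<Rightarrow> real^'n"
    and g :: "(real^'n) \<times> (real^'m) \<Rightarrow> real^'l^'n"
    and k :: "(real^'l) \<times> (real^'n) \<Rightarrow> real^'m"
    and V :: "(real^'l) \<times> (real^'n) \<Rightarrow> real"
    and a :: "real^'n \<Rightarrow> real"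
    and \<sigma> T :: real and \<theta> :: "real^'l"
  assumes closed_\<Theta>: "closed \<Theta>" and convex_\<Theta>: "convex \<Theta>"
    and smooth_f: "smooth_on UNIV f" and smooth_g: "smooth_on UNIV g"
    and f0: "f (0, 0) = 0" and g0: "g (0, 0) = 0"
    and smooth_k: "smooth_on (\<Theta> \<times> UNIV) k"
    and k0: "\<forall>\<theta>\<in>\<Theta>. k (\<theta>, 0) = 0"
    and \<sigma>: "\<sigma> > 0"
    and cont_V: "continuous_on (\<Theta> \<times> UNIV) V"
    and V: "\<forall>\<theta>\<in>\<Theta>. Ck_on 1 UNIV (\<lambda>x. V (\<theta>, x)) \<and>
           positive_definite (\<lambda>x. V (\<theta>, x)) \<and> radially_unbounded (\<lambda>x. V (\<theta>, x))"
    and V_decay: "\<forall>\<theta>\<in>\<Theta>. \<forall>x. gradient (\<lambda>y. V (\<theta>, y)) x \<bullet>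
           (f (x, k (\<theta>, x)) + g (x, k (\<theta>, x)) *v \<theta>) \<le> - 2 * \<sigma> * V (\<theta>, x)"
    and V_bounded: "\<forall>\<Theta>'. \<Theta>' \<noteq> {} \<and> compact \<Theta>' \<and> \<Theta>' \<subseteq> \<Theta> \<longrightarrow>
           (\<forall>M\<ge>0. \<exists>R>0. \<forall>\<theta>\<in>\<Theta>'. \<forall>x. V (\<theta>, x) \<le> M \<longrightarrow> norm x \<le> R)"
    and T: "T > 0"
    and cont_a: "continuous_on UNIV a" and pd_a: "positive_definite a"
    and \<theta>: "\<theta> \<in> \<Theta>"
begin

abbreviation field :: "real^'l \<Rightarrow> real^'n \<Rightarrow> real^'n" where
  "field \<equiv> closed_loop_field f g k \<theta>"

abbreviation event_time :: "real \<Rightarrow> real^'n \<Rightarrow> real^'l \<Rightarrow> ereal" where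
  "event_time t0 x0 \<eta> \<equiv> min (ereal (t0 + T)) (trigger_time f g k V a T \<theta> t0 x0 \<eta>)"

lemma a_nonneg: "0 \<le> a x" and a_pos: "x \<noteq> 0 \<Longrightarrow> 0 < a x" and a_zero: "a 0 = 0"
  using pd_a by (auto simp: positive_definite_def)

lemma V_nonneg: "\<eta> \<in> \<Theta> \<Longrightarrow> 0 \<le> V (\<eta>, x)"
  and V_pos: "\<eta> \<in> \<Theta> \<Longrightarrow> x \<noteq> 0 \<Longrightarrow> 0 < V (\<eta>, x)"
  and V_zero: "\<eta> \<in> \<Theta> \<Longrightarrow> V (\<eta>, 0) = 0"
  using V by (auto simp: positive_definite_def)

lemma cont_V_state: "\<eta> \<in> \<Theta> \<Longrightarrow> continuous_on UNIV (\<lambda>x. V (\<eta>, x))"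
  by (rule continuous_on_compose2[OF cont_V]) (auto intro!: continuous_intros)

lemma bounded_sublevel: "\<eta> \<in> \<Theta> \<Longrightarrow> 0 < M \<Longrightarrow> bounded {x. V (\<eta>, x) \<le> M}"
  using V compact_imp_bounded unfolding radially_unbounded_def by blast

text \<open>The set \<open>{\<eta>} \<times> cball 0 R\<close> is a compact part of the domain of
  \<open>k\<close>, so the local smooth extensions suffice even for \<open>\<eta>\<close> on the
  boundary of \<open>\<Theta>\<close>.\<close>

lemma feedback_lipschitz:
  fixes F :: "(real^'n) \<times> (real^'m) \<Rightarrow> 'b::real_normed_vector"
  assumes F: "smooth_on UNIV F" and \<eta>: "\<eta> \<in> \<Theta>"
  shows "ball_lipschitz (\<lambda>x. F (x, k (\<eta>, x)))"
  unfolding ball_lipschitz_def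
proof
  fix R :: real
  obtain K where K: "K-lipschitz_on ({\<eta>} \<times> cball 0 R) k"
    using smooth_on_imp_lipschitz_on_compact[OF smooth_k, of "{\<eta>} \<times> cball 0 R"] \<eta>
    by (auto simp: compact_Times)
  have "1-lipschitz_on (cball 0 R) (\<lambda>x :: real^'n. (\<eta>, x))"
    by (rule lipschitz_onI) (auto simp: dist_Pair_Pair)
  moreover have "K-lipschitz_on ((\<lambda>x. (\<eta>, x)) ` cball 0 R) k"
    using K by (rule lipschitz_on_subset) auto
  ultimately have "(K * 1)-lipschitz_on (cball 0 R) (\<lambda>x. k (\<eta>, x))"
    by (rule lipschitz_on_compose2)
  then have P: "(sqrt (1\<^sup>2 + (K * 1)\<^sup>2))-lipschitz_on (cball 0 R) (\<lambda>x. (x, k (\<eta>, x)))"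
    by (intro lipschitz_on_Pair lipschitz_on_id)
  have "compact ((\<lambda>x. (x, k (\<eta>, x))) ` cball 0 R)"
    using lipschitz_on_continuous_on[OF P] by (intro compact_continuous_image) auto
  then obtain L where "L-lipschitz_on ((\<lambda>x. (x, k (\<eta>, x))) ` cball 0 R) F"
    using smooth_on_imp_lipschitz_on_compact[OF F] by blast
  then show "\<exists>L. L-lipschitz_on (cball 0 R) (\<lambda>x. F (x, k (\<eta>, x)))"
    using lipschitz_on_compose2[OF P] by blast
qed

lemma field_lipschitz:
  assumes "\<eta> \<in> \<Theta>" shows "ball_lipschitz (field \<eta>)"
  unfolding ball_lipschitz_def closed_loop_field_def
proof
  fix R
  obtain L1 where L1: "L1-lipschitz_on (cball 0 R) (\<lambda>x. f (x, k (\<eta>, x)))"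
    using feedback_lipschitz[OF smooth_f assms] ball_lipschitz_def by blast
  obtain L2 where L2: "L2-lipschitz_on (cball 0 R) (\<lambda>x. g (x, k (\<eta>, x)))"
    using feedback_lipschitz[OF smooth_g assms] ball_lipschitz_def by blast
  obtain B where "B-lipschitz_on ((\<lambda>x. g (x, k (\<eta>, x))) ` cball 0 R) (\<lambda>M. M *v \<theta>)"
    using bounded_linear.lipschitz_boundE[OF bounded_linear_matrix_vector_mult_left] by blast
  then have "(B * L2)-lipschitz_on (cball 0 R) (\<lambda>x. g (x, k (\<eta>, x)) *v \<theta>)"
    by (rule lipschitz_on_compose2[OF L2])
  then show "\<exists>L. L-lipschitz_on (cball 0 R) (\<lambda>x. f (x, k (\<eta>, x)) + g (x, k (\<eta>, x)) *v \<theta>)"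
    using lipschitz_on_add[OF L1] by blast
qed

lemma field_zero: "\<eta> \<in> \<Theta> \<Longrightarrow> field \<eta> 0 = 0"
  using f0 g0 k0 by (simp add: closed_loop_field_def)

lemma field_solution_unique:
  assumes "\<eta> \<in> \<Theta>" "ode_solution (field \<eta>) {t0..<r} x" "ode_solution (field \<eta>) {t0..<r} y"
    "x t0 = y t0" "t \<in> {t0..<r}"
  shows "x t = y t"
proof (rule ode_solution_unique[OF field_lipschitz[OF assms(1)], of t0 t x y t])
  show "ode_solution (field \<eta>) {t0..t} x" "ode_solution (field \<eta>) {t0..t} y"
    using assms(5) by (auto intro: ode_solution_subset assms(2,3))
qed (use assms in auto)

text \<open>The trigger level exceeds the initial value of \<open>V\<close> whenever
  \<open>x0 \<noteq> 0\<close>, so the solution starts strictly inside a bounded sublevel set and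
  survives until the trigger or the timeout, however wrong \<open>\<eta>\<close> is. At
  \<open>x0 = 0\<close> the equilibrium solution lasts the full time \<open>T\<close>.\<close>

lemma inter_event_solution_exists:
  assumes \<eta>: "\<eta> \<in> \<Theta>"
  obtains r y where "t0 < r" "r \<le> t0 + T" "ereal r = event_time t0 x0 \<eta>"
    "y t0 = x0" "ode_solution (field \<eta>) {t0..r} y"
    "\<And>t. t \<in> {t0..r} \<Longrightarrow> V (\<eta>, y t) \<le> V (\<eta>, x0) + a x0"
    "r < t0 + T \<Longrightarrow> x0 \<noteq> 0 \<and> V (\<eta>, y r) = V (\<eta>, x0) + a x0"
proof (cases "x0 = 0")
  case True
  have "ode_solution (field \<eta>) {t0..t0 + T} (\<lambda>_. 0)"
    using field_zero[OF \<eta>] by (simp add: ode_solution_def)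
  then show thesis
    using True T V_zero[OF \<eta>] a_zero by (intro that[of "t0 + T" "\<lambda>_. 0"]) (auto simp: trigger_time_def)
next
  case False
  define M where "M = V (\<eta>, x0) + a x0"
  have M: "V (\<eta>, x0) < M" "0 < M"
    using a_pos[OF False] V_pos[OF \<eta> False] by (auto simp: M_def)
  obtain y r where y: "y t0 = x0" "t0 < r" "r \<le> t0 + T" "ode_solution (field \<eta>) {t0..r} y"
    "\<And>t. t \<in> {t0..<r} \<Longrightarrow> V (\<eta>, y t) < M" "V (\<eta>, y r) \<le> M" "r < t0 + T \<Longrightarrow> V (\<eta>, y r) = M"
    using ode_solution_exists_until_level[OF field_lipschitz[OF \<eta>] cont_V_state[OF \<eta>]
        bounded_sublevel[OF \<eta> M(2)] M(1) T] by blast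
  define S where "S = {t. t0 < t \<and> (\<exists>\<xi>. ode_solution (field \<eta>) {t0..t} \<xi> \<and> \<xi> t0 = x0 \<and> V (\<eta>, \<xi> t) = M)}"
  have tt: "trigger_time f g k V a T \<theta> t0 x0 \<eta> = Inf (ereal ` S)"
    using False by (simp add: trigger_time_def S_def M_def)
  \<comment> \<open>\<open>S\<close> quantifies over arbitrary solutions \<open>\<xi>\<close>;
    uniqueness identifies each of them with \<open>y\<close>, which is below the level before
    \<open>r\<close>.\<close>
  have "r \<le> t" if tS: "t \<in> S" for t
  proof (rule ccontr)
    assume t: "\<not> r \<le> t"
    obtain \<xi> where \<xi>: "t0 < t" "ode_solution (field \<eta>) {t0..t} \<xi>" "\<xi> t0 = x0" "V (\<eta>, \<xi> t) = M"
      using tS unfolding S_def by blast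
    have "ode_solution (field \<eta>) {t0..t} y" using t by (intro ode_solution_subset[OF y(4)]) auto
    then have "\<xi> t = y t"
      using ode_solution_unique[OF field_lipschitz[OF \<eta>] \<xi>(2)] \<xi>(1,3) y(1) by simp
    then show False using y(5)[of t] \<xi>(1,4) t by simp
  qed
  then have lower: "ereal r \<le> Inf (ereal ` S)" by (auto intro: Inf_greatest)
  have "ereal r = event_time t0 x0 \<eta>"
  proof (cases "r < t0 + T")
    case True
    then have "r \<in> S" using y unfolding S_def by blast
    then have "Inf (ereal ` S) = ereal r" using lower by (intro antisym Inf_lower) auto
    then show ?thesis using True by (simp add: tt)
  next
    case F: False
    \<comment> \<open>The level may be hit exactly at \<open>r\<close>, later, or never; the lower
      bound on the infimum settles all three cases.\<close>
    then have "r = t0 + T" using y(3) by simp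
    then show ?thesis using lower by (simp add: tt min_def)
  qed
  moreover have "V (\<eta>, y t) \<le> M" if "t \<in> {t0..r}" for t
    using y(5)[of t] y(6) that by (cases "t = r") auto
  ultimately show thesis
    using False y by (intro that[of r y]) (simp_all add: M_def)
qed

text \<open>Uniqueness transfers the properties of the constructed solution to any given one. The
  given \<open>x\<close> solves the equation only on the half-open interval, and its continuity
  carries the identification to the event time \<open>r\<close>.\<close>

lemma inter_event_solution:
  assumes \<eta>: "\<eta> \<in> \<Theta>" and r: "ereal r = event_time t0 (x t0) \<eta>"
    and x: "ode_solution (field \<eta>) {t0..<r} x" and c: "continuous_on {t0..r} x"
  shows "r \<le> t0 + T"
    and "ode_solution (field \<eta>) {t0..r} x"
    and "t \<in> {t0..r} \<Longrightarrow> V (\<eta>, x t) \<le> V (\<eta>, x t0) + a (x t0)"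
    and "r < t0 + T \<Longrightarrow> x t0 \<noteq> 0 \<and> V (\<eta>, x r) = V (\<eta>, x t0) + a (x t0)"
proof -
  obtain r' y where y: "t0 < r'" "r' \<le> t0 + T" "ereal r' = event_time t0 (x t0) \<eta>"
    "y t0 = x t0" "ode_solution (field \<eta>) {t0..r'} y"
    "\<And>t. t \<in> {t0..r'} \<Longrightarrow> V (\<eta>, y t) \<le> V (\<eta>, x t0) + a (x t0)"
    "r' < t0 + T \<Longrightarrow> x t0 \<noteq> 0 \<and> V (\<eta>, y r') = V (\<eta>, x t0) + a (x t0)"
    using inter_event_solution_exists[OF \<eta>] by metis
  have "ereal r' = ereal r" by (rule trans[OF y(3) r[symmetric]])
  then have [simp]: "r' = r" by simp
  have eq: "x t = y t" if "t \<in> {t0..<r}" for t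
  proof -
    have "ode_solution (field \<eta>) {t0..<r} y" by (rule ode_solution_subset[OF y(5)]) auto
    then show ?thesis using field_solution_unique[OF \<eta> x, of y t] y(4) that by simp
  qed
  have cont: "continuous_on {t0..r} (\<lambda>t. x t - y t)"
    using c ode_solution_continuous_on[OF y(5)] by (intro continuous_on_diff) simp_all
  have "x r - y r = 0"
    by (rule continuous_zero_on_Icc[OF cont]) (use y(1) eq in auto)
  then have eq': "x t = y t" if "t \<in> {t0..r}" for t
    using eq[of t] that by (cases "t = r") auto
  show "r \<le> t0 + T" using y by simp
  show "ode_solution (field \<eta>) {t0..r} x"
    using y(5) eq' by (intro ode_solution_cong[of "{t0..r}" y x]) auto
  show "t \<in> {t0..r} \<Longrightarrow> V (\<eta>, x t) \<le> V (\<eta>, x t0) + a (x t0)" using y(6)[of t] eq' by simp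
  show "r < t0 + T \<Longrightarrow> x t0 \<noteq> 0 \<and> V (\<eta>, x r) = V (\<eta>, x t0) + a (x t0)"
    using y(1,7) eq'[of r] by simp
qed

lemma lyapunov_decay:
  assumes \<eta>: "\<eta> \<in> \<Theta>" and x: "ode_solution (field \<eta>) {t0..r} x"
    and ker: "\<And>t. t \<in> {t0..<r} \<Longrightarrow> g (x t, k (\<eta>, x t)) *v (\<eta> - \<theta>) = 0" and t: "t \<in> {t0..r}"
  shows "V (\<eta>, x t) \<le> exp (- (2 * \<sigma>) * (t - t0)) * V (\<eta>, x t0)"
proof (rule exp_decay)
  show "t0 \<le> t" using t by simp
  show "continuous_on {t0..t} (\<lambda>s. V (\<eta>, x s))"
    using t by (intro continuous_on_compose2[OF cont_V_state[OF \<eta>]]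
        continuous_on_subset[OF ode_solution_continuous_on[OF x]]) auto
  fix s assume s: "t0 < s" "s < t"
  let ?D = "gradient (\<lambda>y. V (\<eta>, y)) (x s)"
  have "(\<lambda>y. V (\<eta>, y)) differentiable (at (x s))" using V \<eta> by simp
  then have D: "((\<lambda>y. V (\<eta>, y)) has_derivative (\<lambda>v. v \<bullet> ?D)) (at (x s))"
    by (rule gradient_works)
  have "s \<in> interior {t0..r}" using s t by auto
  then have "(x has_vector_derivative field \<eta> (x s)) (at s)" by (rule ode_solution_interior[OF x])
  then have "((\<lambda>s. V (\<eta>, x s)) has_derivative (\<lambda>h. (h *\<^sub>R field \<eta> (x s)) \<bullet> ?D)) (at s)"
    unfolding has_vector_derivative_def using D by (rule has_derivative_compose)
  then have "((\<lambda>s. V (\<eta>, x s)) has_real_derivative (field \<eta> (x s) \<bullet> ?D)) (at s)"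
    by (simp add: has_field_derivative_def mult_commute_abs)
  \<comment> \<open>The kernel condition replaces the true parameter by \<open>\<eta>\<close> in the
    field, and this is the field to which \<open>V_decay\<close> applies.\<close>
  moreover have "field \<eta> (x s) = f (x s, k (\<eta>, x s)) + g (x s, k (\<eta>, x s)) *v \<eta>"
    using ker[of s] s t by (simp add: closed_loop_field_def matrix_vector_mult_diff_distrib)
  then have "field \<eta> (x s) \<bullet> ?D \<le> - (2 * \<sigma>) * V (\<eta>, x s)"
    using V_decay \<eta> by (simp add: inner_commute)
  ultimately show "\<exists>d. ((\<lambda>s. V (\<eta>, x s)) has_real_derivative d) (at s) \<and> d \<le> - (2 * \<sigma>) * V (\<eta>, x s)"
    by blast
qed

section \<open>Hybrid solutions\<close>

definition consistent :: "(real^'l) set \<Rightarrow> (real^'l) set" where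
  "consistent N = {\<eta>\<in>\<Theta>. \<eta> - \<theta> \<in> N}"

lemma
  assumes "subspace N"
  shows convex_consistent: "convex (consistent N)" and closed_consistent: "closed (consistent N)"
    and true_parameter_consistent: "\<theta> \<in> consistent N"
proof -
  have "consistent N = \<Theta> \<inter> (+) \<theta> ` N"
    by (force simp: consistent_def image_iff algebra_simps)
  then show "convex (consistent N)" "closed (consistent N)"
    by (simp_all add: convex_Int closed_Int convex_translation closed_translation
        closed_\<Theta> convex_\<Theta> subspace_imp_convex[OF assms] closed_subspace[OF assms])
  show "\<theta> \<in> consistent N" using \<theta> subspace_0[OF assms] by (simp add: consistent_def)
qed

text \<open>The input at \<open>r\<close> already uses the estimate chosen at \<open>r\<close>; the
  half-open interval keeps the set a function of the past alone, so the update defined through it is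
  not circular.\<close>

definition unidentified :: "(real \<Rightarrow> real^'n) \<Rightarrow> (real \<Rightarrow> real^'l) \<Rightarrow> real \<Rightarrow> (real^'l) set" where
  "unidentified x \<theta>h r = {w. \<forall>t\<in>{0..<r}. g (x t, input_signal k x \<theta>h t) *v w = 0}"

lemma subspace_unidentified: "subspace (unidentified x \<theta>h r)"
  unfolding unidentified_def
  by (auto simp: subspace_def matrix_vector_right_distrib matrix_vector_mult_scaleR)

lemma unidentified_antimono: "r \<le> r' \<Longrightarrow> unidentified x \<theta>h r' \<subseteq> unidentified x \<theta>h r"
  by (auto simp: unidentified_def)

lemma unidentified_0: "unidentified x \<theta>h 0 = UNIV"
  by (simp add: unidentified_def)

text \<open>Only the first \<open>n\<close> intervals enter, so the same statement serves for
  analysing a given solution and for verifying a constructed one.\<close>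

lemma update_iff_closest_point:
  assumes \<tau>0: "\<tau> 0 = 0" and n: "0 < n" and \<tau>: "\<And>i. i < n \<Longrightarrow> \<tau> i < \<tau> (Suc i)"
    and \<theta>h: "\<And>i. i < n \<Longrightarrow> \<theta>h (\<tau> i) \<in> \<Theta>"
    and const: "\<And>i t. i < n \<Longrightarrow> t \<in> {\<tau> i..<\<tau> (Suc i)} \<Longrightarrow> \<theta>h t = \<theta>h (\<tau> i)"
    and x: "continuous_on {0..\<tau> n} x"
    and sol: "\<And>i. i < n \<Longrightarrow> ode_solution (field (\<theta>h (\<tau> i))) {\<tau> i..<\<tau> (Suc i)} x"
  shows "unique_minimizer (\<lambda>\<eta>. (norm (\<eta> - \<eta>0))\<^sup>2)
      (\<lambda>\<eta>. \<eta> \<in> \<Theta> \<and> normal_equation f g x (input_signal k x \<theta>h) (\<tau> n) \<eta>) z \<longleftrightarrow>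
    z = closest_point (consistent (unidentified x \<theta>h (\<tau> n))) \<eta>0"
proof -
  have sub: "{\<tau> i..\<tau> (Suc i)} \<subseteq> {0..\<tau> n}" if "i < n" for i
    using strict_increasing_bounds[of n \<tau> 0 i, OF \<tau>] strict_increasing_bounds[of n \<tau> "Suc i" n, OF \<tau>]
      that \<tau>0 by auto
  have pc: "piecewise_continuous_upto \<tau> n (\<lambda>t. F (x t, input_signal k x \<theta>h t))"
    if F: "smooth_on UNIV F" for F :: "(real^'n) \<times> (real^'m) \<Rightarrow> 'b::real_normed_vector"
    unfolding piecewise_continuous_upto_def
  proof (intro allI impI)
    fix i assume i: "i < n"
    have "continuous_on {\<tau> i..\<tau> (Suc i)} (\<lambda>t. F (x t, k (\<theta>h (\<tau> i), x t)))"
      by (rule continuous_on_compose2[OF ball_lipschitz_continuous_on[OF feedback_lipschitz[OF F \<theta>h[OF i]]]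
            continuous_on_subset[OF x sub[OF i]] subset_UNIV])
    then show "\<exists>K. continuous_on {\<tau> i..\<tau> (Suc i)} K \<and>
        (\<forall>t\<in>{\<tau> i..<\<tau> (Suc i)}. F (x t, input_signal k x \<theta>h t) = K t)"
    proof (intro exI conjI ballI)
      fix t assume "t \<in> {\<tau> i..<\<tau> (Suc i)}"
      from const[OF i this]
      show "F (x t, input_signal k x \<theta>h t) = F (x t, k (\<theta>h (\<tau> i), x t))"
        by (simp add: input_signal_def)
    qed
  qed
  have "normal_equation f g x (input_signal k x \<theta>h) (\<tau> n) \<eta> \<longleftrightarrow> \<eta> - \<theta> \<in> unidentified x \<theta>h (\<tau> n)" for \<eta>
    unfolding unidentified_def mem_Collect_eq
  proof (rule normal_equation_iff[OF \<tau>0 n \<tau> x _ pc[OF smooth_f] pc[OF smooth_g]])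
    fix i t assume i: "i < n" and t: "t \<in> {\<tau> i<..<\<tau> (Suc i)}"
    have "(x has_vector_derivative field (\<theta>h (\<tau> i)) (x t)) (at t)"
      using t by (intro ode_solution_interior[OF sol[OF i]]) auto
    then show "(x has_vector_derivative f (x t, input_signal k x \<theta>h t) +
        g (x t, input_signal k x \<theta>h t) *v \<theta>) (at t)"
      using const[OF i, of t] t by (simp add: closed_loop_field_def input_signal_def)
  qed
  then have eq: "(\<lambda>\<eta>. \<eta> \<in> \<Theta> \<and> normal_equation f g x (input_signal k x \<theta>h) (\<tau> n) \<eta>) =
      (\<lambda>\<eta>. \<eta> \<in> consistent (unidentified x \<theta>h (\<tau> n)))"
    by (simp add: consistent_def)
  have ne: "consistent (unidentified x \<theta>h (\<tau> n)) \<noteq> {}"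
    using true_parameter_consistent[OF subspace_unidentified] by blast
  show ?thesis
    unfolding eq
    by (rule unique_minimizer_iff_closest_point[OF convex_consistent[OF subspace_unidentified]
          closed_consistent[OF subspace_unidentified] ne])
qed

section \<open>Event structure of a given solution\<close>

abbreviation hybrid :: "(real \<Rightarrow> real^'n) \<Rightarrow> (real \<Rightarrow> real^'l) \<Rightarrow> (nat \<Rightarrow> real) \<Rightarrow> bool" where
  "hybrid \<equiv> hybrid_solution \<Theta> f g k V a T \<theta>"

lemma
  assumes hyb: "hybrid x \<theta>h \<tau>"
  shows hybrid_start: "\<tau> 0 = 0"
    and hybrid_strict_mono: "strict_mono \<tau>"
    and hybrid_step: "\<tau> i < \<tau> (Suc i)"
    and hybrid_cont: "continuous_on (time_domain \<tau>) x"
    and hybrid_const: "t \<in> {\<tau> i..<\<tau> (Suc i)} \<Longrightarrow> \<theta>h t = \<theta>h (\<tau> i)"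
    and hybrid_Ico_solution: "ode_solution (field (\<theta>h (\<tau> i))) {\<tau> i..<\<tau> (Suc i)} x"
    and hybrid_event: "ereal (\<tau> (Suc i)) = event_time (\<tau> i) (x (\<tau> i)) (\<theta>h (\<tau> i))"
  using hyb by (auto simp: hybrid_solution_def strict_mono_Suc_iff)

lemma hybrid_estimate_in:
  assumes hyb: "hybrid x \<theta>h \<tau>"
  shows "\<theta>h (\<tau> i) \<in> \<Theta>"
proof -
  have "\<tau> i \<in> time_domain \<tau>" using hybrid_step[OF hyb, of i] by (force simp: time_domain_def)
  then show ?thesis using hyb by (simp add: hybrid_solution_def)
qed

lemma hybrid_mono:
  assumes hyb: "hybrid x \<theta>h \<tau>"
  shows "i \<le> j \<Longrightarrow> \<tau> i \<le> \<tau> j"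
  using hybrid_strict_mono[OF hyb] by (simp add: strict_mono_less_eq)

lemma hybrid_nonneg:
  assumes hyb: "hybrid x \<theta>h \<tau>"
  shows "0 \<le> \<tau> i"
  using hybrid_mono[OF hyb, of 0 i] by (simp add: hybrid_start[OF hyb])

lemma Icc_subset_time_domain:
  assumes hyb: "hybrid x \<theta>h \<tau>"
  shows "{0..\<tau> n} \<subseteq> time_domain \<tau>"
proof
  fix t assume "t \<in> {0..\<tau> n}"
  then have "t \<in> {\<tau> 0..<\<tau> (Suc n)}" using hybrid_step[OF hyb, of n] hybrid_start[OF hyb] by auto
  then obtain i where "t \<in> {\<tau> i..<\<tau> (Suc i)}"
    using Ico_partition[of "Suc n" \<tau> t, OF hybrid_step[OF hyb]] by blast
  then show "t \<in> time_domain \<tau>" unfolding time_domain_def by blast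
qed

lemma hybrid_cont_Icc:
  assumes hyb: "hybrid x \<theta>h \<tau>"
  shows "continuous_on {0..\<tau> n} x"
  using hybrid_cont[OF hyb] Icc_subset_time_domain[OF hyb] by (rule continuous_on_subset)

lemma hybrid_cont_step:
  assumes hyb: "hybrid x \<theta>h \<tau>"
  shows "continuous_on {\<tau> i..\<tau> (Suc i)} x"
  using hybrid_nonneg[OF hyb, of i] by (intro continuous_on_subset[OF hybrid_cont_Icc[OF hyb, of "Suc i"]]) auto

lemma
  assumes hyb: "hybrid x \<theta>h \<tau>"
  shows hybrid_step_le: "\<tau> (Suc i) \<le> \<tau> i + T"
    and hybrid_Icc_solution: "ode_solution (field (\<theta>h (\<tau> i))) {\<tau> i..\<tau> (Suc i)} x"
    and hybrid_V_le: "t \<in> {\<tau> i..\<tau> (Suc i)} \<Longrightarrow>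
      V (\<theta>h (\<tau> i), x t) \<le> V (\<theta>h (\<tau> i), x (\<tau> i)) + a (x (\<tau> i))"
    and hybrid_triggered: "\<tau> (Suc i) < \<tau> i + T \<Longrightarrow> x (\<tau> i) \<noteq> 0 \<and>
      V (\<theta>h (\<tau> i), x (\<tau> (Suc i))) = V (\<theta>h (\<tau> i), x (\<tau> i)) + a (x (\<tau> i))"
  by (rule inter_event_solution[OF hybrid_estimate_in[OF hyb] hybrid_event[OF hyb] hybrid_Ico_solution[OF hyb]
        hybrid_cont_step[OF hyb]]; assumption?)+

lemma hybrid_time_le:
  assumes hyb: "hybrid x \<theta>h \<tau>"
  shows "\<tau> i \<le> real i * T"
proof (induction i)
  case (Suc i)
  then show ?case using hybrid_step_le[OF hyb, of i] by (simp add: algebra_simps)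
qed (simp add: hybrid_start[OF hyb])

lemma hybrid_update:
  assumes hyb: "hybrid x \<theta>h \<tau>"
  shows "\<theta>h (\<tau> (Suc i)) = closest_point (consistent (unidentified x \<theta>h (\<tau> (Suc i)))) (\<theta>h (\<tau> i))"
proof -
  have "unique_minimizer (\<lambda>\<eta>. (norm (\<eta> - \<theta>h (\<tau> i)))\<^sup>2)
      (\<lambda>\<eta>. \<eta> \<in> \<Theta> \<and> normal_equation f g x (input_signal k x \<theta>h) (\<tau> (Suc i)) \<eta>) (\<theta>h (\<tau> (Suc i)))"
    using hyb by (simp add: hybrid_solution_def)
  then show ?thesis
    by (subst (asm) update_iff_closest_point[where n = "Suc i" and \<tau> = \<tau>])
       (auto simp: hybrid_start[OF hyb] hybrid_step[OF hyb] hybrid_estimate_in[OF hyb] hybrid_const[OF hyb] hybrid_cont_Icc[OF hyb]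
         hybrid_Ico_solution[OF hyb])
qed

lemma hybrid_consistent:
  assumes hyb: "hybrid x \<theta>h \<tau>"
  shows "\<theta>h (\<tau> i) \<in> consistent (unidentified x \<theta>h (\<tau> i))"
proof (cases i)
  case 0
  then show ?thesis using hybrid_estimate_in[OF hyb, of 0] by (simp add: hybrid_start[OF hyb] unidentified_0 consistent_def)
next
  case (Suc j)
  show ?thesis unfolding Suc hybrid_update[OF hyb]
    using closest_point_in_set[OF closed_consistent] true_parameter_consistent subspace_unidentified
    by blast
qed

lemma hybrid_kernel:
  assumes hyb: "hybrid x \<theta>h \<tau>"
    and "t \<in> {0..<\<tau> i}" shows "g (x t, input_signal k x \<theta>h t) *v (\<theta>h (\<tau> i) - \<theta>) = 0"
  using hybrid_consistent[OF hyb, of i] assms by (simp add: consistent_def unidentified_def)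

text \<open>An estimate that is still consistent is its own closest point. A change therefore
  exhibits a vector, the old error, that has just left the unidentified subspace.\<close>

lemma hybrid_update_eq_iff:
  assumes hyb: "hybrid x \<theta>h \<tau>"
  shows "\<theta>h (\<tau> (Suc i)) = \<theta>h (\<tau> i) \<longleftrightarrow> \<theta>h (\<tau> i) - \<theta> \<in> unidentified x \<theta>h (\<tau> (Suc i))"
proof
  assume "\<theta>h (\<tau> (Suc i)) = \<theta>h (\<tau> i)"
  then show "\<theta>h (\<tau> i) - \<theta> \<in> unidentified x \<theta>h (\<tau> (Suc i))"
    using hybrid_consistent[OF hyb, of "Suc i"] by (simp add: consistent_def)
next
  assume "\<theta>h (\<tau> i) - \<theta> \<in> unidentified x \<theta>h (\<tau> (Suc i))"
  then have "\<theta>h (\<tau> i) \<in> consistent (unidentified x \<theta>h (\<tau> (Suc i)))"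
    using hybrid_estimate_in[OF hyb] by (simp add: consistent_def)
  then show "\<theta>h (\<tau> (Suc i)) = \<theta>h (\<tau> i)" unfolding hybrid_update[OF hyb] by (rule closest_point_self)
qed

text \<open>The projection onto the consistent set is nonexpansive and fixes the true parameter.\<close>

lemma hybrid_error_le:
  assumes hyb: "hybrid x \<theta>h \<tau>"
  shows "dist (\<theta>h (\<tau> i)) \<theta> \<le> dist (\<theta>h 0) \<theta>"
proof (induction i)
  case (Suc i)
  let ?C = "consistent (unidentified x \<theta>h (\<tau> (Suc i)))"
  have C: "convex ?C" "closed ?C" "\<theta> \<in> ?C"
    using convex_consistent closed_consistent true_parameter_consistent subspace_unidentified by blast+
  have "dist (closest_point ?C (\<theta>h (\<tau> i))) (closest_point ?C \<theta>) \<le> dist (\<theta>h (\<tau> i)) \<theta>"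
    using C by (intro closest_point_lipschitz) auto
  then show ?case using Suc closest_point_self[OF C(3)] hybrid_update[OF hyb, of i] by simp
qed (simp add: hybrid_start[OF hyb])

lemma hybrid_stays_exact:
  assumes hyb: "hybrid x \<theta>h \<tau>"
  shows "\<theta>h (\<tau> i) = \<theta> \<Longrightarrow> i \<le> j \<Longrightarrow> \<theta>h (\<tau> j) = \<theta>"
proof (induction j)
  case (Suc j)
  show ?case
  proof (cases "i = Suc j")
    case False
    then have "\<theta>h (\<tau> j) = \<theta>" using Suc by simp
    then show ?thesis
      using hybrid_update_eq_iff[OF hyb, of j] subspace_0[OF subspace_unidentified] by simp
  qed (use Suc in simp)
qed simp

text \<open>The update at the end of the interval judges the interval in retrospect: the new error
  is in the kernel over all the past, and being the old error as well it makes the flow just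
  completed decay.\<close>

lemma hybrid_unchanged_decay:
  assumes hyb: "hybrid x \<theta>h \<tau>"
    and eq: "\<theta>h (\<tau> (Suc i)) = \<theta>h (\<tau> i)" and t: "t \<in> {\<tau> i..\<tau> (Suc i)}"
  shows "V (\<theta>h (\<tau> i), x t) \<le> exp (- (2 * \<sigma>) * (t - \<tau> i)) * V (\<theta>h (\<tau> i), x (\<tau> i))"
proof (rule lyapunov_decay[OF hybrid_estimate_in[OF hyb] hybrid_Icc_solution[OF hyb] _ t])
  fix s assume s: "s \<in> {\<tau> i..<\<tau> (Suc i)}"
  then have "s \<in> {0..<\<tau> (Suc i)}" using hybrid_nonneg[OF hyb, of i] by auto
  from hybrid_kernel[OF hyb this] show "g (x s, k (\<theta>h (\<tau> i), x s)) *v (\<theta>h (\<tau> i) - \<theta>) = 0"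
    using eq hybrid_const[OF hyb s] by (simp add: input_signal_def)
qed

lemma hybrid_unchanged_full_step:
  assumes hyb: "hybrid x \<theta>h \<tau>"
    and eq: "\<theta>h (\<tau> (Suc i)) = \<theta>h (\<tau> i)"
  shows "\<tau> (Suc i) = \<tau> i + T"
proof (rule ccontr)
  let ?\<eta> = "\<theta>h (\<tau> i)"
  assume "\<tau> (Suc i) \<noteq> \<tau> i + T"
  then have trig: "x (\<tau> i) \<noteq> 0" "V (?\<eta>, x (\<tau> (Suc i))) = V (?\<eta>, x (\<tau> i)) + a (x (\<tau> i))"
    using hybrid_triggered[OF hyb, of i] hybrid_step_le[OF hyb, of i] by auto
  have "V (?\<eta>, x (\<tau> (Suc i))) \<le> exp (- (2 * \<sigma>) * (\<tau> (Suc i) - \<tau> i)) * V (?\<eta>, x (\<tau> i))"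
    using hybrid_unchanged_decay[OF hyb eq, of "\<tau> (Suc i)"] hybrid_step[OF hyb, of i] by simp
  also have "\<dots> \<le> 1 * V (?\<eta>, x (\<tau> i))"
    using \<sigma> hybrid_step[OF hyb, of i] V_nonneg[OF hybrid_estimate_in[OF hyb]] by (intro mult_right_mono) auto
  finally show False using trig(2) a_pos[OF trig(1)] by simp
qed

section \<open>Finitely many changes of the estimate, unbounded event times\<close>

lemma hybrid_changes_dim:
  assumes hyb: "hybrid x \<theta>h \<tau>"
  shows "card {j. j < i \<and> \<theta>h (\<tau> (Suc j)) \<noteq> \<theta>h (\<tau> j)} + dim (unidentified x \<theta>h (\<tau> i)) \<le> CARD('l)"
proof (induction i)
  case 0
  then show ?case by (simp add: hybrid_start[OF hyb] unidentified_0 dim_UNIV)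
next
  case (Suc i)
  let ?N = "\<lambda>i. unidentified x \<theta>h (\<tau> i)"
  have sub: "?N (Suc i) \<subseteq> ?N i" by (intro unidentified_antimono hybrid_mono[OF hyb]) simp
  show ?case
  proof (cases "\<theta>h (\<tau> (Suc i)) = \<theta>h (\<tau> i)")
    case True
    then have "{j. j < Suc i \<and> \<theta>h (\<tau> (Suc j)) \<noteq> \<theta>h (\<tau> j)} = {j. j < i \<and> \<theta>h (\<tau> (Suc j)) \<noteq> \<theta>h (\<tau> j)}"
      by (auto simp: less_Suc_eq)
    then show ?thesis using Suc dim_subset[OF sub] by simp
  next
    case False
    then have "{j. j < Suc i \<and> \<theta>h (\<tau> (Suc j)) \<noteq> \<theta>h (\<tau> j)} =
        insert i {j. j < i \<and> \<theta>h (\<tau> (Suc j)) \<noteq> \<theta>h (\<tau> j)}"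
      by (auto simp: less_Suc_eq)
    \<comment> \<open>The old error witnesses that the inclusion is strict.\<close>
    moreover have "\<theta>h (\<tau> i) - \<theta> \<in> ?N i" using hybrid_consistent[OF hyb, of i] by (simp add: consistent_def)
    then have "?N (Suc i) \<subset> ?N i" using False sub hybrid_update_eq_iff[OF hyb, of i] by blast
    then have "span (?N (Suc i)) \<subset> span (?N i)"
      by (simp add: span_eq_iff[THEN iffD2, OF subspace_unidentified])
    then have "dim (?N (Suc i)) < dim (?N i)" by (rule dim_psubset)
    ultimately show ?thesis using Suc by simp
  qed
qed

lemma hybrid_eventually_constant:
  assumes hyb: "hybrid x \<theta>h \<tau>"
  obtains m where "\<And>i. m \<le> i \<Longrightarrow> \<theta>h (\<tau> i) = \<theta>h (\<tau> m)" "\<And>i. m \<le> i \<Longrightarrow> \<tau> (Suc i) = \<tau> i + T"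
proof -
  let ?B = "{j. \<theta>h (\<tau> (Suc j)) \<noteq> \<theta>h (\<tau> j)}"
  have "finite ?B"
  proof (rule ccontr)
    assume "infinite ?B"
    then obtain B where B: "B \<subseteq> ?B" "finite B" "card B = Suc (CARD('l))"
      using infinite_arbitrarily_large by blast
    obtain i where "B \<subseteq> {..<i}" using finite_nat_iff_bounded B(2) by blast
    then have "B \<subseteq> {j. j < i \<and> \<theta>h (\<tau> (Suc j)) \<noteq> \<theta>h (\<tau> j)}" using B(1) by auto
    then have "card B \<le> card {j. j < i \<and> \<theta>h (\<tau> (Suc j)) \<noteq> \<theta>h (\<tau> j)}" by (intro card_mono) auto
    then show False using hybrid_changes_dim[OF hyb, of i] B(3) by simp
  qed
  then obtain m where m: "?B \<subseteq> {..<m}" using finite_nat_iff_bounded by blast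
  then have eq: "\<theta>h (\<tau> (Suc i)) = \<theta>h (\<tau> i)" if "m \<le> i" for i using that by force
  have "\<theta>h (\<tau> i) = \<theta>h (\<tau> m)" if "m \<le> i" for i
    using that by (induction i rule: dec_induct) (use eq in auto)
  then show thesis using that eq hybrid_unchanged_full_step[OF hyb] by blast
qed

lemma hybrid_time_unbounded:
  assumes hyb: "hybrid x \<theta>h \<tau>"
  shows "\<exists>n. t < \<tau> n"
proof -
  obtain m where m: "\<And>i. m \<le> i \<Longrightarrow> \<tau> (Suc i) = \<tau> i + T" using hybrid_eventually_constant[OF hyb] by metis
  have "\<tau> (m + i) = \<tau> m + real i * T" for i
    by (induction i) (simp_all add: m algebra_simps)
  moreover obtain i where "t < real i * T" using T reals_Archimedean3 by blast
  ultimately have "t < \<tau> (m + i)" using hybrid_nonneg[OF hyb, of m] by simp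
  then show ?thesis by blast
qed

lemma hybrid_time_index:
  assumes hyb: "hybrid x \<theta>h \<tau>"
    and "0 \<le> t" obtains i where "t \<in> {\<tau> i..<\<tau> (Suc i)}"
proof -
  obtain n where "t < \<tau> n" using hybrid_time_unbounded[OF hyb] by blast
  then show thesis using Ico_partition[of n \<tau> t, OF hybrid_step[OF hyb]] assms hybrid_start[OF hyb] that by auto
qed

lemma hybrid_time_domain:
  assumes hyb: "hybrid x \<theta>h \<tau>"
  shows "time_domain \<tau> = {0..}"
proof -
  have "{\<tau> i..<\<tau> (Suc i)} \<subseteq> {0..}" for i using hybrid_nonneg[OF hyb, of i] by auto
  then have "time_domain \<tau> \<subseteq> {0..}" unfolding time_domain_def by blast
  moreover have "t \<in> time_domain \<tau>" if t: "0 \<le> t" for t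
  proof -
    obtain i where "t \<in> {\<tau> i..<\<tau> (Suc i)}" using t by (rule hybrid_time_index[OF hyb])
    then show ?thesis unfolding time_domain_def by blast
  qed
  then have "{0..} \<subseteq> time_domain \<tau>" by auto
  ultimately show ?thesis by (rule equalityI)
qed

lemma hybrid_limit_estimate:
  assumes hyb: "hybrid x \<theta>h \<tau>"
  shows "\<exists>ts\<ge>0. \<exists>\<theta>s\<in>\<Theta>. (\<forall>t\<ge>ts. \<theta>h t = \<theta>s) \<and>
     (\<forall>t\<ge>0. g (x t, input_signal k x \<theta>h t) *v (\<theta> - \<theta>s) = 0)"
proof -
  obtain m where m: "\<And>i. m \<le> i \<Longrightarrow> \<theta>h (\<tau> i) = \<theta>h (\<tau> m)" using hybrid_eventually_constant[OF hyb] by metis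
  have "\<theta>h t = \<theta>h (\<tau> m)" if t: "\<tau> m \<le> t" for t
  proof -
    have "0 \<le> t" using t hybrid_nonneg[OF hyb, of m] by simp
    then obtain i where i: "t \<in> {\<tau> i..<\<tau> (Suc i)}" by (rule hybrid_time_index[OF hyb])
    then have "\<tau> m < \<tau> (Suc i)" using t by simp
    then have "m \<le> i" using strict_mono_less[OF hybrid_strict_mono[OF hyb]] by simp
    then show ?thesis using hybrid_const[OF hyb i] m[of i] by simp
  qed
  moreover have "g (x t, input_signal k x \<theta>h t) *v (\<theta> - \<theta>h (\<tau> m)) = 0" if "0 \<le> t" for t
  proof -
    obtain n where "t < \<tau> n" using hybrid_time_unbounded[OF hyb] by blast
    \<comment> \<open>An event past both \<open>t\<close> and the last change: its estimate is the
      final one, and its kernel relation covers \<open>t\<close>.\<close>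
    then have "t \<in> {0..<\<tau> (max m n)}" using that hybrid_mono[OF hyb, of n "max m n"] by auto
    from hybrid_kernel[OF hyb this] show ?thesis
      using m[of "max m n"] by (simp add: matrix_vector_mult_diff_distrib)
  qed
  ultimately show ?thesis using hybrid_nonneg[OF hyb] hybrid_estimate_in[OF hyb] by blast
qed

text \<open>An estimate still wrong at \<open>t\<close> would make the solution itself violate
  observability. Since \<open>\<tau> N \<le> N * T\<close>, at least \<open>N\<close> events have
  passed; exactness is permanent, so all errors up to index \<open>N\<close> are nonzero, and
  observability would force \<open>x 0 = 0\<close>.\<close>

lemma hybrid_observable_identifies:
  assumes hyb: "hybrid x \<theta>h \<tau>"
    and obs: "parameter_observable \<Theta> f g k N" and N: "0 < N" and x0: "x 0 \<noteq> 0"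
    and t: "real N * T \<le> t"
  shows "\<theta>h t = \<theta>"
proof (rule ccontr)
  assume ne: "\<theta>h t \<noteq> \<theta>"
  have "0 \<le> t" using t T by (meson mult_nonneg_nonneg of_nat_0_le_iff less_imp_le order_trans)
  then obtain n where n: "t \<in> {\<tau> n..<\<tau> (Suc n)}" by (rule hybrid_time_index[OF hyb])
  have "real N * T < real (Suc n) * T" using n t hybrid_time_le[OF hyb, of "Suc n"] by simp
  then have "N \<le> n" using T by simp
  define d where "d i = \<theta>h (\<tau> i) - \<theta>" for i
  have d: "d i \<noteq> 0" if "i \<le> N" for i
    using hybrid_stays_exact[OF hyb, of i n] hybrid_const[OF hyb n] ne that \<open>N \<le> n\<close> by (auto simp: d_def)
  have in\<Theta>: "\<theta> + d i \<in> \<Theta>" for i using hybrid_estimate_in[OF hyb] by (simp add: d_def)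
  have C1: "x C1_differentiable_on ({0..\<tau> N} - \<tau> ` {..N})"
    unfolding C1_differentiable_on_def
  proof (intro exI conjI ballI)
    let ?D = "\<lambda>t. field (\<theta>h t) (x t)"
    \<comment> \<open>The estimate is constant on each open interval between events, so
      \<open>?D\<close> is continuous on their union although it may jump at the events.\<close>
    have cover: "{0..\<tau> N} - \<tau> ` {..N} \<subseteq> (\<Union>i\<in>{..<N}. {\<tau> i<..<\<tau> (Suc i)})"
    proof
      fix s assume s: "s \<in> {0..\<tau> N} - \<tau> ` {..N}"
      then have "s \<in> {\<tau> 0..<\<tau> N}" by (cases "s = \<tau> N") (auto simp: hybrid_start[OF hyb])
      then obtain i where i: "i < N" "s \<in> {\<tau> i..<\<tau> (Suc i)}"
        using Ico_partition[of N \<tau> s, OF hybrid_step[OF hyb]] by blast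
      moreover have "s \<noteq> \<tau> i" using s i(1) by auto
      ultimately show "s \<in> (\<Union>i\<in>{..<N}. {\<tau> i<..<\<tau> (Suc i)})" by force
    qed
    show "(x has_vector_derivative ?D s) (at s)" if "s \<in> {0..\<tau> N} - \<tau> ` {..N}" for s
    proof -
      from that cover obtain i where i: "s \<in> {\<tau> i<..<\<tau> (Suc i)}" by blast
      then have "(x has_vector_derivative field (\<theta>h (\<tau> i)) (x s)) (at s)"
        by (intro ode_solution_interior[OF hybrid_Ico_solution[OF hyb]]) simp
      then show ?thesis using hybrid_const[OF hyb, of s i] i by simp
    qed
    have "continuous_on {\<tau> i<..<\<tau> (Suc i)} ?D" for i
    proof -
      have "continuous_on {\<tau> i<..<\<tau> (Suc i)} (\<lambda>t. field (\<theta>h (\<tau> i)) (x t))"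
        by (rule continuous_on_compose2[OF ball_lipschitz_continuous_on[OF field_lipschitz[OF hybrid_estimate_in[OF hyb]]]
              continuous_on_subset[OF hybrid_cont_step[OF hyb, of i]] subset_UNIV]) auto
      then show ?thesis
      proof (rule continuous_on_eq)
        fix t assume "t \<in> {\<tau> i<..<\<tau> (Suc i)}"
        then have "\<theta>h t = \<theta>h (\<tau> i)" by (intro hybrid_const[OF hyb]) simp
        then show "field (\<theta>h (\<tau> i)) (x t) = ?D t" by simp
      qed
    qed
    then have "continuous_on (\<Union>i\<in>{..<N}. {\<tau> i<..<\<tau> (Suc i)}) ?D"
      by (intro continuous_on_open_UN) auto
    then show "continuous_on ({0..\<tau> N} - \<tau> ` {..N}) ?D" using cover by (rule continuous_on_subset)
  qed
  \<comment> \<open>The data give this only on half-open intervals, because the input jumps at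
    events; with the estimate frozen the expression is continuous and extends to the right
    end.\<close>
  have ker: "g (x s, k (\<theta> + d j, x s)) *v d (Suc i) = 0"
    if "j \<le> i" "s \<in> {\<tau> j..\<tau> (Suc j)}" for i j s
  proof (rule continuous_zero_on_Icc[OF _ _ hybrid_step[OF hyb] that(2)])
    have "continuous_on {\<tau> j..\<tau> (Suc j)} (\<lambda>s. g (x s, k (\<theta> + d j, x s)))"
      by (rule continuous_on_compose2[OF ball_lipschitz_continuous_on[OF feedback_lipschitz[OF smooth_g in\<Theta>]]
            hybrid_cont_step[OF hyb] subset_UNIV])
    then show "continuous_on {\<tau> j..\<tau> (Suc j)} (\<lambda>s. g (x s, k (\<theta> + d j, x s)) *v d (Suc i))"
      by (rule continuous_on_matrix_vector_mult_left)
    fix s assume s: "s \<in> {\<tau> j..<\<tau> (Suc j)}"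
    then have "s \<in> {0..<\<tau> (Suc i)}" using hybrid_nonneg[OF hyb, of j] hybrid_mono[OF hyb, of "Suc j" "Suc i"] that(1) by auto
    from hybrid_kernel[OF hyb this] show "g (x s, k (\<theta> + d j, x s)) *v d (Suc i) = 0"
      using hybrid_const[OF hyb s] by (simp add: d_def input_signal_def)
  qed
  have sol: "ode_solution (field (\<theta> + d i)) {\<tau> i..<\<tau> (Suc i)} x" for i
    using hybrid_Ico_solution[OF hyb, of i] by (simp add: d_def)
  have "\<forall>t\<in>{0..\<tau> N}. x t = 0"
    by (rule obs[unfolded parameter_observable_def, THEN spec[of _ \<tau>], THEN spec[of _ \<theta>],
            THEN spec[of _ d], THEN spec[of _ x], THEN mp])
       (intro conjI allI impI ballI hybrid_start[OF hyb] hybrid_step[OF hyb] \<theta> in\<Theta> d hybrid_cont_Icc[OF hyb] C1 sol ker; assumption)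
  then have "x 0 = 0" using hybrid_nonneg[OF hyb, of N] by simp
  then show False using x0 by simp
qed

section \<open>Stability and uniqueness\<close>

text \<open>By \<open>hybrid_error_le\<close> every estimate of every solution starting from
  \<open>\<eta>0\<close> lies here, and the set depends on \<open>\<theta>\<close> and
  \<open>\<eta>0\<close> only, as the KL function must.\<close>

definition parameter_ball :: "real^'l \<Rightarrow> (real^'l) set" where
  "parameter_ball \<eta>0 = \<Theta> \<inter> cball \<theta> (dist \<eta>0 \<theta>)"

lemma parameter_ball:
  shows compact_parameter_ball: "compact (parameter_ball \<eta>0)"
    and parameter_ball_subset: "parameter_ball \<eta>0 \<subseteq> \<Theta>"
    and parameter_ball_nonempty: "parameter_ball \<eta>0 \<noteq> {}"
proof -
  show "compact (parameter_ball \<eta>0)" "parameter_ball \<eta>0 \<subseteq> \<Theta>"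
    using closed_\<Theta> by (auto simp: parameter_ball_def intro: closed_Int_compact)
  have "\<theta> \<in> parameter_ball \<eta>0" using \<theta> by (simp add: parameter_ball_def)
  then show "parameter_ball \<eta>0 \<noteq> {}" by blast
qed

text \<open>Finiteness of the gain is the uniform boundedness of sublevel sets. Its vanishing at 0
  follows from a positive minimum of \<open>V\<close>, jointly in both arguments, on a compact
  shell.\<close>

lemma state_gain:
  obtains \<alpha> where "class_K \<alpha>" "\<And>s. 0 \<le> s \<Longrightarrow> s \<le> \<alpha> s"
    "\<And>\<eta> y. \<eta> \<in> parameter_ball \<eta>0 \<Longrightarrow> norm y \<le> \<alpha> (V (\<eta>, y))"
proof -
  let ?B = "parameter_ball \<eta>0"
  have V_bd: "\<exists>R>0. \<forall>\<eta>\<in>?B. \<forall>y. V (\<eta>, y) \<le> M \<longrightarrow> norm y \<le> R" if "0 \<le> M" for M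
    using V_bounded[rule_format, of ?B M] parameter_ball[of \<eta>0] that by blast
  have V0: "0 \<le> V (\<eta>, y)" if "\<eta> \<in> ?B" for \<eta> y using that V_nonneg parameter_ball_subset by blast
  have bdd: "\<exists>R. \<forall>p\<in>?B \<times> UNIV. V p \<le> M \<longrightarrow> norm (snd p) \<le> R" for M
  proof -
    obtain R where "\<forall>\<eta>\<in>?B. \<forall>y. V (\<eta>, y) \<le> max M 0 \<longrightarrow> norm y \<le> R"
      using V_bd[of "max M 0"] by auto
    then show ?thesis by (intro exI[of _ R]) auto
  qed
  have small: "\<exists>\<delta>>0. \<forall>p\<in>?B \<times> UNIV. V p \<le> \<delta> \<longrightarrow> norm (snd p) \<le> \<epsilon>" if \<epsilon>: "0 < \<epsilon>" for \<epsilon>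
  proof -
    obtain R where R: "\<And>\<eta> y. \<eta> \<in> ?B \<Longrightarrow> V (\<eta>, y) \<le> 1 \<Longrightarrow> norm y \<le> R"
      using V_bd[of 1] by auto
    \<comment> \<open>Removing the open ball keeps the shell compact and away from the origin, where
      \<open>V\<close> vanishes.\<close>
    define K where "K = ?B \<times> (cball (0 :: real^'n) R - ball 0 \<epsilon>)"
    have cK: "compact K" unfolding K_def
      by (intro compact_Times compact_parameter_ball compact_diff) auto
    have sub: "K \<subseteq> \<Theta> \<times> UNIV" using parameter_ball_subset by (auto simp: K_def)
    have pos: "0 < V p" if "p \<in> K" for p
      using that \<epsilon> parameter_ball_subset by (cases p) (auto simp: K_def intro!: V_pos)
    have "\<exists>\<mu>>0. \<forall>p\<in>K. \<mu> \<le> V p"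
    proof (cases "K = {}")
      case False
      then obtain q where "q \<in> K" "\<forall>p\<in>K. V q \<le> V p"
        using continuous_attains_inf[OF cK False continuous_on_subset[OF cont_V sub]] by blast
      then show ?thesis using pos by blast
    qed (auto intro: exI[of _ 1])
    then obtain \<mu> where \<mu>: "0 < \<mu>" "\<And>p. p \<in> K \<Longrightarrow> \<mu> \<le> V p" by blast
    \<comment> \<open>The bound 1 makes the radius \<open>R\<close> applicable, and
      \<open>\<mu> / 2\<close> lies strictly below the minimum over the shell.\<close>
    show ?thesis
    proof (intro exI[of _ "min 1 (\<mu> / 2)"] conjI ballI impI)
      fix p assume p: "p \<in> ?B \<times> (UNIV :: (real^'n) set)" and le: "V p \<le> min 1 (\<mu> / 2)"
      obtain \<eta> y where [simp]: "p = (\<eta>, y)" by (cases p)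
      show "norm (snd p) \<le> \<epsilon>"
      proof (rule ccontr)
        assume "\<not> norm (snd p) \<le> \<epsilon>"
        moreover have "norm y \<le> R" using R[of \<eta> y] p le by simp
        ultimately have "p \<in> K" using p by (simp add: K_def)
        then show False using \<mu>(2)[of p] \<mu>(1) le by simp
      qed
    qed (use \<mu>(1) in simp)
  qed
  obtain \<alpha> where \<alpha>: "class_K \<alpha>" "\<And>s. 0 \<le> s \<Longrightarrow> s \<le> \<alpha> s"
    "\<And>p. p \<in> ?B \<times> UNIV \<Longrightarrow> norm (snd p) \<le> \<alpha> (V p)"
    using class_K_dominates[of "?B \<times> UNIV" V "\<lambda>p. norm (snd p)"] bdd small V0 by blast
  have "norm y \<le> \<alpha> (V (\<eta>, y))" if "\<eta> \<in> ?B" for \<eta> y using \<alpha>(3)[of "(\<eta>, y)"] that by simp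
  with \<alpha> that show thesis by blast
qed

text \<open>\<open>a\<close> is included because between events \<open>V\<close> may rise to the
  trigger level \<open>V + a\<close>, and this level must be controlled by the state at the start of
  the interval.\<close>

lemma lyapunov_gain:
  obtains \<alpha> where "class_K \<alpha>" "\<And>s. 0 \<le> s \<Longrightarrow> s \<le> \<alpha> s"
    "\<And>\<eta> y. \<eta> \<in> parameter_ball \<eta>0 \<Longrightarrow> V (\<eta>, y) + a y \<le> \<alpha> (norm y)"
proof -
  let ?B = "parameter_ball \<eta>0"
  let ?W = "\<lambda>p. V p + a (snd p)"
  have cK: "compact (?B \<times> cball (0 :: real^'n) M)" for M
    by (intro compact_Times compact_parameter_ball compact_cball)
  have cW: "continuous_on (?B \<times> cball (0 :: real^'n) M) ?W" for M
    using parameter_ball_subset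
    by (intro continuous_on_add continuous_on_subset[OF cont_V]
        continuous_on_compose2[OF cont_a continuous_on_snd[OF continuous_on_id]]) auto
  have bdd: "\<exists>R. \<forall>p\<in>?B \<times> UNIV. norm (snd p) \<le> M \<longrightarrow> ?W p \<le> R" for M
  proof -
    have "bounded (?W ` (?B \<times> cball 0 M))"
      by (intro compact_imp_bounded compact_continuous_image cK cW)
    then obtain R where R: "\<forall>w\<in>?W ` (?B \<times> cball 0 M). norm w \<le> R"
      unfolding bounded_iff by blast
    have "?W p \<le> R" if "p \<in> ?B \<times> UNIV" "norm (snd p) \<le> M" for p
    proof -
      have "p \<in> ?B \<times> cball 0 M" using that by (cases p) simp
      then have "norm (?W p) \<le> R" using R by blast
      then show ?thesis by simp
    qed
    then show ?thesis by blast
  qed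
  have small: "\<exists>\<delta>>0. \<forall>p\<in>?B \<times> UNIV. norm (snd p) \<le> \<delta> \<longrightarrow> ?W p \<le> \<epsilon>" if \<epsilon>: "0 < \<epsilon>" for \<epsilon>
  proof -
    obtain d where d: "0 < d" "\<And>p q. p \<in> ?B \<times> cball 0 1 \<Longrightarrow> q \<in> ?B \<times> cball 0 1 \<Longrightarrow> dist q p < d \<Longrightarrow>
        dist (?W q) (?W p) < \<epsilon>"
      using compact_uniformly_continuous[OF cW cK, of 1] \<epsilon> unfolding uniformly_continuous_on_def by metis
    show ?thesis
    proof (intro exI[of _ "min 1 (d / 2)"] conjI ballI impI)
      fix p assume p: "p \<in> ?B \<times> (UNIV :: (real^'n) set)" and le: "norm (snd p) \<le> min 1 (d / 2)"
      obtain \<eta> y where [simp]: "p = (\<eta>, y)" by (cases p)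
      \<comment> \<open>Uniform continuity is applied along the fibre of fixed
        \<open>\<eta>\<close>; as \<open>?W\<close> vanishes at the origin of every fibre,
        \<open>\<delta>\<close> is independent of \<open>\<eta>\<close>.\<close>
      have "dist (?W p) (?W (\<eta>, 0)) < \<epsilon>"
        using p le d(1) by (intro d(2)) (auto simp: dist_Pair_Pair)
      moreover have "?W (\<eta>, 0) = 0"
        using p parameter_ball_subset a_zero by (auto intro!: V_zero)
      ultimately show "?W p \<le> \<epsilon>" by (simp add: dist_real_def)
    qed (use d(1) in simp)
  qed
  obtain \<alpha> where \<alpha>: "class_K \<alpha>" "\<And>s. 0 \<le> s \<Longrightarrow> s \<le> \<alpha> s"
    "\<And>p. p \<in> ?B \<times> UNIV \<Longrightarrow> ?W p \<le> \<alpha> (norm (snd p))"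
    using class_K_dominates[of "?B \<times> UNIV" "\<lambda>p. norm (snd p)" ?W] bdd small by auto
  have "V (\<eta>, y) + a y \<le> \<alpha> (norm y)" if "\<eta> \<in> ?B" for \<eta> y using \<alpha>(3)[of "(\<eta>, y)"] that by simp
  with \<alpha> that show thesis by blast
qed

theorem hybrid_KL_bound:
  assumes \<eta>0: "\<eta>0 \<in> \<Theta>"
  shows "\<exists>\<omega>. class_KL \<omega> \<and> (\<forall>x \<theta>h \<tau>. hybrid x \<theta>h \<tau> \<and> \<theta>h 0 = \<eta>0 \<longrightarrow>
      (\<forall>t\<ge>0. norm (x t) \<le> \<omega> (norm (x 0)) t))"
proof -
  obtain \<alpha>1 where \<alpha>1: "class_K \<alpha>1" "\<And>s. 0 \<le> s \<Longrightarrow> s \<le> \<alpha>1 s"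
    "\<And>\<eta> y. \<eta> \<in> parameter_ball \<eta>0 \<Longrightarrow> norm y \<le> \<alpha>1 (V (\<eta>, y))"
    using state_gain by metis
  obtain \<alpha>2 where \<alpha>2: "class_K \<alpha>2" "\<And>s. 0 \<le> s \<Longrightarrow> s \<le> \<alpha>2 s"
    "\<And>\<eta> y. \<eta> \<in> parameter_ball \<eta>0 \<Longrightarrow> V (\<eta>, y) + a y \<le> \<alpha>2 (norm y)"
    using lyapunov_gain by metis
  \<comment> \<open>One factor \<open>\<alpha>2 (\<alpha>1 s)\<close> bounds \<open>V\<close> over
    an interval by the trigger level, the other re-expresses the resulting state in terms of
    \<open>V\<close> for the new estimate.\<close>
  define A where "A s = \<alpha>2 (\<alpha>1 (\<alpha>2 (\<alpha>1 s)))" for s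
  have K21: "class_K (\<lambda>s. \<alpha>2 (\<alpha>1 s))" by (rule class_K_compose[OF \<alpha>2(1) \<alpha>1(1)])
  have A: "class_K A" unfolding A_def[abs_def] by (rule class_K_compose[OF K21 K21])
  have n1: "0 \<le> \<alpha>1 s" and n2: "0 \<le> \<alpha>2 s" if "0 \<le> s" for s
    using class_K_nonneg \<alpha>1(1) \<alpha>2(1) that by blast+
  have ge21: "s \<le> \<alpha>2 (\<alpha>1 s)" if "0 \<le> s" for s
    using \<alpha>1(2)[OF that] \<alpha>2(2)[OF n1[OF that]] by linarith
  have A21: "\<alpha>2 (\<alpha>1 s) \<le> A s" if "0 \<le> s" for s
    unfolding A_def by (rule ge21) (use that n1 n2 in blast)
  have Age: "\<forall>s\<ge>0. s \<le> A s" using ge21 A21 order_trans by blast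
  \<comment> \<open>The dimension allows \<open>CARD('l)\<close> changes, and these separate one
    more stretch than there are changes.\<close>
  define L where "L = Suc (CARD('l))"
  define \<omega> where "\<omega> s t =
      \<alpha>1 ((A ^^ L) (exp (2 * \<sigma> * T) * exp (- (2 * \<sigma> / real L) * t) * (A ^^ L) (\<alpha>2 s)))" for s t
  have "class_KL \<omega>"
    unfolding \<omega>_def[abs_def]
  proof (rule class_KL_exp)
    show "class_K (\<lambda>s. \<alpha>1 ((A ^^ L) s))" by (rule class_K_compose[OF \<alpha>1(1) class_K_funpow[OF A]])
    show "class_K (\<lambda>s. (A ^^ L) (\<alpha>2 s))" by (rule class_K_compose[OF class_K_funpow[OF A] \<alpha>2(1)])
  qed (use \<sigma> in \<open>simp_all add: L_def\<close>)
  moreover have "norm (x t) \<le> \<omega> (norm (x 0)) t"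
    if hyb: "hybrid x \<theta>h \<tau>" and init: "\<theta>h 0 = \<eta>0" and t: "0 \<le> t" for x \<theta>h \<tau> t
  proof -
    note H = hybrid_start[OF hyb] hybrid_step[OF hyb] hybrid_step_le[OF hyb]
    let ?\<eta> = "\<lambda>i. \<theta>h (\<tau> i)"
    have ball: "?\<eta> i \<in> parameter_ball \<eta>0" for i
      using hybrid_estimate_in[OF hyb, of i] hybrid_error_le[OF hyb, of i] init
      by (simp add: parameter_ball_def dist_commute)
    have Vn: "0 \<le> V (?\<eta> i, y)" for i y by (rule V_nonneg[OF hybrid_estimate_in[OF hyb]])
    define v0 where "v0 = V (?\<eta> 0, x (\<tau> 0))"
    have v0: "0 \<le> v0" by (simp add: v0_def Vn)
    have sig: "0 < 2 * \<sigma>" using \<sigma> by simp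
    note JD = sig T A Age v0
    define J where "J i = card {j. j < i \<and> ?\<eta> (Suc j) \<noteq> ?\<eta> j}" for i
    have J_same: "J (Suc i) = J i" if "?\<eta> (Suc i) = ?\<eta> i" for i
      unfolding J_def using that by (intro arg_cong[of _ _ card]) (auto simp: less_Suc_eq)
    have J_change: "J (Suc i) = Suc (J i)" if "?\<eta> (Suc i) \<noteq> ?\<eta> i" for i
    proof -
      have "{j. j < Suc i \<and> ?\<eta> (Suc j) \<noteq> ?\<eta> j} = insert i {j. j < i \<and> ?\<eta> (Suc j) \<noteq> ?\<eta> j}"
        using that by (auto simp: less_Suc_eq)
      then show ?thesis by (simp add: J_def)
    qed
    have change: "\<alpha>2 (norm (x (\<tau> i))) \<le> \<alpha>2 (\<alpha>1 (V (?\<eta> i, x (\<tau> i))))" for i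
      by (intro class_K_mono[OF \<alpha>2(1)] \<alpha>1(3) ball) simp
    have flow: "V (?\<eta> i, x t) \<le> \<alpha>2 (\<alpha>1 (V (?\<eta> i, x (\<tau> i))))" if "t \<in> {\<tau> i..\<tau> (Suc i)}" for i t
      using hybrid_V_le[OF hyb that] \<alpha>2(3)[OF ball[of i], of "x (\<tau> i)"] change[of i]
      by linarith
    \<comment> \<open>The index counts changes, not events: consecutive unchanged intervals, however
      many, form a single stretch.\<close>
    have inv: "jump_decay (2 * \<sigma>) T A v0 (J i) (\<tau> i) (V (?\<eta> i, x (\<tau> i)))" for i
    proof (induction i)
      case 0
      then show ?case using jump_decay_start[OF JD] by (simp add: J_def v0_def H(1))
    next
      case (Suc i)
      show ?case
      proof (cases "?\<eta> (Suc i) = ?\<eta> i")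
        case True
        have "V (?\<eta> i, x (\<tau> (Suc i))) \<le>
            exp (- (2 * \<sigma>) * (\<tau> (Suc i) - \<tau> i)) * V (?\<eta> i, x (\<tau> i))"
          using hybrid_unchanged_decay[OF hyb True, of "\<tau> (Suc i)"] H(2)[of i] by simp
        then have "jump_decay (2 * \<sigma>) T A v0 (J i) (\<tau> (Suc i)) (V (?\<eta> i, x (\<tau> (Suc i))))"
          by (rule jump_decay_flow[OF JD Suc less_imp_le[OF H(2)] _ Vn])
        then show ?thesis by (simp add: True J_same)
      next
        case False
        let ?x = "x (\<tau> (Suc i))"
        have "V (?\<eta> (Suc i), ?x) \<le> \<alpha>2 (norm ?x)"
          using \<alpha>2(3)[OF ball[of "Suc i"], of ?x] a_nonneg[of ?x] by linarith
        also have "\<dots> \<le> \<alpha>2 (\<alpha>1 (V (?\<eta> i, ?x)))"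
          by (intro class_K_mono[OF \<alpha>2(1)] \<alpha>1(3) ball) simp
        also have "\<dots> \<le> A (V (?\<eta> i, x (\<tau> i)))"
          unfolding A_def using flow[of "\<tau> (Suc i)" i] H(2)[of i]
          by (intro class_K_mono[OF \<alpha>2(1)] class_K_mono[OF \<alpha>1(1)] n1 Vn) simp
        finally have "jump_decay (2 * \<sigma>) T A v0 (Suc (J i)) (\<tau> (Suc i)) (V (?\<eta> (Suc i), ?x))"
          by (rule jump_decay_jump[OF JD Suc H(3) _ Vn])
        then show ?thesis by (simp add: False J_change)
      qed
    qed
    obtain i where i: "t \<in> {\<tau> i..<\<tau> (Suc i)}" using hybrid_time_index[OF hyb t] by blast
    then have i': "t \<in> {\<tau> i..\<tau> (Suc i)}" by simp
    \<comment> \<open>Whether the running interval decays is decided by the update at its end, hence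
      \<open>J (Suc i)\<close>; if the estimate is about to change, the running interval counts as a
      jump already.\<close>
    have "jump_decay (2 * \<sigma>) T A v0 (J (Suc i)) t (V (?\<eta> i, x t))"
    proof (cases "?\<eta> (Suc i) = ?\<eta> i")
      case True
      have "jump_decay (2 * \<sigma>) T A v0 (J i) t (V (?\<eta> i, x t))"
        using i by (intro jump_decay_flow[OF JD inv _ hybrid_unchanged_decay[OF hyb True i'] Vn]) simp
      then show ?thesis by (simp add: True J_same)
    next
      case False
      have "V (?\<eta> i, x t) \<le> A (V (?\<eta> i, x (\<tau> i)))"
        using flow[OF i'] A21[OF Vn] by (rule order_trans)
      then have "jump_decay (2 * \<sigma>) T A v0 (Suc (J i)) t (V (?\<eta> i, x t))"
        using i H(3)[of i] by (intro jump_decay_jump[OF JD inv _ _ Vn]) auto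
      then show ?thesis by (simp add: False J_change)
    qed
    moreover have "J (Suc i) < L"
      using hybrid_changes_dim[OF hyb, of "Suc i"] by (simp add: J_def L_def)
    ultimately have "V (?\<eta> i, x t) \<le>
        (A ^^ L) (exp (2 * \<sigma> * T) * exp (- (2 * \<sigma> / real L) * t) * (A ^^ L) v0)"
      by (rule jump_decay_bound[OF JD _ _ Vn])
    also have "\<dots> \<le> (A ^^ L) (exp (2 * \<sigma> * T) * exp (- (2 * \<sigma> / real L) * t) * (A ^^ L) (\<alpha>2 (norm (x 0))))"
    proof (intro class_K_mono[OF class_K_funpow[OF A]] mult_left_mono mult_nonneg_nonneg
        class_K_nonneg[OF class_K_funpow[OF A]] v0)
      show "v0 \<le> \<alpha>2 (norm (x 0))"
        using \<alpha>2(3)[OF ball[of 0], of "x 0"] a_nonneg[of "x 0"] by (simp add: v0_def H(1))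
    qed auto
    finally have "\<alpha>1 (V (?\<eta> i, x t)) \<le> \<omega> (norm (x 0)) t"
      unfolding \<omega>_def by (rule class_K_mono[OF \<alpha>1(1) Vn])
    moreover have "norm (x t) \<le> \<alpha>1 (V (?\<eta> i, x t))" by (rule \<alpha>1(3)[OF ball])
    ultimately show ?thesis by (rule order_trans[rotated])
  qed
  ultimately show ?thesis by blast
qed

text \<open>Induction over events: the next event time is a function of the current state and
  estimate, the flow up to it is unique, and the update is a projection determined by the strict
  past.\<close>

lemma hybrid_solution_unique:
  assumes hyb: "hybrid x \<theta>h \<tau>"
    and hyb': "hybrid x' \<theta>h' \<tau>'"
    and init: "x' 0 = x 0" "\<theta>h' 0 = \<theta>h 0"
  shows "\<tau>' = \<tau> \<and> (\<forall>t\<ge>0. x' t = x t \<and> \<theta>h' t = \<theta>h t)"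
proof -
  have P: "\<tau>' i = \<tau> i \<and> (\<forall>t\<in>{0..\<tau> i}. x' t = x t \<and> \<theta>h' t = \<theta>h t)" for i
  proof (induction i)
    case 0
    then show ?case using init hybrid_start[OF hyb] hybrid_start[OF hyb'] by simp
  next
    case (Suc i)
    let ?\<eta> = "\<theta>h (\<tau> i)"
    have \<tau>i: "\<tau>' i = \<tau> i" using Suc by simp
    have xi: "x' (\<tau> i) = x (\<tau> i)" "\<theta>h' (\<tau> i) = ?\<eta>" using Suc hybrid_nonneg[OF hyb, of i] by auto
    have "ereal (\<tau>' (Suc i)) = ereal (\<tau> (Suc i))"
      using hybrid_event[OF hyb', of i] unfolding \<tau>i xi by (rule trans) (rule hybrid_event[OF hyb, symmetric])
    then have \<tau>S: "\<tau>' (Suc i) = \<tau> (Suc i)" by simp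
    have sol': "ode_solution (field ?\<eta>) {\<tau> i..<\<tau> (Suc i)} x'"
      using hybrid_Ico_solution[OF hyb', of i] by (simp add: \<tau>i xi \<tau>S)
    have Ico: "x' t = x t" if "t \<in> {\<tau> i..<\<tau> (Suc i)}" for t
      by (rule field_solution_unique[OF hybrid_estimate_in[OF hyb] sol' hybrid_Ico_solution[OF hyb] xi(1) that])
    have Icc: "x' t - x t = 0" if "t \<in> {\<tau> i..\<tau> (Suc i)}" for t
    proof (rule continuous_zero_on_Icc[OF _ _ hybrid_step[OF hyb] that])
      show "continuous_on {\<tau> i..\<tau> (Suc i)} (\<lambda>t. x' t - x t)"
        using hybrid_cont_step[OF hyb', of i] hybrid_cont_step[OF hyb, of i]
        by (intro continuous_on_diff) (simp_all add: \<tau>i \<tau>S)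
    qed (simp add: Ico)
    have x_eq: "x' t = x t" if "t \<in> {0..\<tau> (Suc i)}" for t
      using Suc Icc[of t] that by (cases "t \<le> \<tau> i") auto
    have \<theta>_eq: "\<theta>h' t = \<theta>h t" if "t \<in> {0..<\<tau> (Suc i)}" for t
    proof (cases "t \<le> \<tau> i")
      case False
      then have "t \<in> {\<tau> i..<\<tau> (Suc i)}" using that by simp
      then show ?thesis
        using hybrid_const[OF hyb, of t i] hybrid_const[OF hyb', of t i] by (simp add: \<tau>i \<tau>S xi)
    qed (use Suc that in simp)
    \<comment> \<open>Equality of the estimates is known only before \<open>\<tau> (Suc i)\<close>
      at this point, which is all that the half-open interval asks for.\<close>
    have "unidentified x' \<theta>h' (\<tau> (Suc i)) = unidentified x \<theta>h (\<tau> (Suc i))"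
      unfolding unidentified_def input_signal_def using x_eq \<theta>_eq by auto
    then have "\<theta>h' (\<tau> (Suc i)) = \<theta>h (\<tau> (Suc i))"
      using hybrid_update[OF hyb', of i] hybrid_update[OF hyb, of i] by (simp add: \<tau>i \<tau>S xi)
    then have "\<theta>h' t = \<theta>h t" if "t \<in> {0..\<tau> (Suc i)}" for t
      using \<theta>_eq[of t] that by (cases "t = \<tau> (Suc i)") auto
    then show ?case using \<tau>S x_eq by simp
  qed
  have "x' t = x t \<and> \<theta>h' t = \<theta>h t" if t: "0 \<le> t" for t
  proof -
    obtain n where "t < \<tau> n" using hybrid_time_unbounded[OF hyb] by blast
    then show ?thesis using P[of n] t by simp
  qed
  then show ?thesis using P by blast
qed

section \<open>Existence\<close>

text \<open>The normal equation refers to the whole past, which would make the recursion carry a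
  growing trajectory. Carrying the subspace \<open>N\<close> of unidentified directions instead lets
  each update be computed from the last interval alone; that \<open>N\<close> is the true
  unidentified subspace is checked afterwards in \<open>N_eq\<close>.\<close>

theorem hybrid_solution_exists:
  assumes \<eta>0: "\<eta>0 \<in> \<Theta>"
  shows "\<exists>x \<theta>h \<tau>. hybrid x \<theta>h \<tau> \<and> x 0 = x0 \<and> \<theta>h 0 = \<eta>0"
proof -
  define good where "good t0 z \<eta> r y \<longleftrightarrow> t0 < r \<and> ereal r = event_time t0 z \<eta> \<and> y t0 = z \<and>
      ode_solution (field \<eta>) {t0..r} y" for t0 z \<eta> r y
  define R where "R t0 z \<eta> = (SOME r. \<exists>y. good t0 z \<eta> r y)" for t0 z \<eta>
  define Y where "Y t0 z \<eta> = (SOME y. good t0 z \<eta> (R t0 z \<eta>) y)" for t0 z \<eta>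
  have RY: "good t0 z \<eta> (R t0 z \<eta>) (Y t0 z \<eta>)" if \<eta>: "\<eta> \<in> \<Theta>" for t0 z \<eta>
  proof -
    have "\<exists>r y. good t0 z \<eta> r y"
      using inter_event_solution_exists[OF \<eta>, of t0 z] unfolding good_def by metis
    then have "\<exists>y. good t0 z \<eta> (R t0 z \<eta>) y" unfolding R_def by (rule someI_ex)
    then show ?thesis unfolding Y_def by (rule someI_ex)
  qed
  define N' where "N' t z \<eta> N = N \<inter> {w. \<forall>s\<in>{t..<R t z \<eta>}. g (Y t z \<eta> s, k (\<eta>, Y t z \<eta> s)) *v w = 0}"
    for t z \<eta> N
  define step where "step = (\<lambda>(t, z, \<eta>, N).
      (R t z \<eta>, Y t z \<eta> (R t z \<eta>), closest_point (consistent (N' t z \<eta> N)) \<eta>, N' t z \<eta> N))"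
  define S where "S i = (step ^^ i) (0, x0, \<eta>0, UNIV)" for i
  define \<tau> where "\<tau> i = fst (S i)" for i
  define X where "X i = fst (snd (S i))" for i
  define E where "E i = fst (snd (snd (S i)))" for i
  define N where "N i = snd (snd (snd (S i)))" for i
  define y where "y i = Y (\<tau> i) (X i) (E i)" for i
  have S: "S i = (\<tau> i, X i, E i, N i)" for i
    by (simp add: \<tau>_def X_def E_def N_def)
  have init: "\<tau> 0 = 0" "X 0 = x0" "E 0 = \<eta>0" "N 0 = UNIV"
    by (simp_all add: \<tau>_def X_def E_def N_def S_def)
  have "S (Suc i) = step (\<tau> i, X i, E i, N i)" for i
    using S[of i] by (simp add: S_def)
  then have recur: "\<tau> (Suc i) = R (\<tau> i) (X i) (E i)" "X (Suc i) = y i (\<tau> (Suc i))"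
      "E (Suc i) = closest_point (consistent (N (Suc i))) (E i)"
      "N (Suc i) = N' (\<tau> i) (X i) (E i) (N i)" for i
    by (simp_all add: S step_def y_def)
  have sub: "subspace (N' t z \<eta> N)" if "subspace N" for t z \<eta> N
    using that unfolding N'_def
    by (intro subspace_inter)
       (auto simp: subspace_def matrix_vector_right_distrib matrix_vector_mult_scaleR)
  have N_sub: "subspace (N i)" for i
    by (induction i) (simp_all add: init recur(4) sub)
  have E_in: "E i \<in> \<Theta>" for i
  proof (cases i)
    case (Suc j)
    have "E i \<in> consistent (N i)"
      unfolding Suc recur(3)
      using closest_point_in_set[OF closed_consistent[OF N_sub]] true_parameter_consistent[OF N_sub]
      by blast
    then show ?thesis by (simp add: consistent_def)
  qed (simp add: init \<eta>0)
  have G: "good (\<tau> i) (X i) (E i) (\<tau> (Suc i)) (y i)" for i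
    unfolding y_def recur(1) by (rule RY[OF E_in])
  have less: "\<tau> i < \<tau> (Suc i)" for i using G unfolding good_def by blast
  have smono: "strict_mono \<tau>" using less by (simp add: strict_mono_Suc_iff)
  have nonneg: "0 \<le> \<tau> i" for i
    using strict_mono_less_eq[OF smono, of 0 i] init(1) by simp
  \<comment> \<open>Accumulation of the events is not yet excluded here. Beyond all of them the
    index is an arbitrary number, and the values there lie outside
    \<open>time_domain \<tau>\<close>.\<close>
  define idx where "idx t = (LEAST i. t < \<tau> (Suc i))" for t
  have idx: "idx t = i" if t: "t \<in> {\<tau> i..<\<tau> (Suc i)}" for t i
    unfolding idx_def
  proof (rule Least_equality)
    show "t < \<tau> (Suc i)" using t by simp
    fix j assume "t < \<tau> (Suc j)"
    then have "\<tau> i < \<tau> (Suc j)" using t by simp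
    then show "i \<le> j" using strict_mono_less[OF smono] by simp
  qed
  define x where "x t = y (idx t) t" for t
  define \<theta>h where "\<theta>h t = E (idx t)" for t
  have \<theta>h: "\<theta>h t = E i" if "t \<in> {\<tau> i..<\<tau> (Suc i)}" for t i
    using idx[OF that] by (simp add: \<theta>h_def)
  have \<theta>h\<tau>: "\<theta>h (\<tau> i) = E i" for i using \<theta>h[of "\<tau> i" i] less by simp
  have y\<tau>: "y i (\<tau> i) = X i" for i using G unfolding good_def by blast
  have x\<tau>: "x (\<tau> i) = X i" for i using idx[of "\<tau> i" i] less by (simp add: x_def y\<tau>)
  have x: "x t = y i t" if t: "t \<in> {\<tau> i..\<tau> (Suc i)}" for t i
  proof (cases "t = \<tau> (Suc i)")
    case True
    then show ?thesis by (simp add: x\<tau> recur(2))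
  next
    case False
    then show ?thesis using idx[of t i] t by (simp add: x_def)
  qed
  have sol: "ode_solution (field (E i)) {\<tau> i..\<tau> (Suc i)} x" for i
  proof (rule ode_solution_cong)
    show "ode_solution (field (E i)) {\<tau> i..\<tau> (Suc i)} (y i)" using G unfolding good_def by blast
  qed (simp add: x)
  have sol': "ode_solution (field (E i)) {\<tau> i..<\<tau> (Suc i)} x" for i
    by (rule ode_solution_subset[OF sol]) auto
  have cont: "continuous_on {0..\<tau> n} x" for n
  proof (induction n)
    case 0
    then show ?case by (simp add: init(1))
  next
    case (Suc n)
    have "{0..\<tau> (Suc n)} = {0..\<tau> n} \<union> {\<tau> n..\<tau> (Suc n)}"
      using nonneg[of n] less[of n] by auto
    then show ?case
      using continuous_on_closed_Un[OF closed_atLeastAtMost closed_atLeastAtMost Suc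
          ode_solution_continuous_on[OF sol]] by simp
  qed
  have dom: "time_domain \<tau> \<subseteq> {0..}"
  proof -
    have "{\<tau> i..<\<tau> (Suc i)} \<subseteq> {0..}" for i using nonneg[of i] by auto
    then show ?thesis unfolding time_domain_def by blast
  qed
  have cont_dom: "continuous_on (time_domain \<tau>) x"
    unfolding continuous_on_eq_continuous_within
  proof
    fix t assume "t \<in> time_domain \<tau>"
    then obtain i where i: "t \<in> {\<tau> i..<\<tau> (Suc i)}" unfolding time_domain_def by blast
    have "t \<in> {0..\<tau> (Suc i)}" using i nonneg[of i] by simp
    then have "continuous (at t within {0..\<tau> (Suc i)}) x"
      using cont continuous_on_eq_continuous_within by blast
    then have "continuous (at t within time_domain \<tau> \<inter> {..<\<tau> (Suc i)}) x"
      by (rule continuous_within_subset) (use dom in auto)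
    \<comment> \<open>Continuity is local and \<open>t\<close> precedes
      \<open>\<tau> (Suc i)\<close> strictly, so the continuity already known up to that event
      suffices.\<close>
    moreover have "at t within time_domain \<tau> \<inter> {..<\<tau> (Suc i)} = at t within time_domain \<tau>"
      using i by (intro at_within_nhd[of t "{..<\<tau> (Suc i)}"]) auto
    ultimately show "continuous (at t within time_domain \<tau>) x" by simp
  qed
  have N_eq: "N i = unidentified x \<theta>h (\<tau> i)" for i
  proof (induction i)
    case 0
    then show ?case by (simp add: init unidentified_0)
  next
    case (Suc i)
    have "{0..<\<tau> (Suc i)} = {0..<\<tau> i} \<union> {\<tau> i..<\<tau> (Suc i)}"
      using nonneg[of i] less[of i] by auto
    then have "unidentified x \<theta>h (\<tau> (Suc i)) = unidentified x \<theta>h (\<tau> i) \<inter>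
        {w. \<forall>t\<in>{\<tau> i..<\<tau> (Suc i)}. g (x t, input_signal k x \<theta>h t) *v w = 0}"
      unfolding unidentified_def by auto
    also have "\<dots> = N i \<inter> {w. \<forall>t\<in>{\<tau> i..<\<tau> (Suc i)}. g (y i t, k (E i, y i t)) *v w = 0}"
      using \<theta>h[of _ i] x[of _ i] by (simp add: Suc input_signal_def)
    also have "\<dots> = N (Suc i)" by (simp add: recur(4) N'_def y_def recur(1))
    finally show ?case by simp
  qed
  have "hybrid x \<theta>h \<tau>"
    unfolding hybrid_solution_def
  proof (intro conjI allI ballI)
    show "\<theta>h t \<in> \<Theta>" if "t \<in> time_domain \<tau>" for t using E_in by (simp add: \<theta>h_def)
    fix i
    show "\<theta>h t = \<theta>h (\<tau> i)" if "t \<in> {\<tau> i..<\<tau> (Suc i)}" for t using \<theta>h[OF that] \<theta>h\<tau> by simp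
    show "ode_solution (field (\<theta>h (\<tau> i))) {\<tau> i..<\<tau> (Suc i)} x" using sol' by (simp add: \<theta>h\<tau>)
    show "ereal (\<tau> (Suc i)) = event_time (\<tau> i) (x (\<tau> i)) (\<theta>h (\<tau> i))"
      using G[of i] by (simp add: good_def x\<tau> \<theta>h\<tau>)
    have "\<theta>h (\<tau> (Suc i)) = closest_point (consistent (unidentified x \<theta>h (\<tau> (Suc i)))) (\<theta>h (\<tau> i))"
      by (simp only: \<theta>h\<tau> recur(3) N_eq)
    then show "unique_minimizer (\<lambda>\<eta>. (norm (\<eta> - \<theta>h (\<tau> i)))\<^sup>2)
        (\<lambda>\<eta>. \<eta> \<in> \<Theta> \<and> normal_equation f g x (input_signal k x \<theta>h) (\<tau> (Suc i)) \<eta>) (\<theta>h (\<tau> (Suc i)))"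
      by (subst update_iff_closest_point[OF init(1) zero_less_Suc less])
         (auto simp: \<theta>h\<tau> \<theta>h E_in cont sol')
  qed (use init smono cont_dom in auto)
  moreover have "x 0 = x0" "\<theta>h 0 = \<eta>0" using x\<tau>[of 0] \<theta>h\<tau>[of 0] init by simp_all
  ultimately show ?thesis by blast
qed

end

theorem theorem4p1:
  fixes \<Theta> :: "(real^'l) set"
    and f :: "(real^'n) \<times> (real^'m) \<Rightarrow> real^'n"
    and g :: "(real^'n) \<times> (real^'m) \<Rightarrow> real^'l^'n"
    and k :: "(real^'l) \<times> (real^'n) \<Rightarrow> real^'m"
    and V :: "(real^'l) \<times> (real^'n) \<Rightarrow> real"
    and a :: "real^'n \<Rightarrow> real"
    and \<sigma> T :: real
  assumes "closed \<Theta>" and "convex \<Theta>"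
    and "smooth_on UNIV f" and "smooth_on UNIV g"
    and "f (0, 0) = 0" and "g (0, 0) = 0"
    and "smooth_on (\<Theta> \<times> UNIV) k"
    and "\<forall>\<theta>\<in>\<Theta>. k (\<theta>, 0) = 0"
    and "\<sigma> > 0"
    and "continuous_on (\<Theta> \<times> UNIV) V"
    and "\<forall>\<theta>\<in>\<Theta>. Ck_on 1 UNIV (\<lambda>x. V (\<theta>, x)) \<and>
           positive_definite (\<lambda>x. V (\<theta>, x)) \<and> radially_unbounded (\<lambda>x. V (\<theta>, x))"
    and "\<forall>\<theta>\<in>\<Theta>. globally_asymptotically_stable (closed_loop_field f g k \<theta> \<theta>)"
    and "\<forall>\<theta>\<in>\<Theta>. \<forall>x. gradient (\<lambda>y. V (\<theta>, y)) x \<bullet>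
           (f (x, k (\<theta>, x)) + g (x, k (\<theta>, x)) *v \<theta>) \<le> - 2 * \<sigma> * V (\<theta>, x)"
    and "\<forall>\<Theta>'. \<Theta>' \<noteq> {} \<and> compact \<Theta>' \<and> \<Theta>' \<subseteq> \<Theta> \<longrightarrow>
           (\<forall>M\<ge>0. \<exists>R>0. \<forall>\<theta>\<in>\<Theta>'. \<forall>x. V (\<theta>, x) \<le> M \<longrightarrow> norm x \<le> R)"
    and "T > 0"
    and "continuous_on UNIV a" and "positive_definite a"
  shows "\<exists>\<omega> :: real^'l \<Rightarrow> real^'l \<Rightarrow> real \<Rightarrow> real \<Rightarrow> real.
           (\<forall>\<theta>\<in>\<Theta>. \<forall>\<theta>h0\<in>\<Theta>. class_KL (\<omega> \<theta> \<theta>h0)) \<and>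
           (\<forall>\<theta>\<in>\<Theta>. \<forall>x0. \<forall>\<theta>h0\<in>\<Theta>. \<exists>x \<theta>h \<tau>.
              hybrid_solution \<Theta> f g k V a T \<theta> x \<theta>h \<tau> \<and> x 0 = x0 \<and> \<theta>h 0 = \<theta>h0 \<and>
              time_domain \<tau> = {0..} \<and>
              (\<forall>x' \<theta>h' \<tau>'.
                 hybrid_solution \<Theta> f g k V a T \<theta> x' \<theta>h' \<tau>' \<and> x' 0 = x0 \<and> \<theta>h' 0 = \<theta>h0 \<longrightarrow>
                 \<tau>' = \<tau> \<and> (\<forall>t\<ge>0. x' t = x t \<and> \<theta>h' t = \<theta>h t)) \<and>
              (\<forall>t\<ge>0. norm (x t) \<le> \<omega> \<theta> \<theta>h0 (norm x0) t) \<and>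
              (\<exists>ts\<ge>0. \<exists>\<theta>s\<in>\<Theta>. (\<forall>t\<ge>ts. \<theta>h t = \<theta>s) \<and>
                 (\<forall>t\<ge>0. g (x t, input_signal k x \<theta>h t) *v (\<theta> - \<theta>s) = 0)) \<and>
              (\<forall>N>0. parameter_observable \<Theta> f g k N \<and> x0 \<noteq> 0 \<longrightarrow>
                 (\<forall>t\<ge>real N * T. \<theta>h t = \<theta>)))"
proof -
  have loop: "adaptive_loop \<Theta> f g k V a \<sigma> T \<theta>" if "\<theta> \<in> \<Theta>" for \<theta>
    by unfold_locales (fact assms that)+
  \<comment> \<open>The membership conditions stand inside the existential so that choice yields one
    total family \<open>\<omega>\<close>.\<close>
  have "\<exists>\<omega>. \<theta> \<in> \<Theta> \<and> \<eta> \<in> \<Theta> \<longrightarrow> class_KL \<omega> \<and>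
      (\<forall>x \<theta>h \<tau>. hybrid_solution \<Theta> f g k V a T \<theta> x \<theta>h \<tau> \<and> \<theta>h 0 = \<eta> \<longrightarrow>
        (\<forall>t\<ge>0. norm (x t) \<le> \<omega> (norm (x 0)) t))" for \<theta> \<eta>
    using adaptive_loop.hybrid_KL_bound[OF loop] by blast
  then obtain \<omega> where KL: "\<And>\<theta> \<eta>. \<theta> \<in> \<Theta> \<Longrightarrow> \<eta> \<in> \<Theta> \<Longrightarrow> class_KL (\<omega> \<theta> \<eta>)"
    and bound: "\<And>\<theta> \<eta> x \<theta>h \<tau> t. \<theta> \<in> \<Theta> \<Longrightarrow> \<eta> \<in> \<Theta> \<Longrightarrow>
      hybrid_solution \<Theta> f g k V a T \<theta> x \<theta>h \<tau> \<Longrightarrow> \<theta>h 0 = \<eta> \<Longrightarrow> 0 \<le> t \<Longrightarrow>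
      norm (x t) \<le> \<omega> \<theta> \<eta> (norm (x 0)) t"
    by metis
  show ?thesis
  proof (intro exI[of _ \<omega>] conjI ballI allI)
    show "class_KL (\<omega> \<theta> \<theta>h0)" if "\<theta> \<in> \<Theta>" "\<theta>h0 \<in> \<Theta>" for \<theta> \<theta>h0 using that by (rule KL)
    fix \<theta> x0 \<theta>h0 assume \<theta>: "\<theta> \<in> \<Theta>" and \<theta>h0: "\<theta>h0 \<in> \<Theta>"
    note loop\<theta> = loop[OF \<theta>]
    obtain x \<theta>h \<tau> where hyb: "hybrid_solution \<Theta> f g k V a T \<theta> x \<theta>h \<tau>" and init: "x 0 = x0" "\<theta>h 0 = \<theta>h0"
      using adaptive_loop.hybrid_solution_exists[OF loop\<theta> \<theta>h0] by blast
    show "\<exists>x \<theta>h \<tau>.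
        hybrid_solution \<Theta> f g k V a T \<theta> x \<theta>h \<tau> \<and> x 0 = x0 \<and> \<theta>h 0 = \<theta>h0 \<and>
        time_domain \<tau> = {0..} \<and>
        (\<forall>x' \<theta>h' \<tau>'.
           hybrid_solution \<Theta> f g k V a T \<theta> x' \<theta>h' \<tau>' \<and> x' 0 = x0 \<and> \<theta>h' 0 = \<theta>h0 \<longrightarrow>
           \<tau>' = \<tau> \<and> (\<forall>t\<ge>0. x' t = x t \<and> \<theta>h' t = \<theta>h t)) \<and>
        (\<forall>t\<ge>0. norm (x t) \<le> \<omega> \<theta> \<theta>h0 (norm x0) t) \<and>
        (\<exists>ts\<ge>0. \<exists>\<theta>s\<in>\<Theta>. (\<forall>t\<ge>ts. \<theta>h t = \<theta>s) \<and>
           (\<forall>t\<ge>0. g (x t, input_signal k x \<theta>h t) *v (\<theta> - \<theta>s) = 0)) \<and>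
        (\<forall>N>0. parameter_observable \<Theta> f g k N \<and> x0 \<noteq> 0 \<longrightarrow> (\<forall>t\<ge>real N * T. \<theta>h t = \<theta>))"
    proof (rule exI[of _ x], rule exI[of _ \<theta>h], rule exI[of _ \<tau>], intro conjI)
      show "\<forall>x' \<theta>h' \<tau>'.
          hybrid_solution \<Theta> f g k V a T \<theta> x' \<theta>h' \<tau>' \<and> x' 0 = x0 \<and> \<theta>h' 0 = \<theta>h0 \<longrightarrow>
          \<tau>' = \<tau> \<and> (\<forall>t\<ge>0. x' t = x t \<and> \<theta>h' t = \<theta>h t)"
        by (intro allI impI, elim conjE, rule adaptive_loop.hybrid_solution_unique[OF loop\<theta> hyb]) (simp_all add: init)
      show "\<forall>t\<ge>0. norm (x t) \<le> \<omega> \<theta> \<theta>h0 (norm x0) t"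
        using bound[OF \<theta> \<theta>h0 hyb init(2)] init(1) by simp
      show "\<forall>N>0. parameter_observable \<Theta> f g k N \<and> x0 \<noteq> 0 \<longrightarrow> (\<forall>t\<ge>real N * T. \<theta>h t = \<theta>)"
        using init(1) by (intro allI impI, elim conjE, intro adaptive_loop.hybrid_observable_identifies[OF loop\<theta> hyb]) simp_all
    qed (fact hyb init adaptive_loop.hybrid_time_domain[OF loop\<theta> hyb] adaptive_loop.hybrid_limit_estimate[OF loop\<theta> hyb])+
  qed
qed

thm_deps theorem4p1

end
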